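(* Let $X$ be a smooth orbifold which is contractible, i.e. all of whose orbifold homotopy groups $\pi_i^{orb}(X)$, $i\ge 1$ (at every base point), vanish. Then $X$ is a manifold, i.e. all local groups of the orbifold $X$ are trivial.
   Context: **Smooth orbifolds.** A smooth $n$-dimensional orbifold $X$ is a paracompact Hausdorff space with a (maximal) atlas of orbifold charts $(\tilde U,\Gamma,\varphi)$, where $\tilde U$ is a connected open subset of $\mathbb{R}^n$, $\Gamma$ is a finite group acting smoothly and effectively on $\tilde U$, and $\varphi:\tilde U\to U\subset X$ is a continuous $\Gamma$-invariant map inducing a homeomorphism of $\tilde U/\Gamma$ onto an open subset $U$ of $X$. The sets $U$ cover $X$. The charts are compatible in the usual sense: if $\varphi_1(\tilde x_1)=\varphi_2(\tilde x_2)$ for points $\tilde x_j\in\tilde U_j$ in two charts, then there is a diffeomorphism $h$ from a neighborhood of $\tilde x_1$ onto a neighborhood of $\tilde x_2$ with $h(\tilde x_1)=\tilde x_2$ and $\varphi_2\circ h=\varphi_1$. The local group of $X$ at $x=\varphi(\tilde x)$ is the stabilizer $\Gamma_{\tilde x}$ (well defined up to isomorphism). The orbifold $X$ is called a manifold if all its local groups are trivial. In that case the charts define a smooth manifold structure on $X$. **Orbifold homotopy groups.** Choose a Riemannian metric on $X$, i.e. $\Gamma$-invariant Riemannian metrics on the charts $\tilde U$ compatible with the changes of charts. Let $\mathrm{Fr}(X)$ be the orthonormal frame bundle of $X$, obtained by gluing the quotients $\mathrm{Fr}(\tilde U)/\Gamma$ of the orthonormal frame bundles of the charts. Since $\Gamma$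 acts freely on $\mathrm{Fr}(\tilde U)$, $\mathrm{Fr}(X)$ is a smooth manifold. It carries a smooth effective action of $O(n)$ with finite stabilizers (the stabilizers being isomorphic to the local groups of $X$) and $\mathrm{Fr}(X)/O(n)=X$. Let $E$ be a contractible CW complex on which $O(n)$ acts freely, with quotient $E/O(n)=BO(n)$ the classifying space of $O(n)$. The classifying space of $X$ is $\hat X=(\mathrm{Fr}(X)\times E)/O(n)$, with the diagonal action; up to weak homotopy equivalence it does not depend on the choices. If $X$ is orientable, one may equivalently use the oriented orthonormal frame bundle and $SO(n)$. The orbifold homotopy groups are by definition the ordinary homotopy groups of this space: $\pi_i^{orb}(X):=\pi_i(\hat X)$. *)

theory Defs
  imports "HOL-Analysis.Analysis" "HOL-Algebra.Group_Action" "HOL-Algebra.Elementary_Groups"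
begin

section \<open>Smooth maps between open subsets of Euclidean spaces\<close>

text \<open>The derivatives in all fixed directions determine the total derivative, so iterating them
  expresses \<open>C\<^sup>k\<close> without changing the codomain. The definitions are meant for open sets.\<close>

primrec Ck_on :: "nat \<Rightarrow> 'a::real_normed_vector set \<Rightarrow> ('a \<Rightarrow> 'b::real_normed_vector) \<Rightarrow> bool" where
  "Ck_on 0 S f \<longleftrightarrow> continuous_on S f"
| "Ck_on (Suc k) S f \<longleftrightarrow>
     (\<forall>x\<in>S. f differentiable (at x)) \<and> (\<forall>v. Ck_on k S (\<lambda>x. frechet_derivative f (at x) v))"

definition smooth_on :: "'a::real_normed_vector set \<Rightarrow> ('a \<Rightarrow> 'b::real_normed_vector) \<Rightarrow> bool" where
  "smooth_on S f \<longleftrightarrow> (\<forall>k. Ck_on k S f)"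

definition diffeomorphism ::
  "'a::real_normed_vector set \<Rightarrow> 'b::real_normed_vector set \<Rightarrow> ('a \<Rightarrow> 'b) \<Rightarrow> bool" where
  "diffeomorphism V W h \<longleftrightarrow>
     bij_betw h V W \<and> smooth_on V h \<and> smooth_on W (inv_into V h)"


section \<open>Quotient topologies and paracompactness\<close>

text \<open>The final topology on the image of \<open>q\<close>. It is used with \<open>q\<close> sending a point to its
  equivalence class or to its orbit.\<close>

definition quotient_topology :: "'a topology \<Rightarrow> ('a \<Rightarrow> 'b) \<Rightarrow> 'b topology" where
  "quotient_topology T q =
     topology (\<lambda>U. U \<subseteq> q ` topspace T \<and> openin T {x \<in> topspace T. q x \<in> U})"

lemma openin_quotient_topology:
  "openin (quotient_topology T q) U \<longleftrightarrow>
     U \<subseteq> q ` topspace T \<and> openin T {x \<in> topspace T. q x \<in> U}"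
proof -
  have "istopology (\<lambda>U. U \<subseteq> q ` topspace T \<and> openin T {x \<in> topspace T. q x \<in> U})"
    unfolding istopology_def
  proof (intro conjI allI impI)
    fix S U assume "S \<subseteq> q ` topspace T \<and> openin T {x \<in> topspace T. q x \<in> S}"
      and "U \<subseteq> q ` topspace T \<and> openin T {x \<in> topspace T. q x \<in> U}"
    moreover have "{x \<in> topspace T. q x \<in> S \<inter> U} =
        {x \<in> topspace T. q x \<in> S} \<inter> {x \<in> topspace T. q x \<in> U}" by auto
    ultimately show "S \<inter> U \<subseteq> q ` topspace T" "openin T {x \<in> topspace T. q x \<in> S \<inter> U}"
      by auto
  next
    fix K assume K: "\<forall>S\<in>K. S \<subseteq> q ` topspace T \<and> openin T {x \<in> topspace T. q x \<in> S}"
    then show "\<Union>K \<subseteq> q ` topspace T" by auto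
    have "{x \<in> topspace T. q x \<in> \<Union>K} = (\<Union>S\<in>K. {x \<in> topspace T. q x \<in> S})" by auto
    then show "openin T {x \<in> topspace T. q x \<in> \<Union>K}" using K by auto
  qed
  then show ?thesis by (simp add: quotient_topology_def)
qed

lemma topspace_quotient_topology [simp]: "topspace (quotient_topology T q) = q ` topspace T"
proof -
  have "{x \<in> topspace T. q x \<in> q ` topspace T} = topspace T" by auto
  then have "openin (quotient_topology T q) (q ` topspace T)"
    by (simp add: openin_quotient_topology)
  then show ?thesis
    by (metis openin_quotient_topology openin_subset openin_topspace subset_antisym)
qed

lemma quotient_map_quotient_topology: "quotient_map T (quotient_topology T q) q"
  by (auto simp: quotient_map_def openin_quotient_topology)

definition paracompact_space :: "'a topology \<Rightarrow> bool" where
  "paracompact_space X \<longleftrightarrow>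
     (\<forall>\<U>. (\<forall>U\<in>\<U>. openin X U) \<and> \<Union>\<U> = topspace X \<longrightarrow>
        (\<exists>\<V>. (\<forall>V\<in>\<V>. openin X V \<and> (\<exists>U\<in>\<U>. V \<subseteq> U)) \<and> \<Union>\<V> = topspace X \<and>
             locally_finite_in X \<V>))"


section \<open>Smooth orbifolds\<close>

record ('n::finite, 'g, 'x) orbifold_chart =
  chart_dom :: "(real^'n) set"
  chart_group :: "'g monoid"
  chart_act :: "'g \<Rightarrow> real^'n \<Rightarrow> real^'n"
  chart_map :: "real^'n \<Rightarrow> 'x"

text \<open>The map induced by \<open>chart_map\<close> on the orbit space sends an orbit, which is mapped to a single
  point by invariance, to that point.\<close>

definition orbifold_chart :: "'x topology \<Rightarrow> ('n::finite, 'g, 'x) orbifold_chart \<Rightarrow> bool" where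
  "orbifold_chart X c \<longleftrightarrow>
     open (chart_dom c) \<and> connected (chart_dom c) \<and>
     finite (carrier (chart_group c)) \<and>
     faithful_action (chart_group c) (chart_dom c) (chart_act c) \<and>
     (\<forall>\<gamma>\<in>carrier (chart_group c). smooth_on (chart_dom c) (chart_act c \<gamma>)) \<and>
     continuous_map (top_of_set (chart_dom c)) X (chart_map c) \<and>
     (\<forall>\<gamma>\<in>carrier (chart_group c). \<forall>x\<in>chart_dom c. chart_map c (chart_act c \<gamma> x) = chart_map c x) \<and>
     openin X (chart_map c ` chart_dom c) \<and>
     homeomorphic_map
       (quotient_topology (top_of_set (chart_dom c)) (orbit (chart_group c) (chart_act c)))
       (subtopology X (chart_map c ` chart_dom c))
       (\<lambda>p. the_elem (chart_map c ` p))"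

definition chart_change ::
  "('n::finite, 'g, 'x) orbifold_chart \<Rightarrow> ('n, 'g, 'x) orbifold_chart \<Rightarrow>
   (real^'n) set \<Rightarrow> (real^'n) set \<Rightarrow> (real^'n \<Rightarrow> real^'n) \<Rightarrow> bool" where
  "chart_change c d V W h \<longleftrightarrow>
     open V \<and> V \<subseteq> chart_dom c \<and> open W \<and> W \<subseteq> chart_dom d \<and> diffeomorphism V W h \<and>
     (\<forall>x\<in>V. chart_map d (h x) = chart_map c x)"

text \<open>The atlas is not required to be maximal; maximal atlases are included.\<close>

definition smooth_orbifold :: "'x topology \<Rightarrow> ('n::finite, 'g, 'x) orbifold_chart set \<Rightarrow> bool" where
  "smooth_orbifold X \<A> \<longleftrightarrow>
     Hausdorff_space X \<and> paracompact_space X \<and>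
     (\<forall>c\<in>\<A>. orbifold_chart X c) \<and>
     (\<Union>c\<in>\<A>. chart_map c ` chart_dom c) = topspace X \<and>
     (\<forall>c\<in>\<A>. \<forall>d\<in>\<A>. \<forall>x\<in>chart_dom c. \<forall>y\<in>chart_dom d. chart_map c x = chart_map d y \<longrightarrow>
        (\<exists>V W h. chart_change c d V W h \<and> x \<in> V \<and> y \<in> W \<and> h x = y))"

text \<open>The local group at \<open>chart_map c x\<close>.\<close>

definition local_group :: "('n::finite, 'g, 'x) orbifold_chart \<Rightarrow> real^'n \<Rightarrow> 'g monoid" where
  "local_group c x =
     (chart_group c)\<lparr>carrier := stabilizer (chart_group c) (chart_act c) x\<rparr>"

definition orbifold_is_manifold :: "('n::finite, 'g, 'x) orbifold_chart set \<Rightarrow> bool" where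
  "orbifold_is_manifold \<A> \<longleftrightarrow> (\<forall>c\<in>\<A>. \<forall>x\<in>chart_dom c. trivial_group (local_group c x))"


section \<open>Riemannian metrics and the orthonormal frame bundle\<close>

text \<open>\<open>g c x\<close> is the Gram matrix of the metric at \<open>x\<close> in the chart \<open>c\<close>.\<close>

definition orbifold_metric ::
  "('n::finite, 'g, 'x) orbifold_chart set \<Rightarrow>
   (('n, 'g, 'x) orbifold_chart \<Rightarrow> real^'n \<Rightarrow> real^'n^'n) \<Rightarrow> bool" where
  "orbifold_metric \<A> g \<longleftrightarrow>
     (\<forall>c\<in>\<A>. smooth_on (chart_dom c) (g c) \<and>
        (\<forall>x\<in>chart_dom c. transpose (g c x) = g c x \<and> (\<forall>v. v \<noteq> 0 \<longrightarrow> v \<bullet> (g c x *v v) > 0)) \<and>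
        (\<forall>\<gamma>\<in>carrier (chart_group c). \<forall>x\<in>chart_dom c.
           transpose (jacobian (chart_act c \<gamma>) (at x)) ** g c (chart_act c \<gamma> x) **
             jacobian (chart_act c \<gamma>) (at x) = g c x)) \<and>
     (\<forall>c\<in>\<A>. \<forall>d\<in>\<A>. \<forall>V W h. chart_change c d V W h \<longrightarrow>
        (\<forall>x\<in>V. transpose (jacobian h (at x)) ** g d (h x) ** jacobian h (at x) = g c x))"

text \<open>A frame at \<open>x\<close> is the matrix having the frame vectors as columns.\<close>

definition chart_frames ::
  "(('n::finite, 'g, 'x) orbifold_chart \<Rightarrow> real^'n \<Rightarrow> real^'n^'n) \<Rightarrow>
   ('n, 'g, 'x) orbifold_chart \<Rightarrow> ((real^'n) \<times> (real^'n^'n)) topology" where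
  "chart_frames g c = top_of_set {(x, F). x \<in> chart_dom c \<and> transpose F ** g c x ** F = mat 1}"

text \<open>The gluing relation on the disjoint union of the frame bundles of the charts. Since each
  element of a chart group is itself a change of charts (from the chart to itself, see
  \<open>chart_change_act\<close>), this relation includes passing to the quotients by the chart groups.\<close>

definition frame_rel ::
  "('n::finite, 'g, 'x) orbifold_chart set \<Rightarrow>
   (('n, 'g, 'x) orbifold_chart \<Rightarrow> real^'n \<Rightarrow> real^'n^'n) \<Rightarrow>
   ((('n, 'g, 'x) orbifold_chart \<times> (real^'n) \<times> (real^'n^'n)) \<times>
    (('n, 'g, 'x) orbifold_chart \<times> (real^'n) \<times> (real^'n^'n))) set" where
  "frame_rel \<A> g =
     {((c, x, F), (d, y, G)).
        (c, x, F) \<in> topspace (sum_topology (chart_frames g) \<A>) \<and>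
        (d, y, G) \<in> topspace (sum_topology (chart_frames g) \<A>) \<and>
        (\<exists>V W h. chart_change c d V W h \<and> x \<in> V \<and> h x = y \<and> jacobian h (at x) ** F = G)}"

definition frame_bundle ::
  "('n::finite, 'g, 'x) orbifold_chart set \<Rightarrow>
   (('n, 'g, 'x) orbifold_chart \<Rightarrow> real^'n \<Rightarrow> real^'n^'n) \<Rightarrow>
   (('n, 'g, 'x) orbifold_chart \<times> (real^'n) \<times> (real^'n^'n)) set topology" where
  "frame_bundle \<A> g =
     quotient_topology (sum_topology (chart_frames g) \<A>) (\<lambda>p. frame_rel \<A> g `` {p})"

lemma inv_into_chart_act:
  assumes "group_action G E \<phi>" "a \<in> carrier G" "x \<in> E"
  shows "inv_into E (\<phi> a) x = \<phi> (inv\<^bsub>G\<^esub> a) x"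
proof -
  interpret group_action G E \<phi> by fact
  interpret G: group G using group_hom group_hom.axioms(1) by blast
  have "\<phi> (inv\<^bsub>G\<^esub> a) x \<in> E" using assms surj_prop[of "inv\<^bsub>G\<^esub> a"] by auto
  moreover have "\<phi> a (\<phi> (inv\<^bsub>G\<^esub> a) x) = x"
    using assms composition_rule[of x a "inv\<^bsub>G\<^esub> a"] id_eq_one
    by (metis G.inv_closed G.r_inv restrict_apply')
  ultimately show ?thesis
    using inj_prop[OF assms(2)] by (metis inv_into_f_f)
qed

lemma Ck_on_cong:
  assumes "open S" "\<And>x. x \<in> S \<Longrightarrow> f x = f' x" "Ck_on k S f"
  shows "Ck_on k S f'"
  using assms
proof (induction k arbitrary: f f')
  case 0
  then show ?case by (auto cong: continuous_on_cong)
next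
  case (Suc k)
  have iff: "(f has_derivative D) (at x) \<longleftrightarrow> (f' has_derivative D) (at x)" if "x \<in> S" for x D
    using has_derivative_transform_within_open[OF _ Suc.prems(1) that, of f D UNIV f']
      has_derivative_transform_within_open[OF _ Suc.prems(1) that, of f' D UNIV f] Suc.prems(2)
    by metis
  then have "frechet_derivative f (at x) = frechet_derivative f' (at x)" if "x \<in> S" for x
    using that by (simp add: frechet_derivative_def)
  then have "Ck_on k S (\<lambda>x. frechet_derivative f' (at x) v)" for v
    using Suc.IH[OF Suc.prems(1), of "\<lambda>x. frechet_derivative f (at x) v"] Suc.prems(3) by simp
  then show ?case
    using iff Suc.prems(3) by (auto simp: differentiable_def)
qed

lemma chart_change_act:
  assumes "orbifold_chart X c" "\<gamma> \<in> carrier (chart_group c)"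
  shows "chart_change c c (chart_dom c) (chart_dom c) (chart_act c \<gamma>)"
proof -
  have ga: "group_action (chart_group c) (chart_dom c) (chart_act c)"
    and op: "open (chart_dom c)"
    using assms by (auto simp: orbifold_chart_def faithful_action_def)
  interpret group_action "chart_group c" "chart_dom c" "chart_act c" by fact
  interpret G: group "chart_group c" using group_hom group_hom.axioms(1) by blast
  have "smooth_on (chart_dom c) (chart_act c (inv\<^bsub>chart_group c\<^esub> \<gamma>))"
    using assms by (auto simp: orbifold_chart_def)
  then have "smooth_on (chart_dom c) (inv_into (chart_dom c) (chart_act c \<gamma>))"
    using inv_into_chart_act[OF ga assms(2)] Ck_on_cong[OF op]
    unfolding smooth_on_def by metis
  moreover have "bij_betw (chart_act c \<gamma>) (chart_dom c) (chart_dom c)"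
    using inj_prop surj_prop assms(2) by (simp add: bij_betw_def)
  ultimately show ?thesis
    using assms by (auto simp: chart_change_def diffeomorphism_def orbifold_chart_def)
qed


section \<open>CW complexes\<close>

definition closed_disc :: "nat \<Rightarrow> (nat \<Rightarrow> real) topology" where
  "closed_disc k = subtopology (Euclidean_space k) {x. (\<Sum>i<k. (x i)\<^sup>2) \<le> 1}"

definition disc_interior :: "nat \<Rightarrow> (nat \<Rightarrow> real) set" where
  "disc_interior k = {x \<in> topspace (Euclidean_space k). (\<Sum>i<k. (x i)\<^sup>2) < 1}"

definition disc_boundary :: "nat \<Rightarrow> (nat \<Rightarrow> real) set" where
  "disc_boundary k = {x \<in> topspace (Euclidean_space k). (\<Sum>i<k. (x i)\<^sup>2) = 1}"

text \<open>\<open>K\<close> is the set of cells, each given by its dimension and its characteristic map.\<close>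

definition CW_complex :: "'e topology \<Rightarrow> bool" where
  "CW_complex E \<longleftrightarrow> Hausdorff_space E \<and>
     (\<exists>K :: (nat \<times> ((nat \<Rightarrow> real) \<Rightarrow> 'e)) set.
        (\<forall>(k, \<Phi>)\<in>K. continuous_map (closed_disc k) E \<Phi> \<and>
           embedding_map (subtopology (closed_disc k) (disc_interior k)) E \<Phi> \<and>
           (\<exists>L\<subseteq>K. finite L \<and> (\<forall>(l, \<Psi>)\<in>L. l < k) \<and>
              \<Phi> ` disc_boundary k \<subseteq> (\<Union>(l, \<Psi>)\<in>L. \<Psi> ` disc_interior l))) \<and>
        pairwise (\<lambda>(k, \<Phi>) (l, \<Psi>). disjnt (\<Phi> ` disc_interior k) (\<Psi> ` disc_interior l)) K \<and>
        (\<Union>(k, \<Phi>)\<in>K. \<Phi> ` disc_interior k) = topspace E \<and>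
        (\<forall>C\<subseteq>topspace E. closedin E C \<longleftrightarrow>
           (\<forall>(k, \<Phi>)\<in>K. closedin (closed_disc k) {t \<in> topspace (closed_disc k). \<Phi> t \<in> C})))"


section \<open>The classifying space of an orbifold\<close>

definition orthogonal_group :: "(real^'n^'n) monoid" where
  "orthogonal_group = \<lparr>carrier = {Q. orthogonal_matrix Q}, mult = (**), one = mat 1\<rparr>"

text \<open>A contractible CW complex with a free action of \<open>O(n)\<close>, so that its quotient is \<open>BO(n)\<close>.
  Nonemptiness is explicit since \<^const>\<open>contractible_space\<close> holds for the empty space.\<close>

definition universal_orthogonal_space ::
  "'e topology \<Rightarrow> (real^'n^'n \<Rightarrow> 'e \<Rightarrow> 'e) \<Rightarrow> bool" where
  "universal_orthogonal_space E \<sigma> \<longleftrightarrow>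
     CW_complex E \<and> contractible_space E \<and> topspace E \<noteq> {} \<and>
     group_action orthogonal_group (topspace E) \<sigma> \<and>
     continuous_map (prod_topology (top_of_set {Q. orthogonal_matrix Q}) E) E (\<lambda>(Q, e). \<sigma> Q e) \<and>
     (\<forall>Q\<in>carrier orthogonal_group. \<forall>e\<in>topspace E. \<sigma> Q e = e \<longrightarrow> Q = mat 1)"

text \<open>\<open>O(n)\<close> acts on frames from the right by \<open>F \<mapsto> F Q\<close>. Here \<open>Q\<close> acts through its inverse, which
  gives a left action; on classes of frames it acts elementwise.\<close>

definition frame_act ::
  "real^'n^'n \<Rightarrow> (('n::finite, 'g, 'x) orbifold_chart \<times> (real^'n) \<times> (real^'n^'n)) set \<Rightarrow>
   (('n, 'g, 'x) orbifold_chart \<times> (real^'n) \<times> (real^'n^'n)) set" where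
  "frame_act Q P = (\<lambda>(c, x, F). (c, x, F ** transpose Q)) ` P"

definition classifying_space ::
  "('n::finite, 'g, 'x) orbifold_chart set \<Rightarrow>
   (('n, 'g, 'x) orbifold_chart \<Rightarrow> real^'n \<Rightarrow> real^'n^'n) \<Rightarrow>
   'e topology \<Rightarrow> (real^'n^'n \<Rightarrow> 'e \<Rightarrow> 'e) \<Rightarrow>
   ((('n, 'g, 'x) orbifold_chart \<times> (real^'n) \<times> (real^'n^'n)) set \<times> 'e) set topology" where
  "classifying_space \<A> g E \<sigma> =
     quotient_topology (prod_topology (frame_bundle \<A> g) E)
       (orbit orthogonal_group (\<lambda>Q (P, e). (frame_act Q P, \<sigma> Q e)))"


section \<open>Homotopy groups\<close>

definition cube :: "nat \<Rightarrow> (nat \<Rightarrow> real) topology" where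
  "cube i = subtopology (Euclidean_space i) {t. \<forall>j<i. 0 \<le> t j \<and> t j \<le> 1}"

definition cube_boundary :: "nat \<Rightarrow> (nat \<Rightarrow> real) set" where
  "cube_boundary i = {t \<in> topspace (cube i). \<exists>j<i. t j = 0 \<or> t j = 1}"

definition spheroids :: "nat \<Rightarrow> 'a topology \<Rightarrow> 'a \<Rightarrow> ((nat \<Rightarrow> real) \<Rightarrow> 'a) set" where
  "spheroids i Y y = {f. continuous_map (cube i) Y f \<and> (\<forall>t\<in>cube_boundary i. f t = y)}"

definition spheroid_homotopy ::
  "nat \<Rightarrow> 'a topology \<Rightarrow> 'a \<Rightarrow> (((nat \<Rightarrow> real) \<Rightarrow> 'a) \<times> ((nat \<Rightarrow> real) \<Rightarrow> 'a)) set" where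
  "spheroid_homotopy i Y y =
     {(f, f'). homotopic_with (\<lambda>h. \<forall>t\<in>cube_boundary i. h t = y) (cube i) Y f f'}"

definition spheroid_concat ::
  "((nat \<Rightarrow> real) \<Rightarrow> 'a) \<Rightarrow> ((nat \<Rightarrow> real) \<Rightarrow> 'a) \<Rightarrow> (nat \<Rightarrow> real) \<Rightarrow> 'a" where
  "spheroid_concat f f' t =
     (if t 0 \<le> 1/2 then f (t(0 := 2 * t 0)) else f' (t(0 := 2 * t 0 - 1)))"

text \<open>The homotopy group \<open>\<pi>\<^sub>i\<close> of \<open>Y\<close> at \<open>y\<close>, meaningful for \<open>i \<ge> 1\<close>.\<close>

definition homotopy_group :: "nat \<Rightarrow> 'a topology \<Rightarrow> 'a \<Rightarrow> ((nat \<Rightarrow> real) \<Rightarrow> 'a) set monoid" where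
  "homotopy_group i Y y =
     \<lparr>carrier = spheroids i Y y // spheroid_homotopy i Y y,
      mult = (\<lambda>a b. \<Union>f\<in>a. \<Union>f'\<in>b. spheroid_homotopy i Y y `` {spheroid_concat f f'}),
      one = spheroid_homotopy i Y y `` {\<lambda>_. y}\<rparr>"

lemma equiv_spheroid_homotopy: "equiv (spheroids i Y y) (spheroid_homotopy i Y y)"
proof (rule equivI)
  show "spheroid_homotopy i Y y \<subseteq> spheroids i Y y \<times> spheroids i Y y"
    by (auto simp: spheroid_homotopy_def spheroids_def
        dest: homotopic_with_imp_continuous_maps homotopic_with_imp_property)
  show "refl_on (spheroids i Y y) (spheroid_homotopy i Y y)"
    by (auto simp: refl_on_def spheroid_homotopy_def spheroids_def)
  show "sym (spheroid_homotopy i Y y)"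
    by (auto simp: sym_def spheroid_homotopy_def homotopic_with_sym)
  show "trans (spheroid_homotopy i Y y)"
    by (auto simp: trans_def spheroid_homotopy_def intro: homotopic_with_trans)
qed

lemma trivial_homotopy_group_iff:
  assumes "y \<in> topspace Y"
  shows "trivial_group (homotopy_group i Y y) \<longleftrightarrow>
           (\<forall>f\<in>spheroids i Y y. (f, \<lambda>_. y) \<in> spheroid_homotopy i Y y)"
proof -
  let ?R = "spheroid_homotopy i Y y" and ?S = "spheroids i Y y" and ?G = "homotopy_group i Y y"
  let ?k = "\<lambda>_ :: nat \<Rightarrow> real. y"
  note eqv = equiv_spheroid_homotopy[of i Y y]
  have k: "?k \<in> ?S" using assms by (auto simp: spheroids_def)
  have car: "carrier ?G = {\<one>\<^bsub>?G\<^esub>} \<longleftrightarrow> (\<forall>f\<in>?S. (f, ?k) \<in> ?R)"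
  proof
    assume "carrier ?G = {\<one>\<^bsub>?G\<^esub>}"
    moreover have "\<forall>f\<in>?S. ?R `` {f} \<in> carrier ?G"
      by (simp add: homotopy_group_def quotientI)
    ultimately have "\<forall>f\<in>?S. ?R `` {f} = ?R `` {?k}"
      by (simp add: homotopy_group_def)
    then show "\<forall>f\<in>?S. (f, ?k) \<in> ?R" using eq_equiv_class[OF _ eqv k] by blast
  next
    assume "\<forall>f\<in>?S. (f, ?k) \<in> ?R"
    then have "?S // ?R \<subseteq> {?R `` {?k}}"
      using equiv_class_eq[OF eqv] by (blast elim: quotientE)
    moreover have "?R `` {?k} \<in> ?S // ?R" using k by (rule quotientI)
    ultimately show "carrier ?G = {\<one>\<^bsub>?G\<^esub>}" unfolding homotopy_group_def by simp blast
  qed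
  have "group ?G" if c: "carrier ?G = {\<one>\<^bsub>?G\<^esub>}"
  proof -
    let ?o = "?R `` {?k}"
    have one: "\<one>\<^bsub>?G\<^esub> = ?o" by (simp add: homotopy_group_def)
    have sym: "sym ?R" using eqv by (simp add: equiv_def)
    have all: "f \<in> ?o" if "f \<in> ?S" for f
    proof -
      have "(f, ?k) \<in> ?R" using c car that by blast
      then show ?thesis using symD[OF sym] by blast
    qed
    have sub: "?R `` {f} \<subseteq> ?o" for f
      using all eqv by (auto simp: equiv_def)
    have "spheroid_concat ?k ?k = ?k" by (simp add: spheroid_concat_def fun_eq_iff)
    then have "?o \<subseteq> (\<Union>f\<in>?o. \<Union>f'\<in>?o. ?R `` {spheroid_concat f f'})"
      using all[OF k] by fastforce
    moreover have "(\<Union>f\<in>?o. \<Union>f'\<in>?o. ?R `` {spheroid_concat f f'}) \<subseteq> ?o"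
      using sub by (intro UN_least)
    ultimately have "(\<Union>f\<in>?o. \<Union>f'\<in>?o. ?R `` {spheroid_concat f f'}) = ?o"
      by (rule subset_antisym[OF _ _, rotated])
    then have "\<one>\<^bsub>?G\<^esub> \<otimes>\<^bsub>?G\<^esub> \<one>\<^bsub>?G\<^esub> = \<one>\<^bsub>?G\<^esub>"
      by (simp add: homotopy_group_def)
    then show ?thesis by (intro groupI) (simp_all add: c)
  qed
  then show ?thesis using car unfolding trivial_group_def by blast
qed

definition orbifold_homotopy_group ::
  "nat \<Rightarrow> ('n::finite, 'g, 'x) orbifold_chart set \<Rightarrow>
   (('n, 'g, 'x) orbifold_chart \<Rightarrow> real^'n \<Rightarrow> real^'n^'n) \<Rightarrow>
   'e topology \<Rightarrow> (real^'n^'n \<Rightarrow> 'e \<Rightarrow> 'e) \<Rightarrow>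
   ((('n, 'g, 'x) orbifold_chart \<times> (real^'n) \<times> (real^'n^'n)) set \<times> 'e) set \<Rightarrow>
   ((nat \<Rightarrow> real) \<Rightarrow> ((('n, 'g, 'x) orbifold_chart \<times> (real^'n) \<times> (real^'n^'n)) set \<times> 'e) set) set monoid"
  where
  "orbifold_homotopy_group i \<A> g E \<sigma> y = homotopy_group i (classifying_space \<A> g E \<sigma>) y"

definition contractible_orbifold ::
  "('n::finite, 'g, 'x) orbifold_chart set \<Rightarrow>
   (('n, 'g, 'x) orbifold_chart \<Rightarrow> real^'n \<Rightarrow> real^'n^'n) \<Rightarrow>
   'e topology \<Rightarrow> (real^'n^'n \<Rightarrow> 'e \<Rightarrow> 'e) \<Rightarrow> bool" where
  "contractible_orbifold \<A> g E \<sigma> \<longleftrightarrow>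
     (\<forall>i\<ge>1. \<forall>y\<in>topspace (classifying_space \<A> g E \<sigma>).
        trivial_group (orbifold_homotopy_group i \<A> g E \<sigma> y))"

end

theory Submission
  imports Defs "HOL-Homology.Homology" "HOL-Algebra.Multiplicative_Group"
begin

text \<open>Suppose that \<open>\<gamma> \<noteq> 1\<close> fixes the point \<open>x\<close> of a chart, let \<open>q\<close> be the principal \<open>O(n)\<close>-bundle from
  \<open>P = Fr(X) \<times> E\<close> to the classifying space, and let \<open>A\<close> be the orthogonal matrix by which the
  derivative of \<open>\<gamma>\<close> acts on a frame at \<open>x\<close>. It has finite order \<open>m \<ge> 2\<close>, because a diffeomorphism
  of finite order with trivial derivative at a fixed point is the identity, and it acts freely on
  \<open>P\<close> over the classifying space. The copy of \<open>E\<close> over \<open>x\<close> is a contractible \<open>A\<close>-invariant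
  subspace of \<open>P\<close>, so a point of it starts arbitrarily long sequences of singular chains \<open>c\<^sub>n\<close> in \<open>P\<close>
  with \<open>\<partial>c\<^sub>n\<^sub>+\<^sub>1\<close> equal to \<open>(t - 1) c\<^sub>n\<close> for even \<open>n\<close> and \<open>(1 + t + \<dots> + t\<^bsup>m-1\<^esup>) c\<^sub>n\<close> for odd
  \<open>n\<close>, where \<open>t\<close> is the action of \<open>A\<close>. If the classifying space is weakly contractible, its
  singular simplices can be contracted compatibly with faces; lifting the contractions moves the
  sequence into a fibre of \<open>q\<close>. But a fibre is compact, so it is covered by finitely many invariant
  open sets on which \<open>t\<close> looks like a translation of the cyclic group. This bounds the length of such
  a sequence unless the augmentation of \<open>c\<^sub>0\<close> is a multiple of \<open>m\<close>, and the augmentation of a point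
  is 1.\<close>

text \<open>The homotopy-theoretic reason: \<open>E\<close> modulo \<open>A\<close> is a classifying
  space of the cyclic group of order \<open>m\<close>. As \<open>t\<close> is translation by an
  element of the structure group, it preserves every fibre of \<open>q\<close>; so if the base were
  weakly contractible, this classifying space would map, compatibly with the coverings, to a fibre
  modulo \<open>A\<close>. That is a compact manifold of finite cohomological dimension, while the
  cyclic group has cohomology in arbitrarily high degrees. The sequences of chains carry this out by
  hand: such a sequence is a map out of the periodic resolution, and the augmentation of its first
  chain modulo \<open>m\<close> is the class that obstructs, a generator for a single point. Two
  obstacles shape the proof. The contractions lifted from the base are not equivariant, so moving a
  sequence into the fibre has to correct for this degree by degree. And the number of degrees
  required is the number of open sets covering the fibre, which is known only after the move;
  therefore one sequence of unbounded length is carried along.\<close>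

lemma singular_chain_induct [consumes 1, case_names zero simplex diff]:
  assumes "singular_chain k X c" "P 0" "\<And>f. singular_simplex k X f \<Longrightarrow> P (frag_of f)"
    "\<And>a b. \<lbrakk>P a; P b\<rbrakk> \<Longrightarrow> P (a - b)"
  shows "P c"
  using assms(1) unfolding singular_chain_def
  by (induction c rule: frag_induction) (use assms(2-) in auto)

section \<open>Augmentation and iterated subdivision of singular chains\<close>

abbreviation simplex_vertex :: "nat \<Rightarrow> real" where
  "simplex_vertex \<equiv> \<lambda>j. if j = 0 then 1 else 0"

lemma simplex_vertex_in: "simplex_vertex \<in> standard_simplex p"
  by (simp add: basis_in_standard_simplex)

text \<open>The type \<open>unit\<close> admits only one simplex, so \<open>unit chain\<close> is a
  copy of the integers. As a push-forward the augmentation inherits naturality from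
  \<open>chain_map\<close>.\<close>

definition aug :: "'a chain \<Rightarrow> unit chain" where
  "aug = chain_map 0 (\<lambda>_. ())"

lemma aug_simps [simp]:
  "aug 0 = 0" "aug (a + b) = aug a + aug b" "aug (a - b) = aug a - aug b" "aug (- a) = - aug a"
  by (simp_all add: aug_def chain_map_add chain_map_diff chain_map_minus)

lemma aug_sum: "finite I \<Longrightarrow> aug (sum f I) = (\<Sum>i\<in>I. aug (f i))"
  by (simp add: aug_def chain_map_sum)

lemma aug_chain_map [simp]: "aug (chain_map 0 g c) = aug c"
proof -
  have "chain_map 0 (\<lambda>_. ()) (chain_map 0 g c) = chain_map 0 ((\<lambda>_. ()) \<circ> g) c"
    by (metis chain_map_compose comp_apply)
  then show ?thesis by (simp add: aug_def o_def)
qed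

text \<open>After the push-forward to a point both endpoints of a 1-simplex coincide and
  cancel.\<close>

lemma aug_boundary:
  assumes "singular_chain (Suc 0) X c"
  shows "aug (chain_boundary (Suc 0) c) = 0"
proof -
  let ?U = "discrete_topology {()}"
  have cm: "continuous_map X ?U (\<lambda>_. ())" by (simp add: continuous_map_def)
  have "aug (chain_boundary (Suc 0) c) = chain_boundary (Suc 0) (chain_map (Suc 0) (\<lambda>_. ()) c)"
    using chain_boundary_chain_map[OF assms, of "\<lambda>_. ()"] by (simp add: aug_def)
  also have "\<dots> = 0"
    using chain_boundary_of_singleton[of ?U "()" "Suc 0"] singular_chain_chain_map[OF assms cm]
    by simp
  finally show ?thesis .
qed

lemma singular_subdivision_power_zero:
  "singular_chain 0 X c \<Longrightarrow> (singular_subdivision 0 ^^ n) c = c"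
  by (induction n) (auto simp: singular_subdivision_zero)

lemma singular_chain_subdivision_power:
  "singular_chain k X c \<Longrightarrow> singular_chain k X ((singular_subdivision k ^^ n) c)"
  by (induction n) (auto simp: singular_chain_singular_subdivision)

lemma chain_boundary_subdivision_power:
  "singular_chain k X c \<Longrightarrow>
    chain_boundary k ((singular_subdivision k ^^ n) c) =
      (singular_subdivision (k - Suc 0) ^^ n) (chain_boundary k c)"
  by (induction n)
    (auto simp: chain_boundary_singular_subdivision[OF singular_chain_subdivision_power])

lemma naturality_subdivision_power:
  "singular_chain k X c \<Longrightarrow>
    (singular_subdivision k ^^ n) (chain_map k g c) = chain_map k g ((singular_subdivision k ^^ n) c)"
  by (induction n) (auto simp: naturality_singular_subdivision[OF singular_chain_subdivision_power])

lemma subdivision_power_add: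
  "(singular_subdivision k ^^ n) (a + b) = (singular_subdivision k ^^ n) a + (singular_subdivision k ^^ n) b"
  by (induction n) (auto simp: singular_subdivision_add)

lemma subdivision_power_sum:
  "finite I \<Longrightarrow> (singular_subdivision k ^^ n) (sum f I) = (\<Sum>i\<in>I. (singular_subdivision k ^^ n) (f i))"
  by (induction I rule: finite_induct) (auto simp: subdivision_power_add)

text \<open>The alternating multiplications \<open>t - 1\<close> and \<open>1 + t + \<dots> + t\<^bsup>m-1\<^esup>\<close> of the periodic resolution
  of the integers over the group ring of a cyclic group of order \<open>m\<close>.\<close>

definition periodic :: "('a \<Rightarrow> 'a) \<Rightarrow> nat \<Rightarrow> nat \<Rightarrow> nat \<Rightarrow> 'a chain \<Rightarrow> 'a chain" where
  "periodic t m n k c =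
     (if odd n then chain_map k t c - c else (\<Sum>i<m. chain_map k (t ^^ i) c))"

text \<open>Such a sequence is an equivariant chain map out of the periodic resolution, truncated at
  degree \<open>K\<close>: \<open>c n\<close> is the image of the generator of degree
  \<open>n\<close>. The parity index of \<open>periodic\<close> is the degree of the generator whose
  boundary is taken, so the boundary of \<open>c 1\<close> is \<open>t - 1\<close> applied to
  \<open>c 0\<close>.\<close>

definition tower :: "'a topology \<Rightarrow> ('a \<Rightarrow> 'a) \<Rightarrow> nat \<Rightarrow> nat \<Rightarrow> (nat \<Rightarrow> 'a chain) \<Rightarrow> bool" where
  "tower X t m K c \<longleftrightarrow> (\<forall>n\<le>K. singular_chain n X (c n)) \<and>
     (\<forall>n<K. chain_boundary (Suc n) (c (Suc n)) = periodic t m (Suc n) n (c n))"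

lemma periodic_0 [simp]: "periodic t m n k 0 = 0"
  by (simp add: periodic_def)

lemma periodic_add: "periodic t m n k (a + b) = periodic t m n k a + periodic t m n k b"
  by (simp add: periodic_def chain_map_add sum.distrib)

lemma periodic_diff: "periodic t m n k (a - b) = periodic t m n k a - periodic t m n k b"
  by (simp add: periodic_def chain_map_diff sum_subtractf)

lemma continuous_map_funpow: "continuous_map X X t \<Longrightarrow> continuous_map X X (t ^^ i)"
  by (induction i) (auto intro: continuous_map_compose)

lemma singular_chain_periodic:
  assumes "continuous_map X X t" "singular_chain k X c"
  shows "singular_chain k X (periodic t m n k c)"
  using assms continuous_map_funpow[OF assms(1)]
  by (auto simp: periodic_def intro!: singular_chain_diff singular_chain_sum singular_chain_chain_map)

lemma chain_boundary_periodic: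
  assumes "singular_chain k X c"
  shows "chain_boundary k (periodic t m n k c) = periodic t m n (k - Suc 0) (chain_boundary k c)"
  by (auto simp: periodic_def chain_boundary_diff chain_boundary_sum chain_boundary_chain_map[OF assms])

lemma subdivision_power_periodic:
  assumes "singular_chain k X c"
  shows "(singular_subdivision k ^^ r) (periodic t m n k c) = periodic t m n k ((singular_subdivision k ^^ r) c)"
  by (auto simp: periodic_def singular_subdivision_power_diff subdivision_power_sum
      naturality_subdivision_power[OF assms])

lemma chain_map_chain_map: "chain_map k g (chain_map k h c) = chain_map k (g \<circ> h) c"
  by (simp add: chain_map_compose)

lemma chain_map_funpow_period:
  assumes "singular_chain k X c" "\<And>x. x \<in> topspace X \<Longrightarrow> (t ^^ m) x = x"
  shows "chain_map k (t ^^ m) c = c"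
  using chain_map_id_gen assms by blast

text \<open>The translates of \<open>c\<close> are permuted cyclically; the difference of the two
  sums telescopes to \<open>F m - F 0\<close>.\<close>

lemma norm_shift:
  assumes "singular_chain k X c" "\<And>x. x \<in> topspace X \<Longrightarrow> (t ^^ m) x = x"
  shows "(\<Sum>i<m. chain_map k (t ^^ Suc i) c) = (\<Sum>i<m. chain_map k (t ^^ i) c)"
proof -
  define F where "F i = chain_map k (t ^^ i) c" for i
  have "F m = F 0"
    using chain_map_funpow_period[OF assms] chain_map_id_gen[OF assms(1), of "t ^^ 0"]
    by (simp add: F_def)
  then have "(\<Sum>i<m. F (Suc i) - F i) = 0"
    by (subst sum_lessThan_telescope) simp
  then show ?thesis
    unfolding sum_subtractf F_def right_minus_eq .
qed

text \<open>The two factors multiply to \<open>t^m - 1\<close>, in either order.\<close>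

lemma periodic_periodic:
  assumes "singular_chain k X c" "\<And>x. x \<in> topspace X \<Longrightarrow> (t ^^ m) x = x"
  shows "periodic t m (Suc n) k (periodic t m n k c) = 0"
proof -
  have *: "chain_map k t (\<Sum>i<m. chain_map k (t ^^ i) c) = (\<Sum>i<m. chain_map k (t ^^ Suc i) c)"
    by (simp add: chain_map_sum chain_map_chain_map)
  have **: "(\<Sum>i<m. chain_map k (t ^^ i) (chain_map k t c)) = (\<Sum>i<m. chain_map k (t ^^ Suc i) c)"
    by (simp only: chain_map_chain_map funpow_Suc_right)
  note * = trans[OF * norm_shift[OF assms]] and ** = trans[OF ** norm_shift[OF assms]]
  show ?thesis
    by (cases "odd n") (simp_all add: periodic_def chain_map_diff sum_subtractf * **)
qed

lemma aug_periodic: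
  "aug (periodic t m n 0 c) = (if odd n then 0 else frag_cmul (int m) (aug c))"
proof -
  have "(\<Sum>i<m. x) = frag_cmul (int m) x" for x :: "unit chain"
    by (induction m) (auto simp: frag_cmul_distrib)
  then show ?thesis by (simp add: periodic_def aug_sum)
qed

lemma tower_chain_map:
  assumes "tower X t m K c" "continuous_map X Y f"
    "continuous_map X X t" "\<And>x. x \<in> topspace X \<Longrightarrow> f (t x) = s (f x)"
  shows "tower Y s m K (\<lambda>n. chain_map n f (c n))"
proof -
  have it: "f ((t ^^ i) x) = (s ^^ i) (f x)" if "x \<in> topspace X" for i x
  proof (induction i)
    case (Suc i)
    have "(t ^^ i) x \<in> topspace X"
      using continuous_map_funpow[OF assms(3), of i] that by (auto simp: continuous_map_def)
    with Suc show ?case by (simp add: assms(4))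
  qed auto
  have "chain_map n f (periodic t m j n a) = periodic s m j n (chain_map n f a)"
    if a: "singular_chain n X a" for n j a
  proof -
    have "chain_map n f (chain_map n (t ^^ i) a) = chain_map n (s ^^ i) (chain_map n f a)" for i
      unfolding chain_map_chain_map by (rule chain_map_eq[OF a]) (simp add: it)
    from this this[of 1] show ?thesis
      by (auto simp: periodic_def chain_map_diff chain_map_sum)
  qed
  moreover have "chain_boundary (Suc n) (chain_map (Suc n) f (c (Suc n))) = chain_map n f (chain_boundary (Suc n) (c (Suc n)))"
    if "n < K" for n
    using assms(1) that chain_boundary_chain_map[of "Suc n" X "c (Suc n)" f] by (simp add: tower_def)
  ultimately show ?thesis
    using assms(1,2) by (auto simp: tower_def singular_chain_chain_map)
qed

subsection \<open>Towers on a space covered by locally trivial pieces\<close>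

text \<open>\<open>ix\<close> is an equivariant map from the open set \<open>S\<close> to the cyclic group of order \<open>m\<close>.\<close>

definition trivial_piece :: "'a topology \<Rightarrow> ('a \<Rightarrow> 'a) \<Rightarrow> nat \<Rightarrow> 'a set \<Rightarrow> ('a \<Rightarrow> nat) \<Rightarrow> bool" where
  "trivial_piece X t m S ix \<longleftrightarrow>
     openin X S \<and> continuous_map (subtopology X S) (discrete_topology {..<m}) ix \<and>
     (\<forall>x\<in>S. t x \<in> S \<and> ix (t x) = Suc (ix x) mod m)"

text \<open>A simplex is connected, so it lies in a single sheet of \<open>ix\<close>, and the sheet
  may be read off at one vertex.\<close>

definition piecewise :: "('a \<Rightarrow> nat) \<Rightarrow> (nat \<Rightarrow> nat \<Rightarrow> 'a chain \<Rightarrow> 'a chain) \<Rightarrow> nat \<Rightarrow> 'a chain \<Rightarrow> 'a chain" where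
  "piecewise ix \<Phi> k = frag_extend (\<lambda>f. \<Phi> (ix (f simplex_vertex)) k (frag_of f))"

text \<open>Meant for a simplex of sheet \<open>n\<close>. Applied after the norm, it keeps exactly
  the translate that lies in sheet \<open>m - 1\<close> and moves it on to sheet 0.\<close>

definition last_shift :: "('a \<Rightarrow> 'a) \<Rightarrow> nat \<Rightarrow> nat \<Rightarrow> nat \<Rightarrow> 'a chain \<Rightarrow> 'a chain" where
  "last_shift t m n k c = (if n = m - 1 then chain_map k t c else 0)"

text \<open>Meant for a simplex of sheet \<open>n\<close>: the translates occupy the sheets
  \<open>n\<close> to \<open>m - 1\<close>. Applying \<open>t - 1\<close> telescopes to the simplex
  minus its translate in sheet 0, whence the sign.\<close>

definition partial_norm :: "('a \<Rightarrow> 'a) \<Rightarrow> nat \<Rightarrow> nat \<Rightarrow> nat \<Rightarrow> 'a chain \<Rightarrow> 'a chain" where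
  "partial_norm t m n k c = - (\<Sum>j<m - n. chain_map k (t ^^ j) c)"

lemma index_constant_on_simplex:
  assumes "continuous_map X (discrete_topology U) ix" "singular_simplex k X f"
    "x \<in> standard_simplex k"
  shows "ix (f x) = ix (f simplex_vertex)"
proof -
  have "continuous_map (subtopology (powertop_real UNIV) (standard_simplex k)) (discrete_topology U) (ix \<circ> f)"
    using assms continuous_map_compose unfolding singular_simplex_def by blast
  then have "connectedin (discrete_topology U) ((ix \<circ> f) ` standard_simplex k)"
    using connectedin_continuous_map_image connectedin_standard_simplex
    by (metis connectedin_absolute connectedin_subtopology subset_refl)
  then obtain a where a: "(ix \<circ> f) ` standard_simplex k \<subseteq> {a}"
    unfolding connectedin_discrete_topology by auto
  have "(ix \<circ> f) x \<in> {a}" using a assms(3) by blast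
  moreover have "(ix \<circ> f) simplex_vertex \<in> {a}" using a simplex_vertex_in by blast
  ultimately show ?thesis by simp
qed

lemma piecewise_simps [simp]:
  "piecewise ix \<Phi> k 0 = 0"
  "piecewise ix \<Phi> k (frag_of f) = \<Phi> (ix (f simplex_vertex)) k (frag_of f)"
  by (simp_all add: piecewise_def)

lemma piecewise_diff: "piecewise ix \<Phi> k (a - b) = piecewise ix \<Phi> k a - piecewise ix \<Phi> k b"
  by (simp add: piecewise_def frag_extend_diff)

lemma piecewise_add: "piecewise ix \<Phi> k (a + b) = piecewise ix \<Phi> k a + piecewise ix \<Phi> k b"
  by (simp add: piecewise_def frag_extend_add)

lemma piecewise_minus: "piecewise ix \<Phi> k (- a) = - piecewise ix \<Phi> k a"
  by (simp add: piecewise_def frag_extend_minus)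

lemma singular_chain_piecewise:
  assumes "singular_chain k X c" "\<And>n c. singular_chain k X c \<Longrightarrow> singular_chain k X (\<Phi> n k c)"
  shows "singular_chain k X (piecewise ix \<Phi> k c)"
  unfolding piecewise_def
proof (rule singular_chain_extend)
  fix f assume "f \<in> Poly_Mapping.keys c"
  then have "singular_chain k X (frag_of f)"
    using assms(1) by (auto simp: singular_chain_def)
  then show "singular_chain k X (\<Phi> (ix (f simplex_vertex)) k (frag_of f))"
    by (rule assms(2))
qed

lemma piecewise_same_index:
  assumes "\<And>f. f \<in> Poly_Mapping.keys c \<Longrightarrow> ix (f simplex_vertex) = n"
    "\<Phi> n k 0 = 0" "\<And>a b. \<Phi> n k (a - b) = \<Phi> n k a - \<Phi> n k b"
  shows "piecewise ix \<Phi> k c = \<Phi> n k c"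
proof -
  have "Poly_Mapping.keys c \<subseteq> {f. ix (f simplex_vertex) = n}" using assms(1) by auto
  then show ?thesis
    by (induction c rule: frag_induction) (auto simp: assms(2,3) piecewise_diff)
qed

text \<open>All faces of a simplex lie in the sheet of the simplex, so one and the same operator
  acts on the whole boundary.\<close>

lemma chain_boundary_piecewise:
  assumes ix: "continuous_map X (discrete_topology U) ix" and c: "singular_chain k X c"
    and lin: "\<And>n k. \<Phi> n k 0 = 0" "\<And>n k a b. \<Phi> n k (a - b) = \<Phi> n k a - \<Phi> n k b"
    and bd: "\<And>n k c. singular_chain k X c \<Longrightarrow>
        chain_boundary k (\<Phi> n k c) = \<Phi> n (k - Suc 0) (chain_boundary k c)"
  shows "chain_boundary k (piecewise ix \<Phi> k c) = piecewise ix \<Phi> (k - Suc 0) (chain_boundary k c)"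
  using c
proof (induction c rule: singular_chain_induct)
  case (simplex f)
  let ?n = "ix (f simplex_vertex)"
  have "ix (g simplex_vertex) = ?n" if g: "g \<in> Poly_Mapping.keys (chain_boundary k (frag_of f))" for g
  proof -
    have "k \<noteq> 0" using g by (cases "k = 0") (simp_all add: chain_boundary_def)
    then have "chain_boundary k (frag_of f) = (\<Sum>i\<le>k. frag_cmul ((-1) ^ i) (frag_of (singular_face k i f)))"
      by (simp add: chain_boundary_of)
    then have "Poly_Mapping.keys (chain_boundary k (frag_of f)) \<subseteq>
        (\<Union>i\<in>{..k}. Poly_Mapping.keys (frag_cmul ((-1) ^ i) (frag_of (singular_face k i f))))"
      by (simp only:) (rule keys_sum)
    also have "\<dots> \<subseteq> (\<Union>i\<in>{..k}. {singular_face k i f})"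
      by auto
    finally have "g \<in> (\<Union>i\<in>{..k}. {singular_face k i f})"
      using g by (rule subsetD)
    then obtain i where i: "i \<le> k" "g = singular_face k i f"
      by blast
    \<comment> \<open>The first vertex of face 0 is not the first vertex of \<open>f\<close>; here
      the constancy of the index on the simplex enters.\<close>
    have "g simplex_vertex = f (simplical_face i simplex_vertex)"
      using simplex_vertex_in[of "k - Suc 0"] by (simp add: i(2) singular_face_def)
    moreover have "simplical_face i simplex_vertex \<in> standard_simplex k"
    proof (rule simplical_face_in_standard_simplex[OF _ i(1) simplex_vertex_in])
      show "1 \<le> k" using \<open>k \<noteq> 0\<close> by (cases k) simp_all
    qed
    ultimately show ?thesis
      by (simp only: index_constant_on_simplex[OF ix simplex])
  qed
  then have "piecewise ix \<Phi> (k - Suc 0) (chain_boundary k (frag_of f)) =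
      \<Phi> ?n (k - Suc 0) (chain_boundary k (frag_of f))"
    by (rule piecewise_same_index) (auto simp: lin)
  then show ?case using bd[of k "frag_of f"] simplex by (simp add: singular_chain_of)
qed (auto simp: piecewise_diff chain_boundary_diff)

lemma last_shift_simps:
  "last_shift t m n k 0 = 0" "last_shift t m n k (a - b) = last_shift t m n k a - last_shift t m n k b"
  by (auto simp: last_shift_def chain_map_diff)

lemma partial_norm_simps:
  "partial_norm t m n k 0 = 0"
  "partial_norm t m n k (a - b) = partial_norm t m n k a - partial_norm t m n k b"
  by (auto simp: partial_norm_def chain_map_diff sum_subtractf)

lemma chain_boundary_last_shift:
  "singular_chain k X c \<Longrightarrow>
    chain_boundary k (last_shift t m n k c) = last_shift t m n (k - Suc 0) (chain_boundary k c)"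
  by (auto simp: last_shift_def chain_boundary_chain_map)

lemma chain_boundary_partial_norm:
  "singular_chain k X c \<Longrightarrow>
    chain_boundary k (partial_norm t m n k c) = partial_norm t m n (k - Suc 0) (chain_boundary k c)"
  by (auto simp: partial_norm_def chain_boundary_minus chain_boundary_sum chain_boundary_chain_map)

text \<open>The parity is such that \<open>contraction n\<close> acts against the differential
  \<open>periodic (Suc n)\<close>: \<open>last_shift\<close> faces the norm and
  \<open>partial_norm\<close> faces \<open>t - 1\<close>.\<close>

definition contraction :: "('a \<Rightarrow> 'a) \<Rightarrow> nat \<Rightarrow> ('a \<Rightarrow> nat) \<Rightarrow> nat \<Rightarrow> nat \<Rightarrow> 'a chain \<Rightarrow> 'a chain" where
  "contraction t m ix n = piecewise ix (if odd n then last_shift t m else partial_norm t m)"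

context
  fixes X :: "'a topology" and t :: "'a \<Rightarrow> 'a" and m :: nat and ix :: "'a \<Rightarrow> nat"
  assumes t: "continuous_map X X t" and per: "\<forall>x\<in>topspace X. (t ^^ m) x = x"
    and ix: "continuous_map X (discrete_topology {..<m}) ix"
    and ixt: "\<forall>x\<in>topspace X. ix (t x) = Suc (ix x) mod m"
begin

lemma chain_boundary_contraction:
  "singular_chain k X c \<Longrightarrow>
    chain_boundary k (contraction t m ix n k c) = contraction t m ix n (k - Suc 0) (chain_boundary k c)"
  unfolding contraction_def
  by (rule chain_boundary_piecewise[OF ix])
    (auto simp: last_shift_simps partial_norm_simps chain_boundary_last_shift chain_boundary_partial_norm)

lemma contraction_simps:
  "contraction t m ix n k 0 = 0"
  "contraction t m ix n k (a - b) = contraction t m ix n k a - contraction t m ix n k b"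
  "contraction t m ix n k (a + b) = contraction t m ix n k a + contraction t m ix n k b"
  "contraction t m ix n k (- a) = - contraction t m ix n k a"
  by (simp_all add: contraction_def piecewise_diff piecewise_add piecewise_minus)

lemma contraction_sum:
  "finite I \<Longrightarrow> contraction t m ix n k (sum f I) = (\<Sum>i\<in>I. contraction t m ix n k (f i))"
  by (induction I rule: finite_induct) (auto simp: contraction_simps)

text \<open>The set \<open>S\<close> will be the union of the other pieces: the contraction must not
  leave the overlap with them.\<close>

lemma singular_chain_contraction:
  assumes "singular_chain k (subtopology X S) c" "\<And>x. x \<in> topspace X \<inter> S \<Longrightarrow> t x \<in> S"
  shows "singular_chain k (subtopology X S) (contraction t m ix n k c)"
proof -
  have tS: "continuous_map (subtopology X S) (subtopology X S) t"
    using t assms(2) by (auto simp: continuous_map_in_subtopology continuous_map_from_subtopology)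
  show ?thesis
    unfolding contraction_def
    by (rule singular_chain_piecewise[OF assms(1)])
      (auto simp: last_shift_def partial_norm_def singular_chain_minus
        intro!: singular_chain_sum singular_chain_chain_map tS continuous_map_funpow)
qed

text \<open>Over a locally trivial piece the chains are free over the group ring, a basis being the
  simplices of sheet 0. So the complex formed by the operators \<open>periodic\<close> is exact, and
  this is an explicit contracting homotopy.\<close>

lemma contraction_identity:
  assumes "singular_chain k X c" "0 < m"
  shows "contraction t m ix n k (periodic t m (Suc n) k c) +
         periodic t m n k (contraction t m ix (Suc n) k c) = c"
  using assms(1)
proof (induction c rule: singular_chain_induct)
  case (simplex f)
  let ?a = "ix (f simplex_vertex)" and ?f = "frag_of f"
  have sf: "singular_chain k X ?f" using simplex by (simp add: singular_chain_of)
  have ftop: "f simplex_vertex \<in> topspace X"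
    using simplex simplex_vertex_in[of k] by (auto simp: singular_simplex_def continuous_map_def)
  have am: "?a < m" using ix ftop by (auto simp: continuous_map_def)
  have pw: "chain_map k (t ^^ i) (chain_map k (t ^^ j) ?f) = chain_map k (t ^^ (i + j)) ?f" for i j
    by (simp only: chain_map_chain_map funpow_add)
  have pw1: "chain_map k t (chain_map k (t ^^ j) ?f) = chain_map k (t ^^ (Suc j)) ?f" for j
    by (simp only: chain_map_chain_map funpow.simps)
  have pw2: "chain_map k (t ^^ j) (chain_map k t ?f) = chain_map k (t ^^ (Suc j)) ?f" for j
    using pw[of j 1] by simp
  have per': "chain_map k (t ^^ m) ?f = ?f"
    using chain_map_funpow_period[OF sf] per by blast
  have it: "ix ((t ^^ j) x) = (ix x + j) mod m" if "x \<in> topspace X" for j x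
  proof (induction j)
    case 0
    have "ix x < m" using ix that by (auto simp: continuous_map_def)
    then show ?case by simp
  next
    case (Suc j)
    have "(t ^^ j) x \<in> topspace X"
      using continuous_map_funpow[OF t, of j] that by (auto simp: continuous_map_def)
    then show ?case using Suc by (simp add: ixt mod_Suc_eq)
  qed
  have ixs: "ix (simplex_map k (t ^^ j) f simplex_vertex) = (?a + j) mod m" for j
    using simplex_vertex_in[of k] it[OF ftop] by (simp add: simplex_map_def)
  have ixs1: "ix (simplex_map k t f simplex_vertex) = Suc ?a mod m"
    using ixs[of 1] by simp
  have f0: "chain_map k (t ^^ 0) ?f = ?f" using chain_map_id_gen[OF sf, of "t ^^ 0"] by simp
  show ?case
  proof (cases "odd n")
    case True
    have A: "contraction t m ix n k (periodic t m (Suc n) k ?f)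
        = (\<Sum>i<m. if (?a + i) mod m = m - 1 then chain_map k (t ^^ Suc i) ?f else 0)"
    proof -
      have "contraction t m ix n k (chain_map k (t ^^ i) ?f) =
          (if (?a + i) mod m = m - 1 then chain_map k (t ^^ Suc i) ?f else 0)" for i
        using True pw1[of i] by (simp add: contraction_def ixs last_shift_def)
      then show ?thesis
        using True by (simp only: periodic_def contraction_sum finite_lessThan even_Suc not_not if_False simp_thms)
    qed
    \<comment> \<open>Among the \<open>m\<close> translates of the simplex exactly one lies in the
      last sheet.\<close>
    have "(?a + i) mod m = m - 1 \<longleftrightarrow> i = m - 1 - ?a" if "i < m" for i
    proof (cases "?a + i < m")
      case True
      then show ?thesis by auto
    next
      case False
      then have "(?a + i) mod m = ?a + i - m" using am that by (simp add: le_mod_geq)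
      then show ?thesis using False am that by auto
    qed
    then have "(\<Sum>i<m. if (?a + i) mod m = m - 1 then chain_map k (t ^^ Suc i) ?f else 0)
        = (\<Sum>i<m. if i = m - 1 - ?a then chain_map k (t ^^ Suc i) ?f else 0)"
      by (intro sum.cong) auto
    also have "\<dots> = chain_map k (t ^^ Suc (m - 1 - ?a)) ?f"
      using am by (subst sum.delta) auto
    also have "Suc (m - 1 - ?a) = m - ?a" using am by simp
    finally have A': "contraction t m ix n k (periodic t m (Suc n) k ?f) = chain_map k (t ^^ (m - ?a)) ?f"
      using A by simp
    have "periodic t m n k (contraction t m ix (Suc n) k ?f)
        = chain_map k t (- (\<Sum>j<m - ?a. chain_map k (t ^^ j) ?f)) - (- (\<Sum>j<m - ?a. chain_map k (t ^^ j) ?f))"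
      using True by (simp add: periodic_def contraction_def partial_norm_def)
    also have "\<dots> = - (\<Sum>j<m - ?a. chain_map k (t ^^ Suc j) ?f - chain_map k (t ^^ j) ?f)"
      by (simp add: chain_map_minus chain_map_sum sum_subtractf o_def pw1[simplified])
    also have "\<dots> = - (chain_map k (t ^^ (m - ?a)) ?f - ?f)"
      by (subst sum_lessThan_telescope) (use f0 in simp)
    finally show ?thesis using A' by simp
  next
    case False
    have P: "contraction t m ix n k (periodic t m (Suc n) k ?f)
        = partial_norm t m (Suc ?a mod m) k (chain_map k t ?f) - partial_norm t m ?a k ?f"
      using False ixs1 by (simp add: periodic_def contraction_def piecewise_diff)
    have N: "periodic t m n k (contraction t m ix (Suc n) k ?f)
        = (if ?a = m - 1 then (\<Sum>i<m. chain_map k (t ^^ Suc i) ?f) else 0)"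
      using False by (simp add: periodic_def contraction_def last_shift_def pw2[simplified])
    \<comment> \<open>A simplex of the last sheet is shifted to sheet 0, where
      \<open>partial_norm\<close> is the full norm up to sign; this cancels the norm in the other
      summand. In any other sheet the two partial norms differ by one term.\<close>
    show ?thesis
    proof (cases "?a = m - 1")
      case True
      have ns: "(\<Sum>j<m. chain_map k (t ^^ j) (chain_map k t ?f)) = (\<Sum>i<m. chain_map k (t ^^ Suc i) ?f)"
        by (simp only: pw2)
      have "Suc ?a mod m = 0" "m - ?a = Suc 0" using True am by auto
      then show ?thesis
        unfolding P N partial_norm_def using True f0 ns by simp
    next
      case False
      then have s: "Suc ?a mod m = Suc ?a" "m - ?a = Suc (m - Suc ?a)" using am by auto
      have "(\<Sum>j<m - ?a. chain_map k (t ^^ j) ?f) = ?f + (\<Sum>j<m - Suc ?a. chain_map k (t ^^ Suc j) ?f)"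
        unfolding s(2) sum.lessThan_Suc_shift using f0 by simp
      moreover have "(\<Sum>j<m - Suc ?a. chain_map k (t ^^ j) (chain_map k t ?f)) = (\<Sum>j<m - Suc ?a. chain_map k (t ^^ Suc j) ?f)"
        by (simp only: pw2)
      ultimately show ?thesis
        unfolding P N partial_norm_def using False s(1) by simp
    qed
  qed
qed (auto simp: contraction_simps periodic_diff algebra_simps)

end

text \<open>The same number of subdivisions must serve all degrees, or the result would not be a
  tower again. Smallness survives further subdivision, so a maximum over the degrees works.\<close>

lemma subdivision_power_small:
  assumes "\<And>U. U \<in> \<C> \<Longrightarrow> openin X U" "topspace X \<subseteq> \<Union>\<C>"
    and "\<And>n. n \<le> K \<Longrightarrow> singular_chain n X (c n)"
  obtains r where "\<And>n f. \<lbrakk>n \<le> K; f \<in> Poly_Mapping.keys ((singular_subdivision n ^^ r) (c n))\<rbrakk>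
      \<Longrightarrow> \<exists>V\<in>\<C>. f ` standard_simplex n \<subseteq> V"
proof -
  have "\<exists>r. \<forall>s\<ge>r. \<forall>f\<in>Poly_Mapping.keys ((singular_subdivision n ^^ s) (c n)).
      \<exists>V\<in>\<C>. f \<in> standard_simplex n \<rightarrow> V" if "n \<le> K" for n
    using sufficient_iterated_singular_subdivision_exists[OF assms(1,2) assms(3)[OF that]] by metis
  then obtain r where r: "\<And>n s f. \<lbrakk>n \<le> K; r n \<le> s; f \<in> Poly_Mapping.keys ((singular_subdivision n ^^ s) (c n))\<rbrakk>
      \<Longrightarrow> \<exists>V\<in>\<C>. f \<in> standard_simplex n \<rightarrow> V"
    by metis
  have "r n \<le> Max (r ` {..K})" if "n \<le> K" for n
    using that by (intro Max_ge) auto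
  then show thesis
    using that[of "Max (r ` {..K})"] r image_subset_iff_funcset by metis
qed

lemma tower_subdivision_power:
  assumes "tower X t m K c"
  shows "tower X t m K (\<lambda>n. (singular_subdivision n ^^ r) (c n))"
  unfolding tower_def
proof (intro conjI allI impI)
  fix n assume "n < K"
  then have "singular_chain n X (c n)" "singular_chain (Suc n) X (c (Suc n))"
    "chain_boundary (Suc n) (c (Suc n)) = periodic t m (Suc n) n (c n)"
    using assms by (auto simp: tower_def)
  then show "chain_boundary (Suc n) ((singular_subdivision (Suc n) ^^ r) (c (Suc n))) =
      periodic t m (Suc n) n ((singular_subdivision n ^^ r) (c n))"
    by (simp add: chain_boundary_subdivision_power subdivision_power_periodic)
qed (use assms in \<open>simp add: tower_def singular_chain_subdivision_power\<close>)

text \<open>Splitting off one piece of the cover costs one degree of the tower: the failure of the part of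
  the tower off the piece to be a tower lives in the piece, where the periodic resolution is
  contractible.\<close>

theorem tower_cover:
  assumes "0 < m"
    and "\<And>j. j < M \<Longrightarrow> trivial_piece X t m (S j) (ix j)" "topspace X = (\<Union>j<M. S j)"
    and "continuous_map X X t" "\<And>x. x \<in> topspace X \<Longrightarrow> (t ^^ m) x = x"
    and "tower X t m M c"
  shows "\<exists>d. aug (c 0) = frag_cmul (int m) d"
  using assms(2-)
proof (induction M arbitrary: X c)
  case 0
  then have "c 0 = 0" by (simp add: tower_def singular_chain_empty)
  then have "aug (c 0) = frag_cmul (int m) 0" by simp
  then show ?case by blast
next
  case (Suc M)
  note t = Suc.prems(3) and per = Suc.prems(4)
  define Z where "Z = (\<Union>j<M. S j)"
  define Y where "Y = subtopology X (S M)"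
  have piece: "trivial_piece X t m (S M) (ix M)" using Suc.prems(1) by simp
  have opZ: "openin X Z" and opS: "openin X (S M)"
    using Suc.prems(1) by (auto simp: Z_def trivial_piece_def)
  have tZ: "\<And>x. x \<in> Z \<Longrightarrow> t x \<in> Z"
    using Suc.prems(1) less_SucI unfolding Z_def trivial_piece_def by blast
  have subX: "Z \<subseteq> topspace X" "S M \<subseteq> topspace X"
    using opZ opS openin_subset by auto
  have ch: "\<And>n. n \<le> Suc M \<Longrightarrow> singular_chain n X (c n)"
    using Suc.prems(5) by (simp add: tower_def)
  obtain r where r: "\<And>n f. \<lbrakk>n \<le> Suc M; f \<in> Poly_Mapping.keys ((singular_subdivision n ^^ r) (c n))\<rbrakk>
      \<Longrightarrow> \<exists>V\<in>{Z, S M}. f ` standard_simplex n \<subseteq> V"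
  proof (rule subdivision_power_small[of "{Z, S M}" X "Suc M" c])
    show "topspace X \<subseteq> \<Union>{Z, S M}"
      using Suc.prems(2) by (auto simp: Z_def less_Suc_eq)
  qed (use opZ opS ch in auto)
  define e where "e n = (singular_subdivision n ^^ r) (c n)" for n
  have tow: "tower X t m (Suc M) e"
    unfolding e_def by (rule tower_subdivision_power[OF Suc.prems(5)])
  have che: "\<And>n. n \<le> Suc M \<Longrightarrow> singular_chain n X (e n)"
    and bde: "\<And>n. n \<le> M \<Longrightarrow> chain_boundary (Suc n) (e (Suc n)) = periodic t m (Suc n) n (e n)"
    using tow by (auto simp: tower_def)
  \<comment> \<open>Simplices inside \<open>Z\<close>, the union of the earlier pieces, go to
    \<open>u\<close>; the others lie in the last piece and go to \<open>v\<close>.\<close>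
  define u where "u n = frag_extend (\<lambda>f. if f ` standard_simplex n \<subseteq> Z then frag_of f else 0) (e n)" for n
  define v where "v n = frag_extend (\<lambda>f. if f ` standard_simplex n \<subseteq> Z then 0 else frag_of f) (e n)" for n
  have uv: "u n + v n = e n" for n
  proof -
    have "frag_extend (\<lambda>f. if f ` standard_simplex n \<subseteq> Z then frag_of f else 0) a +
        frag_extend (\<lambda>f. if f ` standard_simplex n \<subseteq> Z then 0 else frag_of f) a = a" for a :: "'a chain"
      using subset_UNIV
    proof (induction a rule: frag_induction)
      case (diff a b)
      then show ?case by (simp add: frag_extend_diff algebra_simps)
    qed auto
    then show ?thesis by (simp add: u_def v_def)
  qed
  have chu: "singular_chain n (subtopology X Z) (u n)" if "n \<le> Suc M" for n
    unfolding u_def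
  proof (rule singular_chain_extend)
    fix f assume f: "f \<in> Poly_Mapping.keys (e n)"
    then have "singular_simplex n X f" using che[OF that] by (auto simp: singular_chain_def)
    then show "singular_chain n (subtopology X Z) (if f ` standard_simplex n \<subseteq> Z then frag_of f else 0)"
      by (simp add: singular_chain_of singular_simplex_subtopology)
  qed
  have chv: "singular_chain n Y (v n)" if "n \<le> Suc M" for n
    unfolding v_def Y_def
  proof (rule singular_chain_extend)
    fix f assume f: "f \<in> Poly_Mapping.keys (e n)"
    then have "singular_simplex n X f" using che[OF that] by (auto simp: singular_chain_def)
    then show "singular_chain n (subtopology X (S M)) (if f ` standard_simplex n \<subseteq> Z then 0 else frag_of f)"
      using r[OF that] f by (auto simp: e_def singular_chain_of singular_simplex_subtopology)
  qed
  have contZ: "continuous_map (subtopology X Z) (subtopology X Z) t"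
    and contY: "continuous_map Y Y t"
    using t tZ piece
    by (auto simp: Y_def trivial_piece_def continuous_map_in_subtopology continuous_map_from_subtopology)
  have topY: "topspace Y = S M" using subX by (auto simp: Y_def)
  have perY: "\<forall>x\<in>topspace Y. (t ^^ m) x = x" using per subX topY by auto
  have ixY: "continuous_map Y (discrete_topology {..<m}) (ix M)"
    and ixt: "\<forall>x\<in>topspace Y. ix M (t x) = Suc (ix M x) mod m"
    using piece topY by (auto simp: Y_def trivial_piece_def)
  \<comment> \<open>The defect of \<open>u\<close> as a tower. As \<open>u + v\<close> is a tower,
    \<open>w\<close> can also be computed from \<open>v\<close>, so it is supported in the overlap
    of \<open>Z\<close> and the last piece.\<close>
  define w where "w n = chain_boundary (Suc n) (u (Suc n)) - periodic t m (Suc n) n (u n)" for n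
  have w': "w n = periodic t m (Suc n) n (v n) - chain_boundary (Suc n) (v (Suc n))" if "n \<le> M" for n
    using bde[OF that] unfolding uv[of n, symmetric] uv[of "Suc n", symmetric] w_def
      chain_boundary_add periodic_add
    by (simp add: algebra_simps)
  have wZ: "singular_chain n (subtopology X Z) (w n)" if "n \<le> M" for n
    unfolding w_def using that
    by (intro singular_chain_diff singular_chain_boundary_alt singular_chain_periodic chu contZ) auto
  have wY: "singular_chain n Y (w n)" if "n \<le> M" for n
    unfolding w'[OF that] using that
    by (intro singular_chain_diff singular_chain_boundary_alt singular_chain_periodic chv contY) auto
  have wYZ: "singular_chain n (subtopology Y Z) (w n)" if "n \<le> M" for n
    using wZ[OF that] wY[OF that] by (simp add: singular_chain_subtopology)
  define \<kappa> where "\<kappa> = contraction t m (ix M)"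
  note \<kappa>_simps = contraction_simps[OF contY perY ixY ixt, folded \<kappa>_def]
    and \<kappa>_boundary = chain_boundary_contraction[OF contY perY ixY ixt, folded \<kappa>_def]
    and \<kappa>_chain = singular_chain_contraction[OF contY perY ixY ixt, folded \<kappa>_def]
    and \<kappa>_id = contraction_identity[OF contY perY ixY ixt _ \<open>0 < m\<close>, folded \<kappa>_def]
  have \<kappa>_parity: "\<kappa> (Suc (Suc n)) = \<kappa> n" for n
    by (simp add: \<kappa>_def contraction_def)
  \<comment> \<open>The defect is contracted inside the last piece. Since \<open>w n\<close>
    involves \<open>u (Suc n)\<close>, the corrected tower \<open>u + x\<close> is one degree
    shorter.\<close>
  define x where "x n = \<kappa> n n (w n)" for n
  have xYZ: "singular_chain n (subtopology Y Z) (x n)" if "n \<le> M" for n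
    unfolding x_def using wYZ[OF that] tZ by (intro \<kappa>_chain) auto
  have xZ: "singular_chain n (subtopology X Z) (x n)" if "n \<le> M" for n
    using xYZ[OF that] by (simp add: Y_def subtopology_subtopology singular_chain_subtopology)
  define c' where "c' n = u n + x n" for n
  have "tower (subtopology X Z) t m M c'"
    unfolding tower_def
  proof (intro conjI allI impI)
    fix n assume "n \<le> M"
    then show "singular_chain n (subtopology X Z) (c' n)"
      unfolding c'_def using chu xZ by (intro singular_chain_add) auto
  next
    fix n assume n: "n < M"
    \<comment> \<open>The defect is itself compatible with the differentials up to sign; with this,
      \<open>contraction_identity\<close> shows that \<open>x\<close> cancels it.\<close>
    have bdw: "chain_boundary (Suc n) (w (Suc n)) = - periodic t m (Suc (Suc n)) n (w n)"
    proof -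
      have su: "singular_chain (Suc n) (subtopology X Z) (u (Suc n))"
        "singular_chain (Suc (Suc n)) (subtopology X Z) (u (Suc (Suc n)))"
        "singular_chain n (subtopology X Z) (u n)"
        using chu n by auto
      have "chain_boundary (Suc n) (w (Suc n))
          = - periodic t m (Suc (Suc n)) n (chain_boundary (Suc n) (u (Suc n)))"
        using chain_boundary_boundary[OF su(2)] chain_boundary_periodic[OF su(1), where t = t and m = m and n = "Suc (Suc n)"]
        by (simp add: w_def chain_boundary_diff)
      also have "chain_boundary (Suc n) (u (Suc n)) = w n + periodic t m (Suc n) n (u n)"
        by (simp add: w_def)
      finally show ?thesis
        using periodic_periodic[OF su(3), where t = t and m = m and n = "Suc n"] per subX by (simp add: periodic_add in_mono)
    qed
    have "chain_boundary (Suc n) (x (Suc n)) = \<kappa> (Suc n) n (chain_boundary (Suc n) (w (Suc n)))"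
      unfolding x_def using \<kappa>_boundary[OF wY[of "Suc n"]] n by simp
    also have "\<dots> = - \<kappa> (Suc n) n (periodic t m (Suc (Suc n)) n (w n))"
      by (simp add: bdw \<kappa>_simps)
    also have "\<dots> = periodic t m (Suc n) n (x n) - w n"
      using \<kappa>_id[OF wY[of n], of "Suc n"] n by (simp add: x_def \<kappa>_parity algebra_simps)
    finally show "chain_boundary (Suc n) (c' (Suc n)) = periodic t m (Suc n) n (c' n)"
      by (simp add: c'_def chain_boundary_add periodic_add w_def)
  qed
  moreover have "trivial_piece (subtopology X Z) t m (S j) (ix j)" if "j < M" for j
  proof -
    have "S j \<subseteq> Z" "trivial_piece X t m (S j) (ix j)" using that Suc.prems(1) by (auto simp: Z_def)
    then show ?thesis
      by (auto simp: trivial_piece_def openin_subtopology subtopology_subtopology Int_absorb1)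
  qed
  moreover have "topspace (subtopology X Z) = (\<Union>j<M. S j)"
    using subX by (auto simp: Z_def)
  ultimately obtain d where d: "aug (c' 0) = frag_cmul (int m) d"
    using Suc.IH[of "subtopology X Z" c'] contZ per by auto
  have v01: "singular_chain 0 Y (v 0)" "singular_chain (Suc 0) Y (v (Suc 0))"
    using chv by auto
  \<comment> \<open>Expressed through \<open>v\<close>, the correction \<open>x 0\<close> is
    \<open>v 0\<close> up to a norm and a boundary. So passing from \<open>u + v\<close> to
    \<open>u + x\<close> changes the augmentation in degree 0 only by a multiple of
    \<open>m\<close>.\<close>
  have "x 0 = \<kappa> 0 0 (periodic t m (Suc 0) 0 (v 0)) - \<kappa> 0 0 (chain_boundary (Suc 0) (v (Suc 0)))"
    by (simp add: x_def w' \<kappa>_simps)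
  also have "\<kappa> 0 0 (chain_boundary (Suc 0) (v (Suc 0))) = chain_boundary (Suc 0) (\<kappa> 0 (Suc 0) (v (Suc 0)))"
    using \<kappa>_boundary[OF v01(2), of 0] by simp
  also have "\<kappa> 0 0 (periodic t m (Suc 0) 0 (v 0)) = v 0 - periodic t m 0 0 (\<kappa> (Suc 0) 0 (v 0))"
    using \<kappa>_id[OF v01(1), of 0] by (simp add: algebra_simps)
  finally have x0: "x 0 = v 0 - periodic t m 0 0 (\<kappa> (Suc 0) 0 (v 0)) - chain_boundary (Suc 0) (\<kappa> 0 (Suc 0) (v (Suc 0)))" .
  have "singular_chain (Suc 0) Y (\<kappa> 0 (Suc 0) (v (Suc 0)))"
    using \<kappa>_chain[of "Suc 0" UNIV "v (Suc 0)" 0] v01(2) by simp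
  then have "aug (x 0) = aug (v 0) - frag_cmul (int m) (aug (\<kappa> (Suc 0) 0 (v 0)))"
    by (simp add: x0 aug_boundary aug_periodic)
  then have "aug (e 0) = frag_cmul (int m) (d + aug (\<kappa> (Suc 0) 0 (v 0)))"
    using d by (simp add: c'_def frag_cmul_distrib2 flip: uv) (simp add: algebra_simps)
  moreover have "e 0 = c 0"
    unfolding e_def using singular_subdivision_power_zero[OF ch[of 0]] by simp
  ultimately show ?case by auto
qed

subsection \<open>Towers on contractible spaces\<close>

text \<open>A homotopy from the identity to a constant map makes the cycle homologous to one
  supported at a single point. There cycles of positive degree bound, and in degree 0 the
  augmentation determines the chain.\<close>

lemma contractible_cycle_boundary:
  assumes E: "contractible_space E" and c: "singular_chain k E c" and bd: "chain_boundary k c = 0"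
    and aug: "k = 0 \<Longrightarrow> aug c = 0"
  shows "\<exists>d. singular_chain (Suc k) E d \<and> chain_boundary (Suc k) d = c"
proof (cases "topspace E = {}")
  case True
  then have "c = 0" using c singular_chain_empty by blast
  then show ?thesis by (intro exI[of _ 0]) auto
next
  case False
  obtain a where hom: "homotopic_with (\<lambda>x. True) E E id (\<lambda>x. a)"
    using E by (auto simp: contractible_space_def)
  then have a: "a \<in> topspace E"
    using False homotopic_with_imp_continuous_maps[OF hom] by (auto simp: continuous_map_def)
  have "homologous_rel k E {} (chain_map k id c) (chain_map k (\<lambda>_. a) c)"
    by (rule homotopic_imp_homologous_rel_chain_maps[where S = E and T = "{}"])
      (use hom c bd in \<open>auto simp: singular_cycle elim: homotopic_with_mono\<close>)
  then obtain d where d: "singular_chain (Suc k) E d"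
      "chain_boundary (Suc k) d = c - chain_map k (\<lambda>_. a) c"
    using chain_map_ident[OF c] by (auto simp: homologous_rel_def singular_boundary)
  let ?E = "subtopology E {a}"
  have top: "topspace ?E = {a}" using a by auto
  have cm: "continuous_map E ?E (\<lambda>_. a)" using a by (simp add: continuous_map_in_subtopology)
  have ca: "singular_chain k ?E (chain_map k (\<lambda>_. a) c)"
    by (rule singular_chain_chain_map[OF c cm])
  have "\<exists>d'. singular_chain (Suc k) ?E d' \<and> chain_boundary (Suc k) d' = chain_map k (\<lambda>_. a) c"
  proof (cases "k = 0")
    case True
    have "chain_map 0 (\<lambda>_. a) (aug c) = chain_map 0 (\<lambda>_. a) c"
      by (simp add: aug_def chain_map_chain_map o_def)
    then show ?thesis using aug True by (intro exI[of _ 0]) auto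
  next
    case False
    have "chain_boundary k (chain_map k (\<lambda>_. a) c) = 0"
      using chain_boundary_chain_map[OF c] bd by simp
    then have "singular_relcycle k ?E {} (chain_map k (\<lambda>_. a) c)"
      using ca by (simp add: singular_cycle)
    then show ?thesis
      using singular_boundary_eq_cycle_singleton[OF top, of k] False
      by (auto simp: singular_boundary)
  qed
  then obtain d' where d': "singular_chain (Suc k) E d'" "chain_boundary (Suc k) d' = chain_map k (\<lambda>_. a) c"
    by (auto simp: singular_chain_subtopology)
  show ?thesis
    using d d' by (intro exI[of _ "d + d'"]) (auto simp: singular_chain_add chain_boundary_add)
qed

text \<open>The comparison map out of a resolution, built degree by degree by filling cycles. One
  sequence has to serve all \<open>K\<close>, since the length required later depends on a cover
  that is chosen after the sequence.\<close>

lemma contractible_tower: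
  assumes E: "contractible_space E" "a \<in> topspace E" and t: "continuous_map E E t"
    and per: "\<And>x. x \<in> topspace E \<Longrightarrow> (t ^^ m) x = x"
  obtains c where "\<And>K. tower E t m K c" "aug (c 0) = frag_of (restrict (\<lambda>_. ()) (standard_simplex 0))"
proof -
  define c0 where "c0 = frag_of (restrict (\<lambda>_. a) (standard_simplex 0))"
  define P where "P n x \<longleftrightarrow> singular_chain n E x \<and>
      chain_boundary n (periodic t m (Suc n) n x) = 0 \<and> (n = 0 \<longrightarrow> x = c0)" for n x
  have "\<exists>f. \<forall>n. P n (f n) \<and> chain_boundary (Suc n) (f (Suc n)) = periodic t m (Suc n) n (f n)"
  proof (rule dependent_nat_choice)
    have "singular_simplex 0 E (restrict (\<lambda>_. a) (standard_simplex 0))"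
      using E(2) by (auto simp: singular_simplex_def)
    then show "\<exists>x. P 0 x"
      by (intro exI[of _ c0]) (auto simp: P_def c0_def singular_chain_of chain_boundary_def)
  next
    fix x n assume "P n x"
    then have x: "singular_chain n E x" "chain_boundary n (periodic t m (Suc n) n x) = 0"
      by (auto simp: P_def)
    \<comment> \<open>In degree 0 the filling exists because the augmentation of
      \<open>t - 1\<close> applied to \<open>x\<close> vanishes.\<close>
    obtain y where y: "singular_chain (Suc n) E y" "chain_boundary (Suc n) y = periodic t m (Suc n) n x"
      using contractible_cycle_boundary[OF E(1) singular_chain_periodic[OF t x(1)] x(2)]
      by (auto simp: aug_periodic)
    have "chain_boundary (Suc n) (periodic t m (Suc (Suc n)) (Suc n) y) = 0"
      using periodic_periodic[OF x(1) per, where n = "Suc n"] y by (simp add: chain_boundary_periodic)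
    then show "\<exists>y. P (Suc n) y \<and> chain_boundary (Suc n) y = periodic t m (Suc n) n x"
      using y by (auto simp: P_def)
  qed
  then obtain c where c: "\<And>n. P n (c n)"
      "\<And>n. chain_boundary (Suc n) (c (Suc n)) = periodic t m (Suc n) n (c n)"
    by blast
  have "aug (c 0) = frag_of (restrict (\<lambda>_. ()) (standard_simplex 0))"
    using c(1)[of 0] by (auto simp: P_def c0_def aug_def simplex_map_def o_def cong: restrict_cong)
  then show thesis using that[of c] c by (auto simp: tower_def P_def)
qed

lemma aug_point_not_multiple:
  assumes "m \<ge> 2"
  shows "frag_of x \<noteq> frag_cmul (int m) d"
proof
  assume "frag_of x = frag_cmul (int m) d"
  then have "1 = int m * Poly_Mapping.lookup d x"
    by (metis lookup_frag_of lookup_frag_cmul)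
  then show False using assms
    by (metis zmult_eq_1_iff int_one_le_iff_zero_less linorder_not_less nat_1_add_1 of_nat_1 of_nat_eq_iff
      lessI numeral_2_eq_2 One_nat_def abs_zmult_eq_1 abs_of_nat abs_1 mult.commute)
qed

subsection \<open>The geometry of the prism over a simplex\<close>

lemma powertop_real_subtopology: "subtopology (powertop_real UNIV) S = top_of_set S"
  by (simp add: euclidean_product_topology)

text \<open>The gauge of the simplex with respect to its barycentre, and the dilation about it.\<close>

definition gauge :: "nat \<Rightarrow> (nat \<Rightarrow> real) \<Rightarrow> real" where
  "gauge k x = 1 - (real k + 1) * Min (x ` {..k})"

definition dilate :: "nat \<Rightarrow> real \<Rightarrow> (nat \<Rightarrow> real) \<Rightarrow> nat \<Rightarrow> real" where
  "dilate k c x = (\<lambda>i. if i \<le> k then 1 / (real k + 1) + c * (x i - 1 / (real k + 1)) else 0)"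

definition simplex_boundary :: "nat \<Rightarrow> (nat \<Rightarrow> real) set" where
  "simplex_boundary k = {x \<in> standard_simplex k. \<exists>i\<le>k. x i = 0}"

lemma simplex_boundary_subset: "simplex_boundary k \<subseteq> standard_simplex k"
  by (auto simp: simplex_boundary_def)

lemma continuous_on_Min_coordinates [continuous_intros]:
  fixes f :: "'a::topological_space \<Rightarrow> nat \<Rightarrow> real"
  assumes "continuous_on S f"
  shows "continuous_on S (\<lambda>z. Min (f z ` {..k}))"
proof (induction k)
  case 0
  show ?case using continuous_on_product_then_coordinatewise[OF assms] by simp
next
  case (Suc k)
  have "Min (f z ` {..Suc k}) = min (f z (Suc k)) (Min (f z ` {..k}))" for z
    by (simp add: atMost_Suc)
  then show ?case
    using continuous_on_product_then_coordinatewise[OF assms] Suc by (auto intro: continuous_intros)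
qed

lemma continuous_on_gauge [continuous_intros]:
  "continuous_on S f \<Longrightarrow> continuous_on S (\<lambda>z. gauge k (f z))"
  unfolding gauge_def
  by (intro continuous_on_diff continuous_on_mult continuous_on_const continuous_on_Min_coordinates)

lemma continuous_on_dilate [continuous_intros]:
  assumes "continuous_on S f" "continuous_on S c"
  shows "continuous_on S (\<lambda>z. dilate k (c z) (f z))"
proof (rule continuous_on_coordinatewise_then_product)
  fix i
  show "continuous_on S (\<lambda>z. dilate k (c z) (f z) i)"
    using continuous_on_product_then_coordinatewise[OF assms(1)] assms(2)
    by (cases "i \<le> k") (auto simp: dilate_def intro!: continuous_intros)
qed

lemma gauge_bounds:
  assumes "x \<in> standard_simplex k"
  shows "0 \<le> gauge k x" "gauge k x \<le> 1"
proof -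
  have "0 \<le> Min (x ` {..k})" using assms by (auto simp: standard_simplex_def)
  then show "gauge k x \<le> 1" by (auto simp: gauge_def)
  have "(\<Sum>i\<le>k. Min (x ` {..k})) \<le> sum x {..k}" by (intro sum_mono) auto
  then show "0 \<le> gauge k x" using assms by (simp add: gauge_def standard_simplex_def algebra_simps)
qed

lemma gauge_eq_1_iff:
  assumes "x \<in> standard_simplex k"
  shows "gauge k x = 1 \<longleftrightarrow> x \<in> simplex_boundary k"
proof -
  have "gauge k x = 1 \<longleftrightarrow> Min (x ` {..k}) = 0" by (auto simp: gauge_def)
  also have "\<dots> \<longleftrightarrow> (\<exists>i\<le>k. x i = 0)"
  proof
    assume "Min (x ` {..k}) = 0"
    then show "\<exists>i\<le>k. x i = 0" using Min_in[of "x ` {..k}"] by fastforce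
  next
    assume "\<exists>i\<le>k. x i = 0"
    then have "Min (x ` {..k}) \<le> 0" by (metis Min_le atMost_iff finite_atMost finite_imageI imageI)
    moreover have "0 \<le> Min (x ` {..k})" using assms by (auto simp: standard_simplex_def)
    ultimately show "Min (x ` {..k}) = 0" by simp
  qed
  finally show ?thesis using assms by (simp add: simplex_boundary_def)
qed

lemma dilate_1: "x \<in> standard_simplex k \<Longrightarrow> dilate k 1 x = x"
  by (auto simp: dilate_def standard_simplex_def fun_eq_iff)

lemma dilate_dilate: "dilate k c (dilate k d x) = dilate k (c * d) x"
  by (auto simp: dilate_def fun_eq_iff)

lemma Min_dilate:
  assumes "0 \<le> c"
  shows "Min (dilate k c x ` {..k}) = 1 / (real k + 1) + c * (Min (x ` {..k}) - 1 / (real k + 1))"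
proof -
  let ?f = "\<lambda>y. 1 / (real k + 1) + c * (y - 1 / (real k + 1))"
  have "mono ?f" using assms by (auto simp: mono_def intro!: mult_left_mono)
  then have "?f (Min (x ` {..k})) = Min (?f ` (x ` {..k}))" by (intro mono_Min_commute) auto
  also have "?f ` (x ` {..k}) = dilate k c x ` {..k}"
    unfolding image_image by (intro image_cong) (auto simp: dilate_def)
  finally show ?thesis by simp
qed

lemma gauge_dilate:
  assumes "0 \<le> c"
  shows "gauge k (dilate k c x) = c * gauge k x"
  unfolding gauge_def Min_dilate[OF assms] by (simp add: field_simps)

lemma dilate_in_simplex:
  assumes x: "x \<in> standard_simplex k" and c: "0 \<le> c" "c * gauge k x \<le> 1"
  shows "dilate k c x \<in> standard_simplex k"
proof -
  let ?y = "dilate k c x"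
  have "gauge k ?y \<le> 1" using gauge_dilate[OF c(1)] c(2) by simp
  then have "0 \<le> Min (?y ` {..k})" by (simp add: gauge_def zero_le_mult_iff)
  then have nn: "0 \<le> ?y i" for i by (cases "i \<le> k") (auto simp: dilate_def[of k c x])
  have "sum ?y {..k} = (\<Sum>i\<le>k. 1 / (real k + 1) + c * (x i - 1 / (real k + 1)))"
    by (intro sum.cong) (auto simp: dilate_def)
  also have "\<dots> = 1"
    using x by (simp add: sum.distrib sum_subtractf flip: sum_distrib_left)
      (simp add: standard_simplex_def field_simps)
  finally have s: "sum ?y {..k} = 1" .
  moreover have "?y i \<le> 1" for i
  proof (cases "i \<le> k")
    case True
    then show ?thesis using s nn member_le_sum[of i "{..k}" ?y] by auto
  qed (auto simp: dilate_def)
  ultimately show ?thesis using nn by (auto simp: standard_simplex_def dilate_def)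
qed

definition prism :: "nat \<Rightarrow> (real \<times> (nat \<Rightarrow> real)) set" where
  "prism k = {0..1} \<times> standard_simplex k"

definition horn :: "nat \<Rightarrow> (real \<times> (nat \<Rightarrow> real)) set" where
  "horn k = {z \<in> prism k. fst z = 0 \<or> snd z \<in> simplex_boundary k}"

text \<open>\<open>fold_up\<close> bends the simplex onto the horn; \<open>unfold\<close> extends its inverse to the prism in such a
  way that a point of the top is sent to the boundary of the simplex or has \<open>height\<close> 1.\<close>

definition fold_up :: "nat \<Rightarrow> (nat \<Rightarrow> real) \<Rightarrow> real \<times> (nat \<Rightarrow> real)" where
  "fold_up k x = (max 0 (2 * gauge k x - 1), dilate k (2 / max 1 (2 * gauge k x)) x)"

text \<open>The factor \<open>(1 + t) / 2\<close> inverts \<open>fold_up\<close> on the horn. The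
  second factor is 1 there, as \<open>t = 0\<close> or \<open>r = 1\<close>. On the top
  \<open>t = 1\<close> the product is \<open>3 - 2 * r\<close>, large enough to push every point of
  gauge \<open>r \<ge> 1/2\<close> out to the boundary; the remaining points of the top have
  \<open>height\<close> 1.\<close>

definition stretch :: "real \<Rightarrow> real \<Rightarrow> real" where
  "stretch t r = (1 + t) / 2 * (1 + 2 * t * (1 - r))"

definition unfold_down :: "nat \<Rightarrow> real \<times> (nat \<Rightarrow> real) \<Rightarrow> nat \<Rightarrow> real" where
  "unfold_down k z = (case z of (t, x) \<Rightarrow>
     dilate k (stretch t (gauge k x) / max 1 (stretch t (gauge k x) * gauge k x)) x)"

definition height :: "nat \<Rightarrow> real \<times> (nat \<Rightarrow> real) \<Rightarrow> real" where
  "height k z = (case z of (t, x) \<Rightarrow> min 1 (2 * t * (1 - gauge k x)))"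

lemma continuous_on_fold_up: "continuous_on S (fold_up k)"
  unfolding fold_up_def by (intro continuous_intros) auto

lemma continuous_on_unfold_down: "continuous_on S (unfold_down k)"
  unfolding unfold_down_def case_prod_unfold stretch_def by (intro continuous_intros) auto

lemma continuous_on_height: "continuous_on S (height k)"
  unfolding height_def case_prod_unfold by (intro continuous_intros)

text \<open>The inner half of the simplex, of gauge at most 1/2, is doubled onto the base; the outer
  half climbs the sides.\<close>

lemma fold_up_in_horn:
  assumes x: "x \<in> standard_simplex k"
  shows "fold_up k x \<in> horn k"
proof -
  let ?r = "gauge k x"
  note r = gauge_bounds[OF x]
  have d: "dilate k (2 / max 1 (2 * ?r)) x \<in> standard_simplex k"
    using x r by (intro dilate_in_simplex) (auto simp: divide_simps max_def)
  have g: "gauge k (dilate k (2 / max 1 (2 * ?r)) x) = 2 / max 1 (2 * ?r) * ?r"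
    by (intro gauge_dilate) auto
  have "dilate k (2 / max 1 (2 * ?r)) x \<in> simplex_boundary k" if "2 * ?r \<ge> 1"
    using that gauge_eq_1_iff[OF d] g by (simp add: max_def)
  then show ?thesis
    using d r by (auto simp: fold_up_def horn_def prism_def max_def)
qed

lemma fold_up_boundary:
  assumes "x \<in> simplex_boundary k"
  shows "fst (fold_up k x) = 1" "snd (fold_up k x) \<in> simplex_boundary k"
proof -
  have x: "x \<in> standard_simplex k" "gauge k x = 1"
    using assms gauge_eq_1_iff simplex_boundary_subset by auto
  then show "fst (fold_up k x) = 1" by (simp add: fold_up_def)
  then show "snd (fold_up k x) \<in> simplex_boundary k"
    using fold_up_in_horn[OF x(1)] by (auto simp: horn_def)
qed

lemma
  assumes "z \<in> prism k"
  shows unfold_down_in_simplex: "unfold_down k z \<in> standard_simplex k"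
    and gauge_unfold_down: "gauge k (unfold_down k z) =
      min 1 (stretch (fst z) (gauge k (snd z)) * gauge k (snd z))"
proof -
  obtain t x where z: "z = (t, x)" by fastforce
  let ?s = "stretch t (gauge k x)"
  have tx: "0 \<le> t" "t \<le> 1" "x \<in> standard_simplex k" using assms z by (auto simp: prism_def)
  note r = gauge_bounds[OF tx(3)]
  have s: "0 \<le> ?s" using tx r by (simp add: stretch_def)
  then show "unfold_down k z \<in> standard_simplex k"
    unfolding unfold_down_def z using tx r
    by (auto intro!: dilate_in_simplex simp: divide_simps max_def)
  show "gauge k (unfold_down k z) = min 1 (stretch (fst z) (gauge k (snd z)) * gauge k (snd z))"
    unfolding unfold_down_def z using s by (auto simp: gauge_dilate max_def min_def)
qed

lemma height_bounds:
  assumes "z \<in> prism k"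
  shows "height k z \<in> {0..1}"
  using assms gauge_bounds by (auto simp: height_def prism_def)

lemma
  assumes "z \<in> horn k"
  shows height_horn: "height k z = 0"
    and fold_up_unfold_down: "fold_up k (unfold_down k z) = z"
proof -
  obtain t x where z: "z = (t, x)" by fastforce
  have tx: "0 \<le> t" "t \<le> 1" "x \<in> standard_simplex k" and zp: "z \<in> prism k"
    using assms z by (auto simp: horn_def prism_def)
  have h: "t = 0 \<or> gauge k x = 1"
    using assms z gauge_eq_1_iff[OF tx(3)] by (auto simp: horn_def)
  then show "height k z = 0" by (auto simp: height_def z)
  note r = gauge_bounds[OF tx(3)]
  have s: "stretch t (gauge k x) = (1 + t) / 2" using h by (auto simp: stretch_def)
  have sr: "(1 + t) / 2 * gauge k x \<le> 1" using tx r mult_mono[of "(1+t)/2" 1 "gauge k x" 1] by simp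
  have u: "unfold_down k z = dilate k ((1 + t) / 2) x"
    using sr by (simp add: unfold_down_def z s max_def)
  have g: "gauge k (unfold_down k z) = (1 + t) / 2 * gauge k x"
    using gauge_unfold_down[OF zp] sr by (simp add: z s min_def)
  have "2 / max 1 (2 * ((1 + t) / 2 * gauge k x)) * ((1 + t) / 2) = 1"
    using h tx r by (auto simp: max_def divide_simps)
  moreover have "max 0 (2 * ((1 + t) / 2 * gauge k x) - 1) = t"
    using h tx r by (auto simp: max_def)
  ultimately show "fold_up k (unfold_down k z) = z"
    unfolding fold_up_def g unfolding u dilate_dilate
    using dilate_1[OF tx(3)] z by simp
qed

lemma unfold_down_top:
  assumes "x \<in> standard_simplex k"
  shows "height k (1, x) = 1 \<or> unfold_down k (1, x) \<in> simplex_boundary k"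
proof (cases "gauge k x \<le> 1 / 2")
  case True
  then show ?thesis by (simp add: height_def)
next
  case False
  have z: "(1, x) \<in> prism k" using assms by (simp add: prism_def)
  note r = gauge_bounds[OF assms]
  \<comment> \<open>This product equals \<open>stretch 1 r * r - 1\<close>, where \<open>r\<close>
    is the gauge of \<open>x\<close>.\<close>
  have "(gauge k x * 2 - 1) * (1 - gauge k x) \<ge> 0" using False r by (intro mult_nonneg_nonneg) auto
  then have "stretch 1 (gauge k x) * gauge k x \<ge> 1" by (simp add: stretch_def algebra_simps)
  then have "gauge k (unfold_down k (1, x)) = 1" using gauge_unfold_down[OF z] by simp
  then show ?thesis using gauge_eq_1_iff[OF unfold_down_in_simplex[OF z]] by simp
qed

lemma top_in_prism: "x \<in> standard_simplex k \<Longrightarrow> t \<in> {0..1} \<Longrightarrow> (t, x) \<in> prism k"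
  by (simp add: prism_def)

lemma horn_subset_prism: "horn k \<subseteq> prism k"
  by (auto simp: horn_def)

lemma continuous_map_horn_retraction:
  "continuous_map (top_of_set (prism k)) (top_of_set (horn k)) (\<lambda>z. fold_up k (unfold_down k z))"
proof -
  have "continuous_on (prism k) (fold_up k \<circ> unfold_down k)"
    by (intro continuous_on_compose continuous_on_fold_up continuous_on_unfold_down)
  then show ?thesis
    using fold_up_in_horn unfold_down_in_simplex by (auto simp: continuous_map_in_subtopology o_def)
qed

text \<open>The homotopy extension property used to push simplices of \<open>P\<close> into a fibre of \<open>q\<close>.\<close>

lemma prism_extension:
  assumes q: "continuous_map P Y q"
    and lift: "\<And>F G. \<lbrakk>continuous_map (top_of_set (horn k)) P F; continuous_map (top_of_set (prism k)) Y G;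
        \<And>z. z \<in> horn k \<Longrightarrow> q (F z) = G z\<rbrakk> \<Longrightarrow>
        \<exists>L. continuous_map (top_of_set (prism k)) P L \<and> (\<forall>z\<in>horn k. L z = F z) \<and>
            (\<forall>z\<in>prism k. q (L z) = G z)"
    and null: "\<And>f. \<lbrakk>continuous_map (top_of_set (standard_simplex k)) Y f;
        \<And>x. x \<in> simplex_boundary k \<Longrightarrow> f x = y0\<rbrakk> \<Longrightarrow>
        \<exists>H. continuous_map (top_of_set (prism k)) Y H \<and>
          (\<forall>x\<in>standard_simplex k. H (0, x) = f x \<and> H (1, x) = y0) \<and>
          (\<forall>t\<in>{0..1}. \<forall>x\<in>simplex_boundary k. H (t, x) = y0)"
    and F: "continuous_map (top_of_set (horn k)) P F"
    and F1: "\<And>x. x \<in> simplex_boundary k \<Longrightarrow> q (F (1, x)) = y0"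
  shows "\<exists>L. continuous_map (top_of_set (prism k)) P L \<and> (\<forall>z\<in>horn k. L z = F z) \<and>
      (\<forall>x\<in>standard_simplex k. q (L (1, x)) = y0)"
proof -
  have fu: "continuous_map (top_of_set (standard_simplex k)) (top_of_set (horn k)) (fold_up k)"
    using fold_up_in_horn continuous_on_fold_up by (auto simp: continuous_map_in_subtopology)
  \<comment> \<open>The horn is a bent simplex, so \<open>q \<circ> F\<close> becomes a map of the
    simplex that is constant on the boundary and hence null homotopic.\<close>
  have "continuous_map (top_of_set (standard_simplex k)) Y (\<lambda>x. q (F (fold_up k x)))"
    using continuous_map_compose[OF continuous_map_compose[OF fu F] q] by (simp add: o_def)
  moreover have "q (F (fold_up k x)) = y0" if "x \<in> simplex_boundary k" for x
    using F1[OF fold_up_boundary(2)[OF that]] fold_up_boundary(1)[OF that]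
    by (cases "fold_up k x") simp
  ultimately obtain H where H: "continuous_map (top_of_set (prism k)) Y H"
    and H0: "\<And>x. x \<in> standard_simplex k \<Longrightarrow> H (0, x) = q (F (fold_up k x)) \<and> H (1, x) = y0"
    and Hb: "\<And>t x. \<lbrakk>t \<in> {0..1}; x \<in> simplex_boundary k\<rbrakk> \<Longrightarrow> H (t, x) = y0"
    using null[of "\<lambda>x. q (F (fold_up k x))"] by blast
  \<comment> \<open>The position on the bent simplex is \<open>unfold_down\<close>, the time in the
    null homotopy is \<open>height\<close>. On the horn the time is 0 and \<open>G\<close> restricts
    to \<open>q \<circ> F\<close>.\<close>
  define G where "G = (\<lambda>z. H (height k z, unfold_down k z))"
  have "continuous_map (top_of_set (prism k)) (top_of_set (prism k)) (\<lambda>z. (height k z, unfold_down k z))"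
  proof -
    have "continuous_on (prism k) (\<lambda>z. (height k z, unfold_down k z))"
      by (intro continuous_on_Pair continuous_on_height continuous_on_unfold_down)
    moreover have "(height k z, unfold_down k z) \<in> prism k" if "z \<in> prism k" for z
      using height_bounds[OF that] unfold_down_in_simplex[OF that] by (simp add: prism_def)
    ultimately show ?thesis by (simp add: continuous_map_in_subtopology image_subset_iff Pi_iff)
  qed
  then have "continuous_map (top_of_set (prism k)) Y G"
    unfolding G_def by (rule continuous_map_compose[OF _ H, unfolded o_def])
  moreover have "q (F z) = G z" if "z \<in> horn k" for z
    using H0[OF unfold_down_in_simplex[OF subsetD[OF horn_subset_prism that]]]
    by (simp add: G_def height_horn[OF that] fold_up_unfold_down[OF that])
  ultimately obtain L where L: "continuous_map (top_of_set (prism k)) P L"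
      "\<forall>z\<in>horn k. L z = F z" "\<forall>z\<in>prism k. q (L z) = G z"
    using lift[OF F, of G] by blast
  \<comment> \<open>On the top either the null homotopy has ended or the position is on the
    boundary, where the null homotopy is constant.\<close>
  moreover have "G (1, x) = y0" if x: "x \<in> standard_simplex k" for x
    using unfold_down_top[OF x] H0[OF unfold_down_in_simplex[of "(1, x)" k]]
      Hb[OF height_bounds[of "(1, x)" k]] top_in_prism[OF x, of 1] by (auto simp: G_def)
  ultimately show ?thesis using top_in_prism[of _ k 1] by auto
qed

subsection \<open>Prism operators\<close>

lemma contractible_prism: "contractible_space (top_of_set (prism k))"
proof -
  define H where "H = (\<lambda>(u, (t, x)). ((1 - u) * t, \<lambda>i. (1 - u) * x i + u * simplex_vertex i) :: real \<times> (nat \<Rightarrow> real))"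
  have cont: "continuous_on ({0..1} \<times> prism k) H"
    unfolding H_def case_prod_unfold
    by (intro continuous_intros continuous_on_coordinatewise_then_product
        continuous_on_product_then_coordinatewise)
  have im: "H (u, z) \<in> prism k" if u: "u \<in> {0..1}" and z: "z \<in> prism k" for u z
  proof -
    obtain t x where zt: "z = (t, x)" "0 \<le> t" "t \<le> 1" "x \<in> standard_simplex k"
      using z by (cases z) (auto simp: prism_def)
    have "(1 - u) * t \<le> 1 * 1" using u zt by (intro mult_mono) auto
    then show ?thesis
      using u zt convex_standard_simplex[OF zt(4) simplex_vertex_in[of k], of u]
      by (simp add: H_def prism_def)
  qed
  have "continuous_map (prod_topology (top_of_set {0..1}) (top_of_set (prism k))) (top_of_set (prism k)) H"
    unfolding prod_topology_subtopology_eu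
    using cont im by (auto simp: continuous_map_in_subtopology)
  moreover have "H (0, z) = id z" "H (1, z) = (0, simplex_vertex)" for z
    by (auto simp: H_def split: prod.splits)
  ultimately show ?thesis
    unfolding contractible_space_def homotopic_with_def by (intro exI[of _ "(0, simplex_vertex)"] exI[of _ H]) simp
qed

abbreviation identity_chain :: "nat \<Rightarrow> (nat \<Rightarrow> real) chain" where
  "identity_chain k \<equiv> frag_of (restrict id (standard_simplex k))"

text \<open>Acyclic models: a chain \<open>w\<close>, chosen once on the prism over the standard
  simplex, is transported to all prisms along the maps \<open>id \<times> f\<close>.\<close>

definition prism_chain :: "nat \<Rightarrow> (real \<times> (nat \<Rightarrow> real)) chain \<Rightarrow> (nat \<Rightarrow> real) chain \<Rightarrow> (real \<times> (nat \<Rightarrow> real)) chain" where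
  "prism_chain k w = frag_extend (\<lambda>f. chain_map (Suc k) (\<lambda>(t, x). (t, f x)) w)"

lemma singular_identity_chain: "singular_chain k (top_of_set (standard_simplex k)) (identity_chain k)"
  unfolding singular_chain_of singular_simplex_def powertop_real_subtopology
  using continuous_map_id by (auto intro: continuous_map_eq)

lemma continuous_map_cylinder:
  assumes "continuous_map (top_of_set (standard_simplex k)) (top_of_set (standard_simplex p)) f"
  shows "continuous_map (top_of_set (prism k)) (top_of_set (prism p)) (\<lambda>(t, x). (t, f x))"
proof -
  have "continuous_on (standard_simplex k) f" "f \<in> standard_simplex k \<rightarrow> standard_simplex p"
    using assms by (auto simp: continuous_map_in_subtopology)
  then have f: "continuous_on (standard_simplex k) f" and im: "f \<in> standard_simplex k \<rightarrow> standard_simplex p"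
    by auto
  have "snd ` prism k \<subseteq> standard_simplex k" by (auto simp: prism_def)
  then have "continuous_on (prism k) (\<lambda>z. f (snd z))"
    by (rule continuous_on_compose2[OF f continuous_on_snd[OF continuous_on_id]])
  then have "continuous_on (prism k) (\<lambda>z. (fst z, f (snd z)))"
    by (rule continuous_on_Pair[OF continuous_on_fst[OF continuous_on_id]])
  moreover have "(fst z, f (snd z)) \<in> prism p" if "z \<in> prism k" for z
    using that im by (auto simp: prism_def)
  ultimately show ?thesis by (simp add: continuous_map_in_subtopology case_prod_unfold Pi_iff)
qed

lemma continuous_map_caps:
  assumes "s \<in> {0..1}"
  shows "continuous_map (top_of_set (standard_simplex k)) (top_of_set (prism k)) (Pair s)"
proof -
  have "continuous_on (standard_simplex k) (Pair s :: (nat \<Rightarrow> real) \<Rightarrow> _)" by (intro continuous_intros)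
  then show ?thesis using assms by (simp add: continuous_map_in_subtopology prism_def Pi_iff)
qed

lemma prism_chain_simps:
  "prism_chain k w 0 = 0" "prism_chain k w (frag_of f) = chain_map (Suc k) (\<lambda>(t, x). (t, f x)) w"
  "prism_chain k w (a - b) = prism_chain k w a - prism_chain k w b"
  by (simp_all add: prism_chain_def frag_extend_diff)

lemma singular_prism_chain:
  assumes w: "singular_chain (Suc k) (top_of_set (prism k)) w"
    and c: "singular_chain k (top_of_set (standard_simplex p)) c"
  shows "singular_chain (Suc k) (top_of_set (prism p)) (prism_chain k w c)"
  using c
proof (induction rule: singular_chain_induct)
  case (simplex f)
  then show ?case
    unfolding prism_chain_simps singular_simplex_def powertop_real_subtopology
    using w continuous_map_cylinder singular_chain_chain_map by blast
qed (auto simp: prism_chain_simps singular_chain_diff)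

lemma chain_map_prism_chain:
  assumes w: "singular_chain (Suc k) (top_of_set (prism k)) w"
  shows "chain_map (Suc k) (\<lambda>(t, x). (t, g x)) (prism_chain k w c) = prism_chain k w (chain_map k g c)"
  using subset_UNIV
proof (induction c rule: frag_induction)
  case (one f)
  have "chain_map (Suc k) ((\<lambda>(t, x). (t, g x)) \<circ> (\<lambda>(t, x). (t, f x))) w =
      chain_map (Suc k) (\<lambda>(t, x). (t, simplex_map k g f x)) w"
    by (rule chain_map_eq[OF w]) (auto simp: prism_def simplex_map_def)
  then show ?case by (simp add: prism_chain_simps chain_map_chain_map)
qed (auto simp: prism_chain_simps chain_map_diff)

lemma chain_map_simplex_identity:
  assumes "singular_simplex k X f"
  shows "chain_map (k - Suc 0) f (chain_boundary k (identity_chain k)) = chain_boundary k (frag_of f)"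
  using chain_boundary_chain_map[OF singular_identity_chain[of k], of f]
    singular_simplex_chain_map_id[OF assms] by simp

text \<open>By naturality the formula for the identity simplex yields the formula for every chain in
  a standard simplex.\<close>

lemma chain_boundary_prism_chain:
  assumes w: "singular_chain (Suc k) (top_of_set (prism k)) w"
    and w': "singular_chain (Suc (Suc k)) (top_of_set (prism (Suc k))) w'"
    and bd: "chain_boundary (Suc (Suc k)) w' = chain_map (Suc k) (Pair 1) (identity_chain (Suc k)) -
      chain_map (Suc k) (Pair 0) (identity_chain (Suc k)) - prism_chain k w (chain_boundary (Suc k) (identity_chain (Suc k)))"
    and c: "singular_chain (Suc k) (top_of_set (standard_simplex p)) c"
  shows "chain_boundary (Suc (Suc k)) (prism_chain (Suc k) w' c) =
      chain_map (Suc k) (Pair 1) c - chain_map (Suc k) (Pair 0) c - prism_chain k w (chain_boundary (Suc k) c)"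
  using c
proof (induction rule: singular_chain_induct)
  case (simplex f)
  let ?g = "\<lambda>(t :: real, x). (t, f x)"
  have cap: "chain_map (Suc k) ?g (chain_map (Suc k) (Pair s) (identity_chain (Suc k))) =
      chain_map (Suc k) (Pair s) (frag_of f)" for s
  proof -
    have "chain_map (Suc k) ?g (chain_map (Suc k) (Pair s) (identity_chain (Suc k))) =
        chain_map (Suc k) (Pair s) (chain_map (Suc k) f (identity_chain (Suc k)))"
      unfolding chain_map_chain_map by (simp add: o_def)
    then show ?thesis unfolding singular_simplex_chain_map_id[OF simplex] .
  qed
  have "chain_boundary (Suc (Suc k)) (prism_chain (Suc k) w' (frag_of f)) =
      chain_map (Suc k) ?g (chain_boundary (Suc (Suc k)) w')"
    using chain_boundary_chain_map[OF w', of ?g] by (simp add: prism_chain_simps)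
  also have "\<dots> = chain_map (Suc k) (Pair 1) (frag_of f) - chain_map (Suc k) (Pair 0) (frag_of f) -
      prism_chain k w (chain_map k f (chain_boundary (Suc k) (identity_chain (Suc k))))"
    unfolding bd chain_map_diff cap chain_map_prism_chain[OF w] ..
  finally show ?case using chain_map_simplex_identity[OF simplex] by simp
qed (auto simp: prism_chain_simps chain_map_diff chain_boundary_diff)

text \<open>The prism is contractible, so the model chains are found by filling: what is prescribed
  as the boundary of the next one is a cycle. This stands in for an explicit triangulation of the
  prism.\<close>

lemma prism_chains_exist:
  obtains W where
    "\<And>k. singular_chain (Suc k) (top_of_set (prism k)) (W k)"
    "chain_boundary (Suc 0) (W 0) = chain_map 0 (Pair 1) (identity_chain 0) - chain_map 0 (Pair 0) (identity_chain 0)"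
    "\<And>k. chain_boundary (Suc (Suc k)) (W (Suc k)) = chain_map (Suc k) (Pair 1) (identity_chain (Suc k)) -
      chain_map (Suc k) (Pair 0) (identity_chain (Suc k)) - prism_chain k (W k) (chain_boundary (Suc k) (identity_chain (Suc k)))"
proof -
  \<comment> \<open>The last clause is the boundary formula for cycles. Applied to the boundary of
    the identity simplex it shows that the next prescribed boundary is a cycle.\<close>
  define P where "P k w \<longleftrightarrow> singular_chain (Suc k) (top_of_set (prism k)) w \<and>
      (k = 0 \<longrightarrow> chain_boundary (Suc 0) w = chain_map 0 (Pair 1) (identity_chain 0) - chain_map 0 (Pair 0) (identity_chain 0)) \<and>
      (\<forall>p c. singular_chain k (top_of_set (standard_simplex p)) c \<and> chain_boundary k c = 0 \<longrightarrow>
        chain_boundary (Suc k) (prism_chain k w c) = chain_map k (Pair 1) c - chain_map k (Pair 0) c)" for k w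
  define Q where "Q k w w' \<longleftrightarrow> chain_boundary (Suc (Suc k)) w' = chain_map (Suc k) (Pair 1) (identity_chain (Suc k)) -
      chain_map (Suc k) (Pair 0) (identity_chain (Suc k)) - prism_chain k w (chain_boundary (Suc k) (identity_chain (Suc k)))" for k w w'
  have cap: "singular_chain k (top_of_set (prism k)) (chain_map k (Pair s) (identity_chain k))" if "s \<in> {0..1}" for k s
    by (rule singular_chain_chain_map[OF singular_identity_chain continuous_map_caps[OF that]])
  have "\<exists>W. \<forall>k. P k (W k) \<and> Q k (W k) (W (Suc k))"
  proof (rule dependent_nat_choice)
    let ?z = "chain_map 0 (Pair 1) (identity_chain 0) - chain_map 0 (Pair 0) (identity_chain 0)"
    have "singular_chain 0 (top_of_set (prism 0)) ?z" by (intro singular_chain_diff cap) auto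
    moreover have "aug ?z = 0" by (simp only: aug_simps aug_chain_map) simp
    ultimately obtain w where w: "singular_chain (Suc 0) (top_of_set (prism 0)) w" "chain_boundary (Suc 0) w = ?z"
      using contractible_cycle_boundary[OF contractible_prism, of 0 0 ?z] by (auto simp: chain_boundary_def)
    have "chain_boundary (Suc 0) (prism_chain 0 w c) = chain_map 0 (Pair 1) c - chain_map 0 (Pair 0) c"
      if "singular_chain 0 (top_of_set (standard_simplex p)) c" for p c
      using that
    proof (induction rule: singular_chain_induct)
      case (simplex f)
      let ?g = "\<lambda>(t :: real, x). (t, f x)"
      have "chain_map 0 ?g (chain_map 0 (Pair s) (identity_chain 0)) = chain_map 0 (Pair s) (frag_of f)" for s
      proof -
        have "chain_map 0 ?g (chain_map 0 (Pair s) (identity_chain 0)) = chain_map 0 (Pair s) (chain_map 0 f (identity_chain 0))"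
          unfolding chain_map_chain_map by (simp add: o_def)
        then show ?thesis unfolding singular_simplex_chain_map_id[OF simplex] .
      qed
      then have "chain_map 0 ?g ?z = chain_map 0 (Pair 1) (frag_of f) - chain_map 0 (Pair 0) (frag_of f)"
        by (simp only: chain_map_diff)
      then show ?case
        using chain_boundary_chain_map[OF w(1), of ?g] w(2) by (simp add: prism_chain_simps)
    qed (auto simp: prism_chain_simps chain_map_diff chain_boundary_diff)
    then show "\<exists>w. P 0 w" using w by (auto simp: P_def)
  next
    fix w k assume P: "P k w"
    let ?b = "chain_boundary (Suc k) (identity_chain (Suc k))"
    let ?z = "chain_map (Suc k) (Pair 1) (identity_chain (Suc k)) -
      chain_map (Suc k) (Pair 0) (identity_chain (Suc k)) - prism_chain k w ?b"
    have w: "singular_chain (Suc k) (top_of_set (prism k)) w" using P by (simp add: P_def)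
    have b: "singular_chain k (top_of_set (standard_simplex (Suc k))) ?b"
      by (rule singular_chain_boundary_alt[OF singular_identity_chain])
    have bb: "chain_boundary k ?b = 0"
      using chain_boundary_boundary[OF singular_identity_chain[of "Suc k"]] by simp
    have z: "singular_chain (Suc k) (top_of_set (prism (Suc k))) ?z"
      by (intro singular_chain_diff cap singular_prism_chain w b) auto
    have "chain_boundary (Suc k) (prism_chain k w ?b) = chain_map k (Pair 1) ?b - chain_map k (Pair 0) ?b"
      using P b bb by (auto simp: P_def)
    moreover have "chain_boundary (Suc k) (chain_map (Suc k) (Pair s) (identity_chain (Suc k))) = chain_map k (Pair s) ?b" for s :: real
      using chain_boundary_chain_map[OF singular_identity_chain[of "Suc k"], of "Pair s"] by (simp del: chain_map_of)
    ultimately have bz: "chain_boundary (Suc k) ?z = 0"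
      by (simp only: chain_boundary_diff) simp
    obtain w' where w': "singular_chain (Suc (Suc k)) (top_of_set (prism (Suc k))) w'"
        "chain_boundary (Suc (Suc k)) w' = ?z"
      using contractible_cycle_boundary[OF contractible_prism z bz] by auto
    have "P (Suc k) w'"
      using chain_boundary_prism_chain[OF w w'] w'(1) by (auto simp: P_def prism_chain_simps)
    then show "\<exists>w'. P (Suc k) w' \<and> Q k w w'" using w'(2) unfolding Q_def by blast
  qed
  then obtain W where "\<And>k. P k (W k)" "\<And>k. Q k (W k) (W (Suc k))" by blast
  then show thesis using that[of W] unfolding P_def Q_def by blast
qed

text \<open>The homotopies are chosen simplex by simplex and need not come from a homotopy of
  \<open>P\<close>; agreement on faces makes the prism operator work. \<open>D\<close> sweeps out
  the prisms, and \<open>R\<close> collects the end faces, which lie in \<open>B\<close>.\<close>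

lemma prism_operator:
  assumes h: "\<And>k f. singular_simplex k P f \<Longrightarrow> continuous_map (top_of_set (prism k)) P (h k f)"
    and h0: "\<And>k f x. \<lbrakk>singular_simplex k P f; x \<in> standard_simplex k\<rbrakk> \<Longrightarrow> h k f (0, x) = f x"
    and h1: "\<And>k f x. \<lbrakk>singular_simplex k P f; x \<in> standard_simplex k\<rbrakk> \<Longrightarrow> h k f (1, x) \<in> B"
    and hB: "\<And>k f z. \<lbrakk>singular_simplex k P f; f ` standard_simplex k \<subseteq> B; z \<in> prism k\<rbrakk> \<Longrightarrow> h k f z \<in> B"
    and hf: "\<And>k f i t x. \<lbrakk>singular_simplex (Suc k) P f; i \<le> Suc k; t \<in> {0..1}; x \<in> standard_simplex k\<rbrakk> \<Longrightarrow>
        h (Suc k) f (t, simplical_face i x) = h k (singular_face (Suc k) i f) (t, x)"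
  obtains D R where "\<And>k. D k 0 = 0"
    "\<And>k c. singular_chain k P c \<Longrightarrow> singular_chain (Suc k) P (D k c)"
    "\<And>k c. singular_chain k (subtopology P B) c \<Longrightarrow> singular_chain (Suc k) (subtopology P B) (D k c)"
    "\<And>k c. singular_chain k P c \<Longrightarrow> singular_chain k (subtopology P B) (R k c)"
    "\<And>k c. singular_chain k P c \<Longrightarrow>
      chain_boundary (Suc k) (D k c) = R k c - c - D (k - Suc 0) (chain_boundary k c)"
proof -
  obtain W where W: "\<And>k. singular_chain (Suc k) (top_of_set (prism k)) (W k)"
    and W0: "chain_boundary (Suc 0) (W 0) = chain_map 0 (Pair 1) (identity_chain 0) - chain_map 0 (Pair 0) (identity_chain 0)"
    and WS: "\<And>k. chain_boundary (Suc (Suc k)) (W (Suc k)) = chain_map (Suc k) (Pair 1) (identity_chain (Suc k)) -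
      chain_map (Suc k) (Pair 0) (identity_chain (Suc k)) - prism_chain k (W k) (chain_boundary (Suc k) (identity_chain (Suc k)))"
    using prism_chains_exist by blast
  define D where "D k = frag_extend (\<lambda>f. chain_map (Suc k) (h k f) (W k))" for k
  define R where "R k = frag_extend (\<lambda>f. frag_of (restrict (\<lambda>x. h k f (1, x)) (standard_simplex k)))" for k
  have cap0: "chain_map k (h k f) (chain_map k (Pair 0) (identity_chain k)) = frag_of f"
    if f: "singular_simplex k P f" for k f
  proof -
    have "simplex_map k (h k f) (simplex_map k (Pair 0) (restrict id (standard_simplex k))) = f"
    proof
      fix x show "simplex_map k (h k f) (simplex_map k (Pair 0) (restrict id (standard_simplex k))) x = f x"
        using h0[OF f] f by (cases "x \<in> standard_simplex k") (auto simp: simplex_map_def singular_simplex_def extensional_def)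
    qed
    then show ?thesis by simp
  qed
  have cap1: "chain_map k (h k f) (chain_map k (Pair 1) (identity_chain k)) = R k (frag_of f)" for k f
    by (simp add: R_def simplex_map_def o_def) (rule arg_cong[of _ _ frag_of], auto simp: restrict_def)
  \<comment> \<open>Over a face the homotopy of \<open>f\<close> is the homotopy of that face; this
    turns the sides of the prism into \<open>D\<close> of the boundary.\<close>
  have side: "chain_map (Suc k) (h (Suc k) f) (prism_chain k (W k) (chain_boundary (Suc k) (identity_chain (Suc k)))) =
      D k (chain_boundary (Suc k) (frag_of f))" if f: "singular_simplex (Suc k) P f" for k f
  proof -
    have "chain_map (Suc k) (h (Suc k) f) (chain_map (Suc k) (\<lambda>(t, x). (t, singular_face (Suc k) i (restrict id (standard_simplex (Suc k))) x)) (W k))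
        = chain_map (Suc k) (h k (singular_face (Suc k) i f)) (W k)" if i: "i \<le> Suc k" for i
      unfolding chain_map_chain_map
    proof (rule chain_map_eq[OF W])
      fix z assume "z \<in> topspace (top_of_set (prism k))"
      then obtain t x where z: "z = (t, x)" "t \<in> {0..1}" "x \<in> standard_simplex k"
        by (cases z) (auto simp: prism_def)
      have "simplical_face i x \<in> standard_simplex (Suc k)"
        using simplical_face_in_standard_simplex[of "Suc k" i x] i z(3) by simp
      then show "(h (Suc k) f \<circ> (\<lambda>(t, x). (t, singular_face (Suc k) i (restrict id (standard_simplex (Suc k))) x))) z
          = h k (singular_face (Suc k) i f) z"
        using hf[OF f i z(2,3)] z by (simp add: singular_face_def)
    qed
    then show ?thesis
      by (simp add: chain_boundary_of D_def prism_chain_def frag_extend_sum frag_extend_cmul chain_map_sum o_def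
          del: singular_face_restrict sum.atMost_Suc)
  qed
  have bd: "chain_boundary (Suc k) (D k c) = R k c - c - D (k - Suc 0) (chain_boundary k c)"
    if "singular_chain k P c" for k c
    using that
  proof (induction rule: singular_chain_induct)
    case (simplex f)
    have *: "chain_boundary (Suc k) (D k (frag_of f)) = chain_map k (h k f) (chain_boundary (Suc k) (W k))"
      using chain_boundary_chain_map[OF W[of k], of "h k f"] by (simp add: D_def)
    show ?case
    proof (cases k)
      case 0
      then show ?thesis
        unfolding * using simplex cap0[of 0 f] cap1[of 0 f] W0
        by (simp only: chain_map_diff) (simp add: chain_boundary_def D_def)
    next
      case (Suc j)
      then show ?thesis
        unfolding * using simplex cap0[of k f] cap1[of k f] WS[of j] side[of j f]
        by (simp only: chain_map_diff) simp
    qed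
  qed (auto simp: D_def R_def frag_extend_diff chain_boundary_diff)
  show thesis
  proof (rule that[of D R])
    show "D k 0 = 0" for k by (simp add: D_def)
    show "singular_chain (Suc k) P (D k c)" if "singular_chain k P c" for k c
      unfolding D_def using that
      by (intro singular_chain_extend singular_chain_chain_map[OF W] h) (auto simp: singular_chain_def)
    show "singular_chain (Suc k) (subtopology P B) (D k c)" if "singular_chain k (subtopology P B) c" for k c
      unfolding D_def
    proof (intro singular_chain_extend singular_chain_chain_map[OF W])
      fix f assume "f \<in> Poly_Mapping.keys c"
      then have "singular_simplex k P f" "f ` standard_simplex k \<subseteq> B"
        using that by (auto simp: singular_chain_subtopology) (auto simp: singular_chain_def)
      then show "continuous_map (top_of_set (prism k)) (subtopology P B) (h k f)"
        using h hB by (auto simp: continuous_map_in_subtopology)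
    qed
    show "singular_chain k (subtopology P B) (R k c)" if "singular_chain k P c" for k c
      unfolding R_def
    proof (rule singular_chain_extend)
      fix f assume "f \<in> Poly_Mapping.keys c"
      then have f: "singular_simplex k P f" using that by (auto simp: singular_chain_def)
      have "continuous_map (top_of_set (standard_simplex k)) P (h k f \<circ> Pair 1)"
        using continuous_map_compose[OF continuous_map_caps h[OF f]] by simp
      then have "continuous_map (top_of_set (standard_simplex k)) P (restrict (\<lambda>x. h k f (1, x)) (standard_simplex k))"
        by (rule continuous_map_eq) simp
      then show "singular_chain k (subtopology P B) (frag_of (restrict (\<lambda>x. h k f (1, x)) (standard_simplex k)))"
        using h1[OF f] by (auto simp: singular_chain_of singular_simplex_def powertop_real_subtopology continuous_map_in_subtopology)
    qed
  qed (rule bd)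
qed

text \<open>The deformation into \<open>B\<close> is not equivariant, so deforming the chains
  separately would destroy the relations between them. Instead each chain is first corrected by the
  previous deformation chain \<open>b\<close>, which puts its boundary into
  \<open>B\<close>.\<close>

lemma tower_into_subspace:
  assumes tow: "\<And>K. tower P t m K c" and t: "continuous_map P P t" and tB: "\<And>x. x \<in> B \<Longrightarrow> t x \<in> B"
    and per: "\<And>x. x \<in> topspace P \<Longrightarrow> (t ^^ m) x = x"
    and rel: "\<And>k c. \<lbrakk>singular_chain k P c; k \<noteq> 0 \<Longrightarrow> singular_chain (k - Suc 0) (subtopology P B) (chain_boundary k c)\<rbrakk> \<Longrightarrow>
        \<exists>b e. singular_chain (Suc k) P b \<and> singular_chain k (subtopology P B) e \<and> c = e + chain_boundary (Suc k) b"
  obtains e where "\<And>K. tower (subtopology P B) t m K e" "aug (e 0) = aug (c 0)"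
proof -
  have c: "singular_chain n P (c n)" "chain_boundary (Suc n) (c (Suc n)) = periodic t m (Suc n) n (c n)" for n
    using tow[of "Suc n"] by (auto simp: tower_def)
  have tB': "continuous_map (subtopology P B) (subtopology P B) t"
    using t tB by (auto simp: continuous_map_in_subtopology continuous_map_from_subtopology)
  \<comment> \<open>Beyond degree 0, \<open>c n\<close> minus the boundary of \<open>b\<close>
    equals \<open>e\<close> only up to a periodic operator applied to the previous \<open>b\<close>.
    The next operator kills this term, so the equation is demanded only after applying
    \<open>periodic\<close>.\<close>
  define S where "S n z \<longleftrightarrow> (case z of (b, e) \<Rightarrow> singular_chain (Suc n) P b \<and> singular_chain n (subtopology P B) e \<and>
      periodic t m (Suc n) n (c n - chain_boundary (Suc n) b) = periodic t m (Suc n) n e \<and>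
      (n = 0 \<longrightarrow> aug e = aug (c 0)))" for n z
  define Q where "Q n z z' \<longleftrightarrow> chain_boundary (Suc n) (snd z') = periodic t m (Suc n) n (snd z)" for n and z z' :: "'a chain \<times> 'a chain"
  have "\<exists>f. \<forall>n. S n (f n) \<and> Q n (f n) (f (Suc n))"
  proof (rule dependent_nat_choice)
    obtain b e where be: "singular_chain (Suc 0) P b" "singular_chain 0 (subtopology P B) e" "c 0 = e + chain_boundary (Suc 0) b"
      using rel[OF c(1)[of 0]] by auto
    then show "\<exists>x. S 0 x"
      by (intro exI[of _ "(b, e)"]) (auto simp: S_def aug_boundary)
  next
    fix z n assume "S n z"
    then obtain b e where z: "z = (b, e)" and b: "singular_chain (Suc n) P b" and e: "singular_chain n (subtopology P B) e"
      and eq: "periodic t m (Suc n) n (c n - chain_boundary (Suc n) b) = periodic t m (Suc n) n e"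
      by (auto simp: S_def)
    let ?x = "c (Suc n) - periodic t m (Suc n) (Suc n) b"
    have x: "singular_chain (Suc n) P ?x"
      by (intro singular_chain_diff c singular_chain_periodic t b)
    have bx: "chain_boundary (Suc n) ?x = periodic t m (Suc n) n e"
      using eq by (simp add: chain_boundary_diff c(2) chain_boundary_periodic[OF b] periodic_diff)
    have "singular_chain n (subtopology P B) (chain_boundary (Suc n) ?x)"
      unfolding bx by (rule singular_chain_periodic[OF tB' e])
    then obtain b' e' where b': "singular_chain (Suc (Suc n)) P b'" and e': "singular_chain (Suc n) (subtopology P B) e'"
      and x': "?x = e' + chain_boundary (Suc (Suc n)) b'"
      using rel[OF x] by auto
    have "chain_boundary (Suc n) e' = chain_boundary (Suc n) (?x - chain_boundary (Suc (Suc n)) b')"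
      by (simp add: x')
    then have Q: "Q n z (b', e')"
      using bx chain_boundary_boundary[OF b'] by (simp add: Q_def z chain_boundary_diff)
    have "c (Suc n) - chain_boundary (Suc (Suc n)) b' = e' + periodic t m (Suc n) (Suc n) b"
      using x' by (simp add: algebra_simps)
    then have "S (Suc n) (b', e')"
      using b' e' periodic_periodic[OF b per, where n = "Suc n"] by (simp add: S_def periodic_add)
    then show "\<exists>z'. S (Suc n) z' \<and> Q n z z'" using Q by blast
  qed
  then obtain f where f: "\<And>n. S n (f n)" "\<And>n. Q n (f n) (f (Suc n))" by blast
  show thesis
  proof (rule that[of "\<lambda>n. snd (f n)"])
    show "tower (subtopology P B) t m K (\<lambda>n. snd (f n))" for K
      using f by (auto simp: tower_def S_def Q_def case_prod_unfold)
    show "aug (snd (f 0)) = aug (c 0)" using f(1)[of 0] by (simp add: S_def case_prod_unfold)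
  qed
qed

subsection \<open>Compatible families of homotopies\<close>

definition drop_coordinate :: "nat \<Rightarrow> (nat \<Rightarrow> real) \<Rightarrow> nat \<Rightarrow> real" where
  "drop_coordinate i y = (\<lambda>n. if n < i then y n else y (Suc n))"

lemma simplical_face_drop_coordinate:
  "y i = 0 \<Longrightarrow> simplical_face i (drop_coordinate i y) = y"
  by (auto simp: simplical_face_def drop_coordinate_def fun_eq_iff)

lemma simplical_face_at: "simplical_face i x i = 0"
  by (simp add: simplical_face_def)

lemma drop_coordinate_simplical_face:
  fixes x :: "nat \<Rightarrow> real"
  shows "drop_coordinate i (simplical_face i x) = x"
  by (auto simp: simplical_face_def drop_coordinate_def fun_eq_iff)

lemma drop_coordinate_in_simplex:
  assumes y: "y \<in> standard_simplex (Suc k)" and i: "i \<le> Suc k" "y i = 0"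
  shows "drop_coordinate i y \<in> standard_simplex k"
proof -
  have "sum (drop_coordinate i y) {..k} = sum y ({..Suc k} - {i})"
    by (rule sum.reindex_bij_witness[of _ "\<lambda>n. if n < i then n else n - 1" "\<lambda>n. if n < i then n else Suc n"])
      (use i in \<open>auto simp: drop_coordinate_def\<close>)
  also have "\<dots> = sum y {..Suc k}"
    using i by (simp add: sum_diff1 del: sum.atMost_Suc)
  finally show ?thesis using y i by (auto simp: standard_simplex_def drop_coordinate_def)
qed

lemma drop_coordinate_drop_coordinate:
  assumes "i < l"
  shows "drop_coordinate (l - Suc 0) (drop_coordinate i y) = drop_coordinate i (drop_coordinate l y)"
  using assms by (auto simp: drop_coordinate_def fun_eq_iff)

lemma simplical_face_simplical_face:
  fixes x :: "nat \<Rightarrow> real"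
  assumes "i < l"
  shows "simplical_face i (simplical_face (l - Suc 0) x) = simplical_face l (simplical_face i x)"
  using assms by (auto simp: simplical_face_def fun_eq_iff)

lemma singular_face_singular_face:
  assumes "i < l" "l \<le> Suc (Suc k)"
  shows "singular_face (Suc k) (l - Suc 0) (singular_face (Suc (Suc k)) i f) =
    singular_face (Suc k) i (singular_face (Suc (Suc k)) l f)"
proof
  fix x
  have "simplical_face (l - Suc 0) x \<in> standard_simplex (Suc k)" "simplical_face i x \<in> standard_simplex (Suc k)"
    if "x \<in> standard_simplex k"
    using that assms simplical_face_in_standard_simplex[of "Suc k" _ x] by auto
  then show "singular_face (Suc k) (l - Suc 0) (singular_face (Suc (Suc k)) i f) x =
    singular_face (Suc k) i (singular_face (Suc (Suc k)) l f) x"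
    using simplical_face_simplical_face[OF assms(1), of x] by (auto simp: singular_face_def restrict_def)
qed

lemma continuous_on_drop_coordinate:
  assumes "continuous_on S f"
  shows "continuous_on S (\<lambda>z. drop_coordinate i (f z))"
proof (rule continuous_on_coordinatewise_then_product)
  fix n show "continuous_on S (\<lambda>z. drop_coordinate i (f z) n)"
    using continuous_on_product_then_coordinatewise[OF assms] by (cases "n < i") (simp_all add: drop_coordinate_def)
qed

lemma closedin_prism_conditions:
  "closedin (top_of_set S) {z \<in> S. fst z = (0::real)}"
  "closedin (top_of_set S) {z \<in> S. (snd z :: nat \<Rightarrow> real) i = 0}"
proof -
  have "continuous_on S (fst :: real \<times> (nat \<Rightarrow> real) \<Rightarrow> real)" by (intro continuous_intros)
  from continuous_closedin_preimage_constant[OF this] show "closedin (top_of_set S) {z \<in> S. fst z = 0}" .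
  have "continuous_on S (\<lambda>z :: real \<times> (nat \<Rightarrow> real). snd z i)"
    by (rule continuous_on_product_then_coordinatewise) (intro continuous_intros)
  from continuous_closedin_preimage_constant[OF this] show "closedin (top_of_set S) {z \<in> S. snd z i = 0}" .
qed

text \<open>Stationarity on the simplices inside \<open>B\<close> ensures that chains in
  \<open>B\<close> are swept out inside \<open>B\<close>.\<close>

definition homotopies_into :: "'a topology \<Rightarrow> 'a set \<Rightarrow> nat \<Rightarrow>
    (((nat \<Rightarrow> real) \<Rightarrow> 'a) \<Rightarrow> real \<times> (nat \<Rightarrow> real) \<Rightarrow> 'a) \<Rightarrow> bool" where
  "homotopies_into P B k h \<longleftrightarrow>
     (\<forall>f. singular_simplex k P f \<longrightarrow> continuous_map (top_of_set (prism k)) P (h f) \<and>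
        (\<forall>x\<in>standard_simplex k. h f (0, x) = f x \<and> h f (1, x) \<in> B) \<and>
        (f ` standard_simplex k \<subseteq> B \<longrightarrow> (\<forall>z\<in>prism k. h f z = f (snd z))))"

text \<open>What the next dimension has to know for gluing: the homotopy over a face depends only on
  the face as a simplex. Comparing two simplices with a common face expresses this without
  mentioning the homotopies of lower dimension, so that the recursion can refer to the previous
  stage alone.\<close>

definition agree_on_faces :: "'a topology \<Rightarrow> nat \<Rightarrow> (((nat \<Rightarrow> real) \<Rightarrow> 'a) \<Rightarrow> real \<times> (nat \<Rightarrow> real) \<Rightarrow> 'a) \<Rightarrow> bool" where
  "agree_on_faces P k h \<longleftrightarrow> (\<forall>j f f' i i' t x. k = Suc j \<and> singular_simplex k P f \<and> singular_simplex k P f' \<and>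
     i \<le> k \<and> i' \<le> k \<and> singular_face k i f = singular_face k i' f' \<and> t \<in> {0..1} \<and> x \<in> standard_simplex j \<longrightarrow>
     h f (t, simplical_face i x) = h f' (t, simplical_face i' x))"

text \<open>The simplex on the base and the homotopies already chosen for its faces on the sides are
  pasted along a finite closed cover of the horn.\<close>

lemma horn_data:
  assumes h: "homotopies_into P B k h" and agree: "agree_on_faces P k h"
    and f: "singular_simplex (Suc k) P f"
  obtains F where "continuous_map (top_of_set (horn (Suc k))) P F"
    "\<And>x. x \<in> standard_simplex (Suc k) \<Longrightarrow> F (0, x) = f x"
    "\<And>t x i. \<lbrakk>t \<in> {0..1}; x \<in> standard_simplex k; i \<le> Suc k\<rbrakk> \<Longrightarrow>
      F (t, simplical_face i x) = h (singular_face (Suc k) i f) (t, x)"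
proof -
  \<comment> \<open>The index \<open>Suc (Suc k)\<close> stands for the base, a smaller one for the
    side over the corresponding face.\<close>
  define T where "T i = (if i = Suc (Suc k) then {z \<in> horn (Suc k). fst z = 0} else {z \<in> horn (Suc k). snd z i = 0})" for i
  define g where "g i = (if i = Suc (Suc k) then f \<circ> snd
      else (\<lambda>z. h (singular_face (Suc k) i f) (fst z, drop_coordinate i (snd z))))" for i
  have face: "singular_simplex k P (singular_face (Suc k) i f)" if "i \<le> Suc k" for i
    using singular_simplex_singular_face[OF f, of i] that by simp
  have hornD: "fst z \<in> {0..1}" "snd z \<in> standard_simplex (Suc k)" if "z \<in> horn (Suc k)" for z
    using that by (auto simp: horn_def prism_def)
  have ctop: "subtopology (top_of_set (horn (Suc k))) (T i) = top_of_set (T i)" for i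
    by (auto simp: T_def subtopology_subtopology intro!: arg_cong[where f = top_of_set])
  have base: "h (singular_face (Suc k) i f) (0, drop_coordinate i y) = f y"
    if "i \<le> Suc k" "y \<in> standard_simplex (Suc k)" "y i = 0" for i y
  proof -
    have d: "drop_coordinate i y \<in> standard_simplex k" using drop_coordinate_in_simplex that by blast
    then have "h (singular_face (Suc k) i f) (0, drop_coordinate i y) = singular_face (Suc k) i f (drop_coordinate i y)"
      using h face[OF that(1)] by (simp add: homotopies_into_def)
    then show ?thesis using d simplical_face_drop_coordinate[of y i, OF that(3)] by (simp add: singular_face_def)
  qed
  \<comment> \<open>Two sides meet over a face of codimension 2, where \<open>agree_on_faces\<close>
    applies.\<close>
  have ord: "h (singular_face (Suc k) i f) (t, drop_coordinate i y) = h (singular_face (Suc k) l f) (t, drop_coordinate l y)"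
    if "i < l" "l \<le> Suc k" "t \<in> {0..1}" and y: "y \<in> standard_simplex (Suc k)" "y i = 0" "y l = 0" for i l t y
  proof -
    \<comment> \<open>The two faces of a 1-simplex are disjoint.\<close>
    have "k \<noteq> 0"
    proof
      assume "k = 0"
      then have "i = 0" "l = 1" using that by auto
      then show False using y \<open>k = 0\<close> by (auto simp: standard_simplex_def)
    qed
    then obtain j where k: "k = Suc j" by (cases k) auto
    let ?w = "drop_coordinate i (drop_coordinate l y)"
    have dl: "drop_coordinate l y \<in> standard_simplex k" "drop_coordinate l y i = 0"
      using drop_coordinate_in_simplex[OF y(1)] that by (auto simp: drop_coordinate_def)
    have di: "drop_coordinate i y (l - Suc 0) = 0"
      using that by (auto simp: drop_coordinate_def)
    have w: "?w \<in> standard_simplex j"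
      using drop_coordinate_in_simplex[of "drop_coordinate l y" j i] dl that k by auto
    have e1: "simplical_face (l - Suc 0) ?w = drop_coordinate i y"
      using simplical_face_drop_coordinate[of "drop_coordinate i y" "l - Suc 0", OF di]
        drop_coordinate_drop_coordinate[OF that(1), of y] by simp
    have e2: "simplical_face i ?w = drop_coordinate l y"
      using simplical_face_drop_coordinate[of "drop_coordinate l y" i, OF dl(2)] by simp
    have "singular_face k (l - Suc 0) (singular_face (Suc k) i f) = singular_face k i (singular_face (Suc k) l f)"
      using singular_face_singular_face[OF that(1)] that(2) k by simp
    then have "h (singular_face (Suc k) i f) (t, simplical_face (l - Suc 0) ?w) =
        h (singular_face (Suc k) l f) (t, simplical_face i ?w)"
      using agree[unfolded agree_on_faces_def, rule_format, of j "singular_face (Suc k) i f"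
          "singular_face (Suc k) l f" "l - Suc 0" i t ?w] face[of i] face[of l] that(1-3) w k by simp
    then show ?thesis unfolding e1 e2 .
  qed
  have cont: "continuous_map (subtopology (top_of_set (horn (Suc k))) (T i)) P (g i)" if "i \<le> Suc (Suc k)" for i
  proof (cases "i = Suc (Suc k)")
    case True
    have "continuous_on (T i) (snd :: real \<times> (nat \<Rightarrow> real) \<Rightarrow> _)" by (intro continuous_intros)
    then have snd: "continuous_map (top_of_set (T i)) (top_of_set (standard_simplex (Suc k))) snd"
      using True hornD by (auto simp: continuous_map_in_subtopology T_def)
    have "continuous_map (top_of_set (T i)) P (f \<circ> snd)"
      by (rule continuous_map_compose[OF snd])
        (use f in \<open>simp add: singular_simplex_def powertop_real_subtopology\<close>)
    then show ?thesis
      unfolding ctop by (simp add: g_def True)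
  next
    case False
    then have i: "i \<le> Suc k" using that by simp
    have "continuous_on (T i) (\<lambda>z. (fst z, drop_coordinate i (snd z)))"
      by (intro continuous_on_Pair continuous_on_drop_coordinate continuous_on_fst continuous_on_snd continuous_on_id)
    moreover have "(fst z, drop_coordinate i (snd z)) \<in> prism k" if "z \<in> T i" for z
      using that False i hornD[of z] drop_coordinate_in_simplex[of "snd z" k i] by (simp add: T_def prism_def)
    ultimately have c: "continuous_map (top_of_set (T i)) (top_of_set (prism k)) (\<lambda>z. (fst z, drop_coordinate i (snd z)))"
      by (auto simp: continuous_map_in_subtopology)
    have "continuous_map (top_of_set (prism k)) P (h (singular_face (Suc k) i f))"
      using h face[OF i] by (simp add: homotopies_into_def)
    from continuous_map_compose[OF c this] show ?thesis
      using False by (simp add: ctop g_def o_def)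
  qed
  have compat: "g i z = g l z" if il: "i \<le> Suc (Suc k)" "l \<le> Suc (Suc k)" and z: "z \<in> T i" "z \<in> T l" for i l z
  proof -
    have *: "g i z = g l z" if "i < l" "l \<le> Suc (Suc k)" "z \<in> T i" "z \<in> T l" for i l
    proof -
      have i: "z \<in> horn (Suc k)" "snd z i = 0" and gi: "g i z = h (singular_face (Suc k) i f) (fst z, drop_coordinate i (snd z))"
        using that by (simp_all add: T_def g_def split: if_splits)
      show ?thesis
      proof (cases "l = Suc (Suc k)")
        case True
        then have "fst z = 0" "g l z = f (snd z)" using that by (simp_all add: T_def g_def)
        then show ?thesis using base[OF _ hornD(2)[OF i(1)] i(2)] True that gi by simp
      next
        case False
        then have "snd z l = 0" "g l z = h (singular_face (Suc k) l f) (fst z, drop_coordinate l (snd z))" "l \<le> Suc k"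
          using that by (simp_all add: T_def g_def)
        then show ?thesis using ord[OF that(1) _ hornD(1)[OF i(1)] hornD(2)[OF i(1)] i(2)] gi by simp
      qed
    qed
    consider "i < l" | "i = l" | "l < i" by linarith
    then show ?thesis
    proof cases
      case 1
      then show ?thesis using *[of i l] il z by blast
    next
      case 3
      then show ?thesis using *[of l i] il z by simp
    qed simp
  qed
  have cover: "topspace (top_of_set (horn (Suc k))) \<subseteq> \<Union>(T ` {..Suc (Suc k)})"
  proof
    fix z assume "z \<in> topspace (top_of_set (horn (Suc k)))"
    then have z: "z \<in> horn (Suc k)" by simp
    then consider "fst z = 0" | i where "i \<le> Suc k" "snd z i = 0"
      by (auto simp: horn_def simplex_boundary_def)
    then show "z \<in> \<Union>(T ` {..Suc (Suc k)})"
    proof cases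
      case 1
      then have "z \<in> T (Suc (Suc k))" using z by (simp add: T_def)
      then show ?thesis by blast
    next
      case 2
      then have "z \<in> T i" using z by (simp add: T_def)
      then show ?thesis using 2(1) by (intro UN_I[of i]) auto
    qed
  qed
  have clo: "closedin (top_of_set (horn (Suc k))) (T i)" for i
    using closedin_prism_conditions by (auto simp: T_def)
  obtain F where F: "continuous_map (top_of_set (horn (Suc k))) P F"
    and Fg: "\<And>x i. \<lbrakk>i \<in> {..Suc (Suc k)}; x \<in> topspace (top_of_set (horn (Suc k))) \<inter> T i\<rbrakk> \<Longrightarrow> F x = g i x"
  proof (rule pasting_lemma_exists_closed[OF finite_atMost cover, of P g])
    show "closedin (top_of_set (horn (Suc k))) (T i)" for i by (rule clo)
    show "continuous_map (subtopology (top_of_set (horn (Suc k))) (T i)) P (g i)" if "i \<in> {..Suc (Suc k)}" for i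
      using cont that by simp
    show "g i z = g l z" if "i \<in> {..Suc (Suc k)}" "l \<in> {..Suc (Suc k)}"
      "z \<in> topspace (top_of_set (horn (Suc k))) \<inter> T i \<inter> T l" for i l z
      using compat[of i l z] that by simp
  qed blast
  show thesis
  proof (rule that[OF F])
    fix x assume "x \<in> standard_simplex (Suc k)"
    then have "(0, x) \<in> T (Suc (Suc k))" "(0, x) \<in> horn (Suc k)"
      by (auto simp: T_def horn_def prism_def)
    then show "F (0, x) = f x" using Fg[of "Suc (Suc k)" "(0, x)"] by (simp add: g_def)
  next
    fix t :: real and x i assume a: "t \<in> {0..1}" "x \<in> standard_simplex k" "i \<le> Suc k"
    have "simplical_face i x \<in> standard_simplex (Suc k)"
      using simplical_face_in_standard_simplex[of "Suc k" i x] a by simp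
    then have "(t, simplical_face i x) \<in> horn (Suc k)" "(t, simplical_face i x) \<in> T i"
      using a simplical_face_at[of i x] by (auto simp: T_def horn_def prism_def simplex_boundary_def)
    then show "F (t, simplical_face i x) = h (singular_face (Suc k) i f) (t, x)"
      using Fg[of i "(t, simplical_face i x)"] a by (simp add: g_def drop_coordinate_simplical_face)
  qed
qed

text \<open>A simplex is treated after its faces: one inside \<open>B\<close> stays put, any other
  one is extended from the horn by \<open>ext\<close>.\<close>

lemma homotopy_family_exists:
  fixes P :: "'a topology"
  assumes ext: "\<And>k F. \<lbrakk>continuous_map (top_of_set (horn k)) P F; \<And>x. x \<in> simplex_boundary k \<Longrightarrow> F (1, x) \<in> B\<rbrakk> \<Longrightarrow>
      \<exists>L. continuous_map (top_of_set (prism k)) P L \<and> (\<forall>z\<in>horn k. L z = F z) \<and> (\<forall>x\<in>standard_simplex k. L (1, x) \<in> B)"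
  obtains h where "\<And>k. homotopies_into P B k (h k)"
    "\<And>k f i t x. \<lbrakk>singular_simplex (Suc k) P f; i \<le> Suc k; t \<in> {0..1}; x \<in> standard_simplex k\<rbrakk> \<Longrightarrow>
        h (Suc k) f (t, simplical_face i x) = h k (singular_face (Suc k) i f) (t, x)"
proof -
  define Q where "Q k h h' \<longleftrightarrow> (\<forall>f i t x. singular_simplex (Suc k) P f \<and> i \<le> Suc k \<and> t \<in> {0..1} \<and> x \<in> standard_simplex k \<longrightarrow>
        h' f (t, simplical_face i x) = h (singular_face (Suc k) i f) (t, x))"
    for k and h h' :: "((nat \<Rightarrow> real) \<Rightarrow> 'a) \<Rightarrow> real \<times> (nat \<Rightarrow> real) \<Rightarrow> 'a"
  have stationary: "continuous_map (top_of_set (prism k)) P (f \<circ> snd)" if "singular_simplex k P f" for k f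
  proof -
    have "continuous_on (prism k) (snd :: real \<times> (nat \<Rightarrow> real) \<Rightarrow> _)" by (intro continuous_intros)
    then have snd: "continuous_map (top_of_set (prism k)) (top_of_set (standard_simplex k)) snd"
      by (auto simp: continuous_map_in_subtopology prism_def)
    show ?thesis
      by (rule continuous_map_compose[OF snd])
        (use that in \<open>simp add: singular_simplex_def powertop_real_subtopology\<close>)
  qed
  have "\<exists>h. \<forall>k. (homotopies_into P B k (h k) \<and> agree_on_faces P k (h k)) \<and> Q k (h k) (h (Suc k))"
  proof (rule dependent_nat_choice)
    have "\<exists>L. continuous_map (top_of_set (prism 0)) P L \<and> (\<forall>x\<in>standard_simplex 0. L (0, x) = f x \<and> L (1, x) \<in> B) \<and>
        (f ` standard_simplex 0 \<subseteq> B \<longrightarrow> (\<forall>z\<in>prism 0. L z = f (snd z)))" if f: "singular_simplex 0 P f" for f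
    proof (cases "f ` standard_simplex 0 \<subseteq> B")
      case True
      then show ?thesis using stationary[OF f] by (intro exI[of _ "f \<circ> snd"]) auto
    next
      case False
      have "continuous_map (top_of_set (horn 0)) P (f \<circ> snd)"
        using stationary[OF f] horn_subset_prism continuous_map_from_subtopology_mono by blast
      moreover have "simplex_boundary 0 = {}" by (auto simp: simplex_boundary_def standard_simplex_def)
      ultimately obtain L where "continuous_map (top_of_set (prism 0)) P L"
          "\<forall>z\<in>horn 0. L z = f (snd z)" "\<forall>x\<in>standard_simplex 0. L (1, x) \<in> B"
        using ext[of 0 "f \<circ> snd"] by auto
      then show ?thesis using False by (intro exI[of _ L]) (auto simp: horn_def prism_def)
    qed
    then obtain h where "homotopies_into P B 0 h" unfolding homotopies_into_def by metis
    then show "\<exists>h. homotopies_into P B 0 h \<and> agree_on_faces P 0 h"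
      by (auto simp: agree_on_faces_def)
  next
    fix h k assume "homotopies_into P B k h \<and> agree_on_faces P k h"
    then have h: "homotopies_into P B k h" and agree: "agree_on_faces P k h" by auto
    have "\<exists>L. continuous_map (top_of_set (prism (Suc k))) P L \<and>
        (\<forall>x\<in>standard_simplex (Suc k). L (0, x) = f x \<and> L (1, x) \<in> B) \<and>
        (f ` standard_simplex (Suc k) \<subseteq> B \<longrightarrow> (\<forall>z\<in>prism (Suc k). L z = f (snd z))) \<and>
        (\<forall>i t x. i \<le> Suc k \<and> t \<in> {0..1} \<and> x \<in> standard_simplex k \<longrightarrow>
          L (t, simplical_face i x) = h (singular_face (Suc k) i f) (t, x))"
      if f: "singular_simplex (Suc k) P f" for f
    proof -
      have face: "singular_simplex k P (singular_face (Suc k) i f)" if "i \<le> Suc k" for i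
        using singular_simplex_singular_face[OF f, of i] that by simp
      have sf: "simplical_face i x \<in> standard_simplex (Suc k)" if "i \<le> Suc k" "x \<in> standard_simplex k" for i x
        using simplical_face_in_standard_simplex[of "Suc k" i x] that by simp
      show ?thesis
      proof (cases "f ` standard_simplex (Suc k) \<subseteq> B")
        case True
        have "f (simplical_face i x) = h (singular_face (Suc k) i f) (t, x)"
          if a: "i \<le> Suc k" "t \<in> {0..1}" "x \<in> standard_simplex k" for i t x
        proof -
          have "singular_face (Suc k) i f ` standard_simplex k \<subseteq> B"
            using True sf[OF a(1)] by (auto simp: singular_face_def)
          moreover have "(t, x) \<in> prism k" using a by (simp add: prism_def)
          ultimately have "h (singular_face (Suc k) i f) (t, x) = singular_face (Suc k) i f x"
            using h face[OF a(1)] by (simp add: homotopies_into_def)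
          then show ?thesis using a by (simp add: singular_face_def)
        qed
        then show ?thesis using stationary[OF f] True by (intro exI[of _ "f \<circ> snd"]) auto
      next
        case False
        obtain F where F: "continuous_map (top_of_set (horn (Suc k))) P F"
          and F0: "\<And>x. x \<in> standard_simplex (Suc k) \<Longrightarrow> F (0, x) = f x"
          and Fi: "\<And>t x i. \<lbrakk>t \<in> {0..1}; x \<in> standard_simplex k; i \<le> Suc k\<rbrakk> \<Longrightarrow>
            F (t, simplical_face i x) = h (singular_face (Suc k) i f) (t, x)"
          using horn_data[OF h agree f] by blast
        have "F (1, y) \<in> B" if y: "y \<in> simplex_boundary (Suc k)" for y
        proof -
          obtain i where i: "i \<le> Suc k" "y i = 0" "y \<in> standard_simplex (Suc k)"
            using y by (auto simp: simplex_boundary_def)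
          then have d: "drop_coordinate i y \<in> standard_simplex k" using drop_coordinate_in_simplex by blast
          then have "h (singular_face (Suc k) i f) (1, drop_coordinate i y) \<in> B"
            using h face[OF i(1)] by (simp add: homotopies_into_def)
          then show ?thesis
            using Fi[of 1 "drop_coordinate i y" i] d i simplical_face_drop_coordinate[of y i, OF i(2)] by simp
        qed
        then obtain L where L: "continuous_map (top_of_set (prism (Suc k))) P L"
            "\<forall>z\<in>horn (Suc k). L z = F z" "\<forall>x\<in>standard_simplex (Suc k). L (1, x) \<in> B"
          using ext[OF F] by blast
        have "(0, x) \<in> horn (Suc k)" if "x \<in> standard_simplex (Suc k)" for x
          using that by (simp add: horn_def prism_def)
        moreover have "(t, simplical_face i x) \<in> horn (Suc k)"
          if "i \<le> Suc k" "t \<in> {0..1}" "x \<in> standard_simplex k" for i t x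
          using that sf[of i x] simplical_face_at[of i x] by (auto simp: horn_def prism_def simplex_boundary_def)
        ultimately show ?thesis using L F0 Fi False by (intro exI[of _ L]) simp
      qed
    qed
    then obtain h' where h': "\<And>f. singular_simplex (Suc k) P f \<Longrightarrow> continuous_map (top_of_set (prism (Suc k))) P (h' f) \<and>
        (\<forall>x\<in>standard_simplex (Suc k). h' f (0, x) = f x \<and> h' f (1, x) \<in> B) \<and>
        (f ` standard_simplex (Suc k) \<subseteq> B \<longrightarrow> (\<forall>z\<in>prism (Suc k). h' f z = f (snd z))) \<and>
        (\<forall>i t x. i \<le> Suc k \<and> t \<in> {0..1} \<and> x \<in> standard_simplex k \<longrightarrow>
          h' f (t, simplical_face i x) = h (singular_face (Suc k) i f) (t, x))"
      by metis
    have "homotopies_into P B (Suc k) h'" unfolding homotopies_into_def using h' by blast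
    moreover have "agree_on_faces P (Suc k) h'" unfolding agree_on_faces_def using h' by simp
    moreover have "Q k h h'" unfolding Q_def using h' by blast
    ultimately show "\<exists>h'. (homotopies_into P B (Suc k) h' \<and> agree_on_faces P (Suc k) h') \<and> Q k h h'" by blast
  qed
  then obtain h where "\<And>k. homotopies_into P B k (h k)" "\<And>k. Q k (h k) (h (Suc k))" by blast
  then show thesis using that[of h] unfolding Q_def by blast
qed

text \<open>The relative homology of the pair vanishes, because all simplices deform into
  \<open>B\<close> compatibly with their faces.\<close>

lemma relative_boundary_exists:
  assumes ext: "\<And>k F. \<lbrakk>continuous_map (top_of_set (horn k)) P F; \<And>x. x \<in> simplex_boundary k \<Longrightarrow> F (1, x) \<in> B\<rbrakk> \<Longrightarrow>
      \<exists>L. continuous_map (top_of_set (prism k)) P L \<and> (\<forall>z\<in>horn k. L z = F z) \<and> (\<forall>x\<in>standard_simplex k. L (1, x) \<in> B)"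
    and c: "singular_chain k P c" "k \<noteq> 0 \<Longrightarrow> singular_chain (k - Suc 0) (subtopology P B) (chain_boundary k c)"
  shows "\<exists>b e. singular_chain (Suc k) P b \<and> singular_chain k (subtopology P B) e \<and> c = e + chain_boundary (Suc k) b"
proof -
  obtain h where h: "\<And>k. homotopies_into P B k (h k)"
    and hf: "\<And>k f i t x. \<lbrakk>singular_simplex (Suc k) P f; i \<le> Suc k; t \<in> {0..1}; x \<in> standard_simplex k\<rbrakk> \<Longrightarrow>
        h (Suc k) f (t, simplical_face i x) = h k (singular_face (Suc k) i f) (t, x)"
    using homotopy_family_exists[OF ext] by blast
  obtain D R where D: "\<And>k. D k 0 = 0"
    "\<And>k c. singular_chain k P c \<Longrightarrow> singular_chain (Suc k) P (D k c)"
    "\<And>k c. singular_chain k (subtopology P B) c \<Longrightarrow> singular_chain (Suc k) (subtopology P B) (D k c)"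
    "\<And>k c. singular_chain k P c \<Longrightarrow> singular_chain k (subtopology P B) (R k c)"
    "\<And>k c. singular_chain k P c \<Longrightarrow>
      chain_boundary (Suc k) (D k c) = R k c - c - D (k - Suc 0) (chain_boundary k c)"
  proof (rule prism_operator[of P h B])
    fix k f assume f: "singular_simplex k P f"
    show "continuous_map (top_of_set (prism k)) P (h k f)"
      using h[of k] f by (simp add: homotopies_into_def)
    show "h k f (0, x) = f x" "h k f (1, x) \<in> B" if "x \<in> standard_simplex k" for x
      using h[of k] f that by (auto simp: homotopies_into_def)
    show "h k f z \<in> B" if "f ` standard_simplex k \<subseteq> B" "z \<in> prism k" for z
      using h[of k] f that by (auto simp: homotopies_into_def prism_def)
  qed (use hf in blast)+
  have "singular_chain k (subtopology P B) (D (k - Suc 0) (chain_boundary k c))"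
  proof (cases k)
    case 0
    then show ?thesis by (simp add: chain_boundary_def D(1))
  next
    case (Suc j)
    then show ?thesis using D(3)[of j "chain_boundary k c"] c(2) by simp
  qed
  \<comment> \<open>The boundary formula for \<open>D\<close>, solved for \<open>c\<close>; the term
    with \<open>D\<close> of the boundary stays in \<open>B\<close> because the boundary of
    \<open>c\<close> lies there.\<close>
  then show ?thesis
    using D(2,4,5)[OF c(1)]
    by (intro exI[of _ "- D k c"] exI[of _ "R k c - D (k - Suc 0) (chain_boundary k c)"])
      (auto simp: singular_chain_minus singular_chain_diff chain_boundary_minus)
qed

subsection \<open>Null homotopies over simplices\<close>

text \<open>Where \<open>c\<close> vanishes the quotient is 0 by convention; nearby,
  \<open>b / c\<close> stays bounded by \<open>K\<close> while \<open>a\<close> tends to 0.\<close>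

lemma continuous_on_damped_quotient:
  fixes a b c :: "'a::topological_space \<Rightarrow> real"
  assumes "continuous_on S a" "continuous_on S b" "continuous_on S c"
    and bound: "\<And>x. x \<in> S \<Longrightarrow> \<bar>b x\<bar> \<le> K * \<bar>c x\<bar>" and zero: "\<And>x. \<lbrakk>x \<in> S; c x = 0\<rbrakk> \<Longrightarrow> a x = 0"
  shows "continuous_on S (\<lambda>x. a x * b x / c x)"
  unfolding continuous_on_def
proof
  fix x assume x: "x \<in> S"
  have lim: "(a \<longlongrightarrow> a x) (at x within S)" "(b \<longlongrightarrow> b x) (at x within S)" "(c \<longlongrightarrow> c x) (at x within S)"
    using assms(1-3) x by (auto simp: continuous_on_def)
  show "((\<lambda>x. a x * b x / c x) \<longlongrightarrow> a x * b x / c x) (at x within S)"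
  proof (cases "c x = 0")
    case False
    then show ?thesis using lim by (intro tendsto_intros) auto
  next
    case True
    have "\<bar>a y * b y / c y\<bar> \<le> \<bar>K\<bar> * \<bar>a y\<bar>" if "y \<in> S" for y
    proof (cases "c y = 0")
      case False
      have "K * \<bar>c y\<bar> \<le> \<bar>K\<bar> * \<bar>c y\<bar>" by (intro mult_right_mono) auto
      then have "\<bar>b y\<bar> \<le> \<bar>K\<bar> * \<bar>c y\<bar>" using bound[OF that] by simp
      then have "\<bar>b y\<bar> / \<bar>c y\<bar> \<le> \<bar>K\<bar>" using False by (simp add: divide_simps)
      then have "\<bar>a y\<bar> * (\<bar>b y\<bar> / \<bar>c y\<bar>) \<le> \<bar>a y\<bar> * \<bar>K\<bar>" by (intro mult_left_mono) auto
      then show ?thesis by (simp add: abs_mult abs_divide mult.commute)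
    qed simp
    then have ev: "\<forall>\<^sub>F y in at x within S. norm (a y * b y / c y) \<le> \<bar>K\<bar> * \<bar>a y\<bar>"
      unfolding eventually_at_filter by (intro always_eventually) simp
    have "((\<lambda>y. \<bar>K\<bar> * \<bar>a y\<bar>) \<longlongrightarrow> \<bar>K\<bar> * \<bar>a x\<bar>) (at x within S)"
      using lim by (intro tendsto_intros)
    then have "((\<lambda>y. \<bar>K\<bar> * \<bar>a y\<bar>) \<longlongrightarrow> 0) (at x within S)"
      using zero[OF x True] by simp
    then have "((\<lambda>x. a x * b x / c x) \<longlongrightarrow> 0) (at x within S)"
      by (rule Lim_null_comparison[OF ev])
    then show ?thesis using True by simp
  qed
qed

definition max_coord :: "nat \<Rightarrow> (nat \<Rightarrow> real) \<Rightarrow> real" where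
  "max_coord k x = Max (insert 0 (x ` {..<k}))"

definition sum_coord :: "nat \<Rightarrow> (nat \<Rightarrow> real) \<Rightarrow> real" where
  "sum_coord k x = (\<Sum>i<k. x i)"

definition cube_set :: "nat \<Rightarrow> (nat \<Rightarrow> real) set" where
  "cube_set k = {x. (\<forall>i\<ge>k. x i = 0) \<and> (\<forall>i<k. 0 \<le> x i \<and> x i \<le> 1)}"

lemma cube_eq: "cube k = top_of_set (cube_set k)"
proof -
  have "{x. \<forall>i\<ge>k. x i = 0} \<inter> {t. \<forall>j<k. 0 \<le> t j \<and> t j \<le> (1::real)} = cube_set k"
    by (auto simp: cube_set_def)
  then show ?thesis
    by (simp add: cube_def Euclidean_space_def subtopology_subtopology euclidean_product_topology)
qed

text \<open>The homeomorphism between the cube and the simplex, viewed as cones over their faces opposite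
  to the origin.\<close>

definition cube_to_simplex :: "nat \<Rightarrow> (nat \<Rightarrow> real) \<Rightarrow> nat \<Rightarrow> real" where
  "cube_to_simplex k x = (\<lambda>i. if i < k then x i * max_coord k x / sum_coord k x
     else if i = k then 1 - max_coord k x else 0)"

text \<open>Both maps rescale the rays from the origin so that the largest coordinate of the cube
  point is the sum of the first \<open>k\<close> coordinates of the simplex point. At the origin the
  quotient is 0 by convention.\<close>

definition simplex_to_cube :: "nat \<Rightarrow> (nat \<Rightarrow> real) \<Rightarrow> nat \<Rightarrow> real" where
  "simplex_to_cube k z = (\<lambda>i. if i < k then z i * sum_coord k z / max_coord k z else 0)"

lemma coordinate_continuous: "continuous_on S (\<lambda>x :: nat \<Rightarrow> real. x i)"
  by (rule continuous_on_product_then_coordinatewise) (rule continuous_on_id)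

lemma continuous_on_max_coord: "continuous_on S (max_coord k)"
proof (induction k)
  case (Suc k)
  have "max_coord (Suc k) x = max (x k) (max_coord k x)" for x
    unfolding max_coord_def lessThan_Suc image_insert insert_commute[of 0] by (rule Max_insert) auto
  then show ?case using Suc coordinate_continuous by (auto intro: continuous_intros cong: continuous_on_cong)
qed (simp add: max_coord_def)

lemma continuous_on_sum_coord: "continuous_on S (sum_coord k)"
  unfolding sum_coord_def by (intro continuous_on_sum coordinate_continuous)

lemma max_coord_scale:
  assumes "0 \<le> c" "\<And>i. i < k \<Longrightarrow> y i = x i * c"
  shows "max_coord k y = max_coord k x * c"
proof -
  have "mono (\<lambda>u :: real. u * c)" using assms by (auto simp: mono_def intro: mult_right_mono)
  then have "max_coord k x * c = Max ((\<lambda>u. u * c) ` insert 0 (x ` {..<k}))"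
    unfolding max_coord_def by (intro mono_Max_commute) auto
  also have "(\<lambda>u. u * c) ` insert 0 (x ` {..<k}) = insert 0 (y ` {..<k})"
    using assms(2) by (auto simp: image_image)
  finally show ?thesis by (simp add: max_coord_def)
qed

lemma
  assumes "\<forall>i<k. 0 \<le> x i"
  shows max_coord_nonneg: "0 \<le> max_coord k x"
    and coord_le_max: "i < k \<Longrightarrow> x i \<le> max_coord k x"
    and max_le_sum_coord: "max_coord k x \<le> sum_coord k x"
    and sum_le_max_coord: "sum_coord k x \<le> real k * max_coord k x"
proof -
  show "0 \<le> max_coord k x" by (simp add: max_coord_def)
  have le: "x i \<le> max_coord k x" if "i < k" for i using that by (simp add: max_coord_def)
  then show "i < k \<Longrightarrow> x i \<le> max_coord k x" .
  have "x i \<le> sum_coord k x" if "i < k" for i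
    unfolding sum_coord_def using that assms by (intro member_le_sum) auto
  moreover have "0 \<le> sum_coord k x" unfolding sum_coord_def using assms by (intro sum_nonneg) auto
  ultimately show "max_coord k x \<le> sum_coord k x" by (auto simp: max_coord_def)
  show "sum_coord k x \<le> real k * max_coord k x"
    using sum_bounded_above[of "{..<k}" x "max_coord k x"] le by (simp add: sum_coord_def)
qed

lemma max_coord_eq_0:
  assumes "\<forall>i<k. 0 \<le> x i" "max_coord k x = 0" "i < k"
  shows "x i = 0"
  using coord_le_max[OF assms(1,3)] assms by force

lemma continuous_on_cube_to_simplex: "continuous_on (cube_set k) (cube_to_simplex k)"
proof (rule continuous_on_coordinatewise_then_product)
  fix i
  have nn: "\<forall>i<k. 0 \<le> x i" if "x \<in> cube_set k" for x using that by (simp add: cube_set_def)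
  have "continuous_on (cube_set k) (\<lambda>x. x i * max_coord k x / sum_coord k x)" if "i < k"
  proof (rule continuous_on_damped_quotient[where K = 1])
    fix x assume x: "x \<in> cube_set k"
    show "\<bar>max_coord k x\<bar> \<le> 1 * \<bar>sum_coord k x\<bar>"
      using max_coord_nonneg[OF nn[OF x]] max_le_sum_coord[OF nn[OF x]] by simp
    assume "sum_coord k x = 0"
    then have "max_coord k x = 0"
      using max_coord_nonneg[OF nn[OF x]] max_le_sum_coord[OF nn[OF x]] by simp
    then show "x i = 0" using max_coord_eq_0[OF nn[OF x]] that by simp
  qed (intro coordinate_continuous continuous_on_max_coord continuous_on_sum_coord)+
  moreover have "continuous_on (cube_set k) (\<lambda>x. 1 - max_coord k x)"
    by (intro continuous_on_diff continuous_on_const continuous_on_max_coord)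
  ultimately show "continuous_on (cube_set k) (\<lambda>x. cube_to_simplex k x i)"
    by (cases "i < k"; cases "i = k") (simp_all add: cube_to_simplex_def)
qed

lemma continuous_on_simplex_to_cube: "continuous_on (standard_simplex k) (simplex_to_cube k)"
proof (rule continuous_on_coordinatewise_then_product)
  fix i
  have nn: "\<forall>i<k. 0 \<le> x i" if "x \<in> standard_simplex k" for x
    using that by (simp add: standard_simplex_def)
  have "continuous_on (standard_simplex k) (\<lambda>x. x i * sum_coord k x / max_coord k x)" if "i < k"
  proof (rule continuous_on_damped_quotient[where K = "real k"])
    fix x assume x: "x \<in> standard_simplex k"
    show "\<bar>sum_coord k x\<bar> \<le> real k * \<bar>max_coord k x\<bar>"
      using max_coord_nonneg[OF nn[OF x]] max_le_sum_coord[OF nn[OF x]] sum_le_max_coord[OF nn[OF x]] by simp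
    show "x i = 0" if "max_coord k x = 0"
      using max_coord_eq_0[OF nn[OF x] that] \<open>i < k\<close> by simp
  qed (intro coordinate_continuous continuous_on_max_coord continuous_on_sum_coord)+
  then show "continuous_on (standard_simplex k) (\<lambda>x. simplex_to_cube k x i)"
    by (cases "i < k") (simp_all add: simplex_to_cube_def)
qed

lemma cube_to_simplex_in:
  assumes x: "x \<in> cube_set k"
  shows "cube_to_simplex k x \<in> standard_simplex k"
proof -
  let ?y = "cube_to_simplex k x"
  have nn: "\<forall>i<k. 0 \<le> x i" using x by (simp add: cube_set_def)
  note m = max_coord_nonneg[OF nn] max_le_sum_coord[OF nn]
  have m1: "max_coord k x \<le> 1" using x by (auto simp: max_coord_def cube_set_def)
  have pos: "0 \<le> ?y i" for i
    using m m1 nn by (auto simp: cube_to_simplex_def)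
  have "sum ?y {..k} = (\<Sum>i<k. x i * max_coord k x / sum_coord k x) + (1 - max_coord k x)"
    by (simp add: cube_to_simplex_def lessThan_Suc_atMost[symmetric])
  also have "(\<Sum>i<k. x i * max_coord k x / sum_coord k x) = sum_coord k x * max_coord k x / sum_coord k x"
    by (simp add: sum_coord_def sum_distrib_right sum_divide_distrib)
  also have "\<dots> = max_coord k x" using m by (cases "sum_coord k x = 0") auto
  finally have s: "sum ?y {..k} = 1" by simp
  have "?y i \<le> 1" for i
  proof (cases "i \<le> k")
    case True
    then show ?thesis using member_le_sum[of i "{..k}" ?y] pos s by auto
  qed (simp add: cube_to_simplex_def)
  then show ?thesis using pos s by (auto simp: standard_simplex_def cube_to_simplex_def)
qed

lemma simplex_sum_coord:
  assumes "z \<in> standard_simplex k"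
  shows "sum_coord k z = 1 - z k"
  using assms by (simp add: sum_coord_def standard_simplex_def lessThan_Suc_atMost[symmetric])

lemma
  assumes z: "z \<in> standard_simplex k"
  shows simplex_to_cube_in: "simplex_to_cube k z \<in> cube_set k"
    and cube_to_simplex_to_cube: "cube_to_simplex k (simplex_to_cube k z) = z"
    and simplex_to_cube_boundary: "z \<in> simplex_boundary k \<Longrightarrow> simplex_to_cube k z \<in> cube_boundary k"
proof -
  let ?s = "sum_coord k z" and ?m = "max_coord k z" and ?x = "simplex_to_cube k z"
  have nn: "\<forall>i<k. 0 \<le> z i" using z by (simp add: standard_simplex_def)
  note m = max_coord_nonneg[OF nn] max_le_sum_coord[OF nn] sum_le_max_coord[OF nn] coord_le_max[OF nn]
  have s1: "?s \<le> 1" using simplex_sum_coord[OF z] z by (simp add: standard_simplex_def)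
  have m0: "?s = 0" if "?m = 0" using m that by simp
  have mx: "max_coord k ?x = ?s"
  proof -
    have "max_coord k ?x = ?m * (?s / ?m)"
      by (rule max_coord_scale) (use m in \<open>auto simp: simplex_to_cube_def\<close>)
    then show ?thesis using m0 by (cases "?m = 0") auto
  qed
  have sx: "sum_coord k ?x = ?s * ?s / ?m"
    by (simp add: sum_coord_def simplex_to_cube_def sum_distrib_right sum_divide_distrib)
  have "?x i \<le> 1" "0 \<le> ?x i" if "i < k" for i
  proof -
    show "0 \<le> ?x i" using m nn that by (simp add: simplex_to_cube_def)
    have "?x i \<le> max_coord k ?x" using that by (simp add: max_coord_def)
    then show "?x i \<le> 1" using mx s1 by simp
  qed
  then show xc: "?x \<in> cube_set k" by (simp add: cube_set_def simplex_to_cube_def)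
  show "cube_to_simplex k ?x = z"
  proof
    fix i
    consider "i < k" | "i = k" | "k < i" by linarith
    then show "cube_to_simplex k ?x i = z i"
    proof cases
      case 1
      have "z i = 0" if "?m = 0" using max_coord_eq_0[OF nn that 1] by simp
      moreover have "?s \<noteq> 0" if "?m \<noteq> 0" using m that by simp
      ultimately show ?thesis
        using 1 unfolding cube_to_simplex_def mx sx by (simp add: simplex_to_cube_def)
    next
      case 2
      then show ?thesis using simplex_sum_coord[OF z] by (simp add: cube_to_simplex_def mx)
    next
      case 3
      then show ?thesis using z by (simp add: cube_to_simplex_def standard_simplex_def)
    qed
  qed
  assume "z \<in> simplex_boundary k"
  then obtain i where i: "i \<le> k" "z i = 0" by (auto simp: simplex_boundary_def)
  have "\<exists>j<k. ?x j = 0 \<or> ?x j = 1"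
  proof (cases "i < k")
    case True
    then show ?thesis using i by (auto simp: simplex_to_cube_def)
  next
    case False
    \<comment> \<open>The face opposite to the last vertex, where the first \<open>k\<close>
      coordinates have sum 1, goes to the faces of the cube away from the origin.\<close>
    then have "max_coord k ?x = 1" using i mx simplex_sum_coord[OF z] by simp
    then have "1 \<in> insert 0 (?x ` {..<k})" using Max_in[of "insert 0 (?x ` {..<k})"] by (simp add: max_coord_def)
    then show ?thesis by auto
  qed
  then show "?x \<in> cube_boundary k" using xc by (simp add: cube_boundary_def cube_eq)
qed

lemma cube_to_simplex_boundary:
  assumes "x \<in> cube_boundary k"
  shows "cube_to_simplex k x \<in> simplex_boundary k"
proof -
  have x: "x \<in> cube_set k" using assms by (simp add: cube_boundary_def cube_eq)
  obtain j where j: "j < k" "x j = 0 \<or> x j = 1" using assms by (auto simp: cube_boundary_def)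
  have "cube_to_simplex k x j = 0 \<or> cube_to_simplex k x k = 0"
  proof (cases "x j = 0")
    case False
    have "\<forall>i<k. 0 \<le> x i" using x by (simp add: cube_set_def)
    from coord_le_max[OF this j(1)] have "max_coord k x \<ge> 1" using j False by simp
    moreover have "max_coord k x \<le> 1" using x by (auto simp: max_coord_def cube_set_def)
    ultimately show ?thesis by (simp add: cube_to_simplex_def)
  qed (use j in \<open>simp add: cube_to_simplex_def\<close>)
  then have "\<exists>i\<le>k. cube_to_simplex k x i = 0"
  proof
    assume "cube_to_simplex k x j = 0"
    then show ?thesis using j(1) by (intro exI[of _ j]) simp
  next
    assume "cube_to_simplex k x k = 0"
    then show ?thesis by (intro exI[of _ k]) simp
  qed
  then show ?thesis using cube_to_simplex_in[OF x] by (simp add: simplex_boundary_def)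
qed

text \<open>The vanishing of homotopy groups is transported from cubes to simplices. Dimension 0 is
  separate: the groups of positive degree say nothing about path components, so a path is
  assumed.\<close>

lemma simplex_null_homotopy:
  assumes triv: "\<And>i f. \<lbrakk>1 \<le> i; f \<in> spheroids i Y y0\<rbrakk> \<Longrightarrow> (f, \<lambda>_. y0) \<in> spheroid_homotopy i Y y0"
    and f: "continuous_map (top_of_set (standard_simplex k)) Y f" "\<And>x. x \<in> simplex_boundary k \<Longrightarrow> f x = y0"
    and path: "\<And>x. x \<in> standard_simplex k \<Longrightarrow> path_component_of Y (f x) y0"
  shows "\<exists>H. continuous_map (top_of_set (prism k)) Y H \<and>
      (\<forall>x\<in>standard_simplex k. H (0, x) = f x \<and> H (1, x) = y0) \<and>
      (\<forall>t\<in>{0..1}. \<forall>x\<in>simplex_boundary k. H (t, x) = y0)"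
proof (cases "k = 0")
  case True
  let ?v = "\<lambda>j. if j = 0 then 1 else (0 :: real)"
  have S: "standard_simplex k = {?v}" "simplex_boundary k = {}"
    using True standard_simplex_0 by (auto simp: simplex_boundary_def standard_simplex_def)
  obtain p where p: "pathin Y p" "p 0 = f ?v" "p 1 = y0"
    using path[of ?v] S by (auto simp: path_component_of_def)
  have "continuous_on (prism k) (fst :: real \<times> (nat \<Rightarrow> real) \<Rightarrow> real)" by (intro continuous_intros)
  then have fst: "continuous_map (top_of_set (prism k)) (top_of_set {0..1}) fst"
    by (auto simp: continuous_map_in_subtopology prism_def)
  have "continuous_map (top_of_set (prism k)) Y (p \<circ> fst)"
    by (rule continuous_map_compose[OF fst]) (use p(1) in \<open>simp add: pathin_def\<close>)
  then show ?thesis using p S by (intro exI[of _ "p \<circ> fst"]) auto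
next
  case False
  have cs: "continuous_map (cube k) (top_of_set (standard_simplex k)) (cube_to_simplex k)"
    unfolding cube_eq using continuous_on_cube_to_simplex cube_to_simplex_in
    by (auto simp: continuous_map_in_subtopology)
  have "f \<circ> cube_to_simplex k \<in> spheroids k Y y0"
    using continuous_map_compose[OF cs f(1)] cube_to_simplex_boundary f(2) by (auto simp: spheroids_def)
  then have "(f \<circ> cube_to_simplex k, \<lambda>_. y0) \<in> spheroid_homotopy k Y y0"
    using triv[of k] False by simp
  then obtain h where h: "continuous_map (prod_topology (top_of_set {0..1::real}) (cube k)) Y h"
    and h0: "\<And>x. h (0, x) = f (cube_to_simplex k x)" and h1: "\<And>x. h (1, x) = y0"
    and hb: "\<And>t x. \<lbrakk>t \<in> {0..1}; x \<in> cube_boundary k\<rbrakk> \<Longrightarrow> h (t, x) = y0"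
    by (auto simp: spheroid_homotopy_def homotopic_with_def)
  define \<theta> where "\<theta> z = (fst z, simplex_to_cube k (snd z))" for z :: "real \<times> (nat \<Rightarrow> real)"
  have snd: "snd ` prism k \<subseteq> standard_simplex k" by (auto simp: prism_def)
  have "continuous_on (prism k) (\<lambda>z. simplex_to_cube k (snd z))"
    by (rule continuous_on_compose2[OF continuous_on_simplex_to_cube continuous_on_snd[OF continuous_on_id] snd])
  then have "continuous_on (prism k) \<theta>"
    unfolding \<theta>_def by (rule continuous_on_Pair[OF continuous_on_fst[OF continuous_on_id]])
  moreover have "\<theta> z \<in> {0..1} \<times> cube_set k" if "z \<in> prism k" for z
    using that simplex_to_cube_in[of "snd z" k] by (auto simp: \<theta>_def prism_def)
  ultimately have \<theta>: "continuous_map (top_of_set (prism k)) (prod_topology (top_of_set {0..1}) (cube k)) \<theta>"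
    by (auto simp: cube_eq continuous_map_in_subtopology)
  have bound: "simplex_to_cube k x \<in> cube_boundary k" if "x \<in> simplex_boundary k" for x
    using that simplex_to_cube_boundary simplex_boundary_subset by blast
  show ?thesis
    by (intro exI[of _ "h \<circ> \<theta>"] conjI continuous_map_compose[OF \<theta> h])
      (auto simp: \<theta>_def h0 h1 cube_to_simplex_to_cube intro!: hb bound)
qed

subsection \<open>Lifting through principal bundles\<close>

text \<open>\<open>trans\<close> is the translation function of the bundle. Its continuity allows
  two lifts of the same map to be compared and corrected; the local sections produce lifts over
  small sets.\<close>

locale principal_bundle =
  fixes P :: "'p topology" and Y :: "'y topology" and q :: "'p \<Rightarrow> 'y"
    and G :: "'g topology" and act :: "'g \<Rightarrow> 'p \<Rightarrow> 'p" and trans :: "'p \<Rightarrow> 'p \<Rightarrow> 'g"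
  assumes q: "continuous_map P Y q"
    and act: "continuous_map (prod_topology G P) P (\<lambda>(g, p). act g p)"
    and q_act: "\<lbrakk>g \<in> topspace G; p \<in> topspace P\<rbrakk> \<Longrightarrow> q (act g p) = q p"
    and trans: "continuous_map (subtopology (prod_topology P P) {(p, p'). q p = q p'}) G (\<lambda>(p, p'). trans p p')"
    and act_trans: "\<lbrakk>p \<in> topspace P; p' \<in> topspace P; q p = q p'\<rbrakk> \<Longrightarrow> act (trans p p') p = p'"
    and local_section: "y \<in> topspace Y \<Longrightarrow>
      \<exists>U s. openin Y U \<and> y \<in> U \<and> continuous_map (subtopology Y U) P s \<and> (\<forall>z\<in>U. q (s z) = z)"
begin

definition lift_on :: "'b topology \<Rightarrow> ('b \<Rightarrow> 'y) \<Rightarrow> ('b \<Rightarrow> 'p) \<Rightarrow> bool" where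
  "lift_on D f L \<longleftrightarrow> continuous_map D P L \<and> (\<forall>z\<in>topspace D. q (L z) = f z)"

text \<open>Over \<open>A\<close> the lifts \<open>L\<close> and \<open>F\<close> differ by a
  function into the group. Composed with the retraction \<open>r\<close> it extends to
  \<open>D\<close>, and it moves \<open>L\<close> to a lift that extends \<open>F\<close>.\<close>

lemma relative_lift:
  assumes L: "lift_on D f L" and F: "lift_on (subtopology D A) f F"
    and r: "continuous_map D (subtopology D A) r" "\<And>z. z \<in> topspace D \<inter> A \<Longrightarrow> r z = z"
  shows "\<exists>L'. lift_on D f L' \<and> (\<forall>z\<in>topspace D \<inter> A. L' z = F z)"
proof -
  have rD: "r z \<in> topspace D" "r z \<in> A" if "z \<in> topspace D" for z
    using r(1) that by (auto simp: continuous_map_def)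
  have LP: "L z \<in> topspace P" if "z \<in> topspace D" for z
    using L that by (auto simp: lift_on_def continuous_map_def)
  have FP: "F z \<in> topspace P" if "z \<in> topspace D" "z \<in> A" for z
    using F that by (auto simp: lift_on_def continuous_map_def)
  have qLF: "q (L (r z)) = q (F (r z))" if "z \<in> topspace D" for z
    using L F rD[OF that] by (simp add: lift_on_def)
  have cL: "continuous_map D P L" and cF: "continuous_map (subtopology D A) P F"
    using L F by (auto simp: lift_on_def)
  have "continuous_map D (prod_topology P P) (\<lambda>z. (L (r z), F (r z)))"
    using continuous_map_compose[OF r(1) cF] continuous_map_compose[OF continuous_map_into_fulltopology[OF r(1)] cL]
    by (simp add: continuous_map_pairwise o_def)
  then have "continuous_map D (subtopology (prod_topology P P) {(p, p'). q p = q p'}) (\<lambda>z. (L (r z), F (r z)))"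
    using qLF by (auto simp: continuous_map_in_subtopology)
  from continuous_map_compose[OF this trans]
  have tr: "continuous_map D G (\<lambda>z. trans (L (r z)) (F (r z)))" by (simp add: o_def)
  then have trG: "trans (L (r z)) (F (r z)) \<in> topspace G" if "z \<in> topspace D" for z
    using that by (auto simp: continuous_map_def)
  define L' where "L' = (\<lambda>z. act (trans (L (r z)) (F (r z))) (L z))"
  have "continuous_map D (prod_topology G P) (\<lambda>z. (trans (L (r z)) (F (r z)), L z))"
    using tr cL by (simp add: continuous_map_pairwise o_def)
  from continuous_map_compose[OF this act] have "continuous_map D P L'"
    by (simp add: o_def L'_def)
  moreover have "q (L' z) = f z" if "z \<in> topspace D" for z
    using q_act[OF trG[OF that] LP[OF that]] L that by (simp add: L'_def lift_on_def)
  moreover have "L' z = F z" if "z \<in> topspace D \<inter> A" for z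
    using act_trans[of "L z" "F z"] LP FP qLF[of z] that r(2)[OF that] by (simp add: L'_def)
  ultimately show ?thesis by (auto simp: lift_on_def)
qed

text \<open>The lift over \<open>D2\<close> is first changed to agree with \<open>L1\<close> on the
  overlap; this is possible because the overlap is a retract of \<open>D2\<close>.\<close>

lemma glue_lifts:
  assumes D: "D = D1 \<union> D2" and clo: "closedin (top_of_set D) D1" "closedin (top_of_set D) D2"
    and L1: "lift_on (top_of_set D1) f L1" and L2: "lift_on (top_of_set D2) f L2"
    and r: "continuous_on D2 r" "\<And>z. z \<in> D2 \<Longrightarrow> r z \<in> D1 \<inter> D2" "\<And>z. z \<in> D1 \<inter> D2 \<Longrightarrow> r z = z"
  shows "\<exists>L. lift_on (top_of_set D) f L"
proof -
  let ?A = "D1 \<inter> D2"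
  have "lift_on (subtopology (top_of_set D2) ?A) f L1"
  proof -
    have "continuous_map (top_of_set ?A) P L1"
      by (rule continuous_map_from_subtopology_mono[of _ D1]) (use L1 in \<open>auto simp: lift_on_def\<close>)
    then show ?thesis using L1 by (simp add: lift_on_def subtopology_subtopology Int_absorb1)
  qed
  moreover have "continuous_map (top_of_set D2) (subtopology (top_of_set D2) ?A) r"
    using r by (auto simp: continuous_map_in_subtopology)
  ultimately obtain L2' where L2': "lift_on (top_of_set D2) f L2'" "\<And>z. z \<in> ?A \<Longrightarrow> L2' z = L1 z"
    using relative_lift[OF L2, of ?A L1 r] r(3) by auto
  define T where "T b = (if b then D1 else D2)" for b
  define g where "g b = (if b then L1 else L2')" for b
  have sub: "subtopology (top_of_set D) (T b) = top_of_set (T b)" for b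
    using D by (cases b) (auto simp: T_def subtopology_subtopology Int_absorb1)
  obtain L where L: "continuous_map (top_of_set D) P L"
    and Lg: "\<And>x b. \<lbrakk>b \<in> UNIV; x \<in> topspace (top_of_set D) \<inter> T b\<rbrakk> \<Longrightarrow> L x = g b x"
  proof (rule pasting_lemma_exists_closed[of "UNIV :: bool set" "top_of_set D" T P g])
    show "topspace (top_of_set D) \<subseteq> \<Union>(range T)"
    proof
      fix z assume "z \<in> topspace (top_of_set D)"
      then have "z \<in> T True \<or> z \<in> T False" using D by (simp add: T_def)
      then show "z \<in> \<Union>(range T)" by blast
    qed
    show "closedin (top_of_set D) (T b)" for b using clo by (simp add: T_def)
    show "continuous_map (subtopology (top_of_set D) (T b)) P (g b)" for b
      unfolding sub using L1 L2' by (cases b) (simp_all add: T_def g_def lift_on_def)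
    show "g b z = g b' z" if "z \<in> topspace (top_of_set D) \<inter> T b \<inter> T b'" for b b' z
      using that L2'(2)[of z] by (cases b; cases b') (simp_all add: T_def g_def)
  qed auto
  have "q (L z) = f z" if "z \<in> D" for z
  proof (cases "z \<in> D1")
    case True
    then show ?thesis using Lg[of True z] that L1 by (simp add: T_def g_def lift_on_def)
  next
    case False
    then show ?thesis using Lg[of False z] that L2' D by (simp add: T_def g_def lift_on_def)
  qed
  then show ?thesis using L by (auto simp: lift_on_def)
qed

end

section \<open>Lifting over cuboids by repeated halving\<close>

definition cuboid :: "nat \<Rightarrow> (nat \<Rightarrow> real) \<Rightarrow> (nat \<Rightarrow> real) \<Rightarrow> (nat \<Rightarrow> real) set" where
  "cuboid k a b = {x. (\<forall>i<k. a i \<le> x i \<and> x i \<le> b i) \<and> (\<forall>i\<ge>k. x i = 0)}"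

lemma compact_cuboid: "compact (cuboid k a b)"
proof -
  have "cuboid k a b = (\<Pi>\<^sub>E i\<in>UNIV. if i < k then {a i..b i} else {0})"
  proof (rule Set.set_eqI)
    fix x
    have "x \<in> (\<Pi>\<^sub>E i\<in>UNIV. if i < k then {a i..b i} else {0}) \<longleftrightarrow>
        (\<forall>i. x i \<in> (if i < k then {a i..b i} else {0}))"
      by (simp add: PiE_iff)
    also have "\<dots> \<longleftrightarrow> (\<forall>i. (i < k \<longrightarrow> a i \<le> x i \<and> x i \<le> b i) \<and> (k \<le> i \<longrightarrow> x i = 0))"
      by (intro all_cong1) (auto simp: not_less)
    finally show "x \<in> cuboid k a b \<longleftrightarrow> x \<in> (\<Pi>\<^sub>E i\<in>UNIV. if i < k then {a i..b i} else {0})"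
      unfolding cuboid_def by blast
  qed
  then have "compactin (powertop_real UNIV) (cuboid k a b)"
    by (simp add: compactin_PiE)
  then show ?thesis by (simp add: euclidean_product_topology)
qed

text \<open>The metric on functions is a series with weights \<open>(1/2) ^ n\<close>, whose sum is
  2.\<close>

lemma dist_fun_le:
  fixes x y :: "nat \<Rightarrow> real"
  assumes "\<And>i. \<bar>x i - y i\<bar> \<le> s"
  shows "dist x y \<le> 2 * s"
proof -
  have sm: "summable (\<lambda>n. (1/2 :: real) ^ n * s)" by (intro summable_mult2 summable_geometric) simp
  have "(1/2) ^ n * min (dist (x (from_nat n)) (y (from_nat n))) 1 \<le> (1/2 :: real) ^ n * s" for n
    using assms by (intro mult_left_mono) (auto simp: dist_real_def min.coboundedI1)
  moreover from this have "summable (\<lambda>n. (1/2) ^ n * min (dist (x (from_nat n)) (y (from_nat n))) 1)"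
    by (intro summable_comparison_test'[OF sm]) (auto simp: abs_mult)
  ultimately have "dist x y \<le> suminf (\<lambda>n. (1/2 :: real) ^ n * s)"
    unfolding dist_fun_def by (intro suminf_le sm)
  also have "\<dots> = suminf (\<lambda>n. (1/2 :: real) ^ n) * s"
    by (rule suminf_mult2[symmetric]) (simp add: summable_geometric)
  also have "\<dots> = 2 * s" by (simp add: suminf_geometric)
  finally show ?thesis .
qed

text \<open>Projecting to the wall \<open>x j = c\<close> retracts the upper half onto the overlap
  of the halves, as \<open>glue_lifts\<close> requires.\<close>

lemma cuboid_cut:
  assumes "j < k" "a j \<le> c" "c \<le> b j"
  shows "cuboid k a b = cuboid k a (b(j := c)) \<union> cuboid k (a(j := c)) b"
    "closedin (top_of_set (cuboid k a b)) (cuboid k a (b(j := c)))"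
    "closedin (top_of_set (cuboid k a b)) (cuboid k (a(j := c)) b)"
    "continuous_on S (\<lambda>x :: nat \<Rightarrow> real. x(j := c))"
    "z \<in> cuboid k (a(j := c)) b \<Longrightarrow> z(j := c) \<in> cuboid k a (b(j := c)) \<inter> cuboid k (a(j := c)) b"
    "z \<in> cuboid k a (b(j := c)) \<inter> cuboid k (a(j := c)) b \<Longrightarrow> z(j := c) = z"
proof -
  show eq: "cuboid k a b = cuboid k a (b(j := c)) \<union> cuboid k (a(j := c)) b"
  proof (intro subset_antisym subsetI)
    fix x assume x: "x \<in> cuboid k a b"
    have "x \<in> cuboid k a (b(j := c))" if "x j \<le> c" using x that by (simp add: cuboid_def)
    moreover have "x \<in> cuboid k (a(j := c)) b" if "c \<le> x j" using x that by (simp add: cuboid_def)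
    ultimately show "x \<in> cuboid k a (b(j := c)) \<union> cuboid k (a(j := c)) b" by (meson UnI1 UnI2 linear)
  next
    fix x assume "x \<in> cuboid k a (b(j := c)) \<union> cuboid k (a(j := c)) b"
    then show "x \<in> cuboid k a b"
    proof
      assume x: "x \<in> cuboid k a (b(j := c))"
      then have "x j \<le> b j" using assms by (force simp: cuboid_def)
      then have "x i \<le> b i" if "i < k" for i using x that by (cases "i = j") (auto simp: cuboid_def)
      then show ?thesis using x by (simp add: cuboid_def)
    next
      assume x: "x \<in> cuboid k (a(j := c)) b"
      then have "a j \<le> x j" using assms by (force simp: cuboid_def)
      then have "a i \<le> x i" if "i < k" for i using x that by (cases "i = j") (auto simp: cuboid_def)
      then show ?thesis using x by (simp add: cuboid_def)
    qed
  qed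
  show "closedin (top_of_set (cuboid k a b)) (cuboid k a (b(j := c)))"
    "closedin (top_of_set (cuboid k a b)) (cuboid k (a(j := c)) b)"
    using eq by (auto intro!: closed_subset compact_imp_closed compact_cuboid)
  show "continuous_on S (\<lambda>x :: nat \<Rightarrow> real. x(j := c))"
  proof (rule continuous_on_coordinatewise_then_product)
    show "continuous_on S (\<lambda>x. (x(j := c)) i)" for i
      using coordinate_continuous by (cases "i = j") auto
  qed
  show "z(j := c) \<in> cuboid k a (b(j := c)) \<inter> cuboid k (a(j := c)) b" if "z \<in> cuboid k (a(j := c)) b"
    using that assms by (auto simp: cuboid_def)
  show "z(j := c) = z" if "z \<in> cuboid k a (b(j := c)) \<inter> cuboid k (a(j := c)) b"
  proof -
    have "c \<le> z j" "z j \<le> c" using that assms(1) by (force simp: cuboid_def)+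
    then show ?thesis by auto
  qed
qed

context principal_bundle
begin

text \<open>Cuboids below a Lebesgue number are mapped into the domain of a local section; larger
  ones are halved one direction at a time and the lifts glued.\<close>

lemma cuboid_lift:
  assumes f: "continuous_map (top_of_set (cuboid k a b)) Y f"
  shows "\<exists>L. lift_on (top_of_set (cuboid k a b)) f L"
proof -
  let ?D = "cuboid k a b"
  have "\<exists>V. open V \<and> z \<in> V \<and> (\<exists>U s. openin Y U \<and> f ` (?D \<inter> V) \<subseteq> U \<and>
      continuous_map (subtopology Y U) P s \<and> (\<forall>y\<in>U. q (s y) = y))" if z: "z \<in> ?D" for z
  proof -
    have "f z \<in> topspace Y" using f z by (auto simp: continuous_map_def)
    then obtain U s where U: "openin Y U" "f z \<in> U" "continuous_map (subtopology Y U) P s" "\<forall>y\<in>U. q (s y) = y"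
      using local_section by blast
    have "openin (top_of_set ?D) {x \<in> topspace (top_of_set ?D). f x \<in> U}"
      using f U(1) unfolding continuous_map_def by blast
    then obtain V where "open V" "{x \<in> ?D. f x \<in> U} = ?D \<inter> V" by (auto simp: openin_open)
    then show ?thesis using U z by (intro exI[of _ V]) blast
  qed
  then obtain V where V: "\<And>z. z \<in> ?D \<Longrightarrow> open (V z) \<and> z \<in> V z \<and> (\<exists>U s. openin Y U \<and> f ` (?D \<inter> V z) \<subseteq> U \<and>
      continuous_map (subtopology Y U) P s \<and> (\<forall>y\<in>U. q (s y) = y))"
    by metis
  show ?thesis
  proof (cases "?D = {}")
    case True
    then show ?thesis by (simp add: lift_on_def)
  next
    case False
    obtain \<delta> where \<delta>: "0 < \<delta>" "\<And>T. \<lbrakk>T \<subseteq> ?D; diameter T < \<delta>\<rbrakk> \<Longrightarrow> \<exists>B\<in>V ` ?D. T \<subseteq> B"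
    proof (rule Lebesgue_number_lemma[OF compact_cuboid, of "V ` ?D"])
      show "V ` ?D \<noteq> {}" using False by blast
      show "?D \<subseteq> \<Union>(V ` ?D)" using V by blast
      show "open B" if "B \<in> V ` ?D" for B using that V by blast
    qed blast
    \<comment> \<open>A cuboid with sides at most \<open>s\<close> has diameter at most
      \<open>2 * s\<close>, which is below \<open>\<delta>\<close>.\<close>
    define s where "s = \<delta> / 4"
    have s: "0 < s" using \<delta> by (simp add: s_def)
    have small: "\<exists>L. lift_on (top_of_set (cuboid k a' b')) f L"
      if sub: "cuboid k a' b' \<subseteq> ?D" and side: "\<forall>i<k. b' i - a' i \<le> s" for a' b'
    proof -
      let ?T = "cuboid k a' b'"
      have dT: "dist x y \<le> 2 * s" if "x \<in> ?T" "y \<in> ?T" for x y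
      proof (rule dist_fun_le)
        fix i show "\<bar>x i - y i\<bar> \<le> s"
        proof (cases "i < k")
          case True
          then have "a' i \<le> x i" "x i \<le> b' i" "a' i \<le> y i" "y i \<le> b' i" "b' i - a' i \<le> s"
            using that side by (simp_all add: cuboid_def)
          then show ?thesis by linarith
        next
          case False
          then show ?thesis using that s by (simp add: cuboid_def)
        qed
      qed
      have "diameter ?T \<le> 2 * s"
      proof (cases "?T = {}")
        case True
        then show ?thesis using s by simp
      next
        case False
        have "(SUP (x, y)\<in>?T \<times> ?T. dist x y) \<le> 2 * s"
        proof (rule cSUP_least)
          show "?T \<times> ?T \<noteq> {}" using False by blast
          show "(case z of (x, y) \<Rightarrow> dist x y) \<le> 2 * s" if "z \<in> ?T \<times> ?T" for z
            using that dT by (cases z) simp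
        qed
        then show ?thesis using False by (simp only: diameter_def if_False)
      qed
      then have "diameter ?T < \<delta>" using s by (simp add: s_def)
      then have "\<exists>B\<in>V ` ?D. ?T \<subseteq> B" by (rule \<delta>(2)[OF sub])
      then obtain z where z: "z \<in> ?D" "?T \<subseteq> V z" by blast
      then obtain U \<sigma> where U: "openin Y U" "f ` (?D \<inter> V z) \<subseteq> U"
          "continuous_map (subtopology Y U) P \<sigma>" "\<forall>y\<in>U. q (\<sigma> y) = y"
        using V[OF z(1)] by blast
      have fU: "f x \<in> U" if "x \<in> ?T" for x using that U(2) z(2) sub by blast
      have fT: "continuous_map (top_of_set ?T) (subtopology Y U) f"
        using continuous_map_from_subtopology_mono[OF f sub] fU
        by (simp add: continuous_map_in_subtopology)
      have "continuous_map (top_of_set ?T) P (\<sigma> \<circ> f)" by (rule continuous_map_compose[OF fT U(3)])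
      then show ?thesis using U(4) fU by (intro exI[of _ "\<sigma> \<circ> f"]) (simp add: lift_on_def)
    qed
    have cut: "\<exists>L. lift_on (top_of_set (cuboid k a' b')) f L"
      if "j < k" "a' j \<le> b' j" "\<exists>L. lift_on (top_of_set (cuboid k a' (b'(j := (a' j + b' j) / 2)))) f L"
        "\<exists>L. lift_on (top_of_set (cuboid k (a'(j := (a' j + b' j) / 2)) b')) f L" for a' b' j
    proof -
      have c: "a' j \<le> (a' j + b' j) / 2" "(a' j + b' j) / 2 \<le> b' j" using that(2) by auto
      note cc = cuboid_cut[where j = j and k = k and a = a' and b = b' and c = "(a' j + b' j) / 2", OF that(1) c]
      show ?thesis using that(3,4) glue_lifts[OF cc(1-3) _ _ cc(4-6)] by blast
    qed
    have main: "\<exists>L. lift_on (top_of_set (cuboid k a' b')) f L"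
      if "cuboid k a' b' \<subseteq> ?D" "\<forall>i<k. b' i - a' i \<le> 2 ^ n * s" for n a' b'
      using that
    proof (induction n arbitrary: a' b')
      case 0
      then show ?case using small by simp
    next
      case (Suc n)
      \<comment> \<open>One doubling of all sides is spread over the directions: those below
        \<open>j\<close> may already have the doubled length.\<close>
      have "\<exists>L. lift_on (top_of_set (cuboid k a' b')) f L"
        if "j \<le> k" "cuboid k a' b' \<subseteq> ?D" "\<forall>i<k. b' i - a' i \<le> (if i < j then 2 ^ Suc n * s else 2 ^ n * s)" for j a' b'
        using that
      proof (induction j arbitrary: a' b')
        case 0
        then show ?case using Suc.IH by simp
      next
        case (Suc j)
        show ?case
        proof (cases "a' j \<le> b' j")
          case True
          let ?c = "(a' j + b' j) / 2"
          have jk: "j < k" using Suc.prems(1) by simp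
          have c: "a' j \<le> ?c" "?c \<le> b' j" using True by auto
          have sides: "b' i - a' i \<le> (if i < Suc j then 2 ^ Suc n * s else 2 ^ n * s)" if "i < k" for i
            using Suc.prems(3) that by blast
          have "cuboid k a' b' = cuboid k a' (b'(j := ?c)) \<union> cuboid k (a'(j := ?c)) b'"
            by (rule cuboid_cut(1)[where j = j and k = k and a = a' and b = b' and c = "?c", OF jk c])
          then have sub: "cuboid k a' (b'(j := ?c)) \<subseteq> ?D" "cuboid k (a'(j := ?c)) b' \<subseteq> ?D"
            using Suc.prems(2) by auto
          have "(b'(j := ?c)) i - a' i \<le> (if i < j then 2 ^ Suc n * s else 2 ^ n * s)"
            "b' i - (a'(j := ?c)) i \<le> (if i < j then 2 ^ Suc n * s else 2 ^ n * s)" if "i < k" for i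
          proof -
            have "?c - a' j \<le> 2 ^ n * s" "b' j - ?c \<le> 2 ^ n * s"
              using sides[OF jk] by (simp_all add: field_simps)
            then show "(b'(j := ?c)) i - a' i \<le> (if i < j then 2 ^ Suc n * s else 2 ^ n * s)"
              "b' i - (a'(j := ?c)) i \<le> (if i < j then 2 ^ Suc n * s else 2 ^ n * s)"
              using sides[OF that] by (cases "i = j"; simp add: less_Suc_eq)+
          qed
          then have s12: "\<forall>i<k. (b'(j := ?c)) i - a' i \<le> (if i < j then 2 ^ Suc n * s else 2 ^ n * s)"
            "\<forall>i<k. b' i - (a'(j := ?c)) i \<le> (if i < j then 2 ^ Suc n * s else 2 ^ n * s)"
            by blast+
          show ?thesis
            by (rule cut[OF jk True Suc.IH[OF less_imp_le[OF jk] sub(1) s12(1)] Suc.IH[OF less_imp_le[OF jk] sub(2) s12(2)]])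
        next
          case False
          have "x \<notin> cuboid k a' b'" for x
          proof
            assume "x \<in> cuboid k a' b'"
            then have "a' j \<le> x j" "x j \<le> b' j" using Suc.prems(1) by (simp_all add: cuboid_def)
            then show False using False by linarith
          qed
          then have "cuboid k a' b' = {}" by blast
          then show ?thesis by (simp add: lift_on_def)
        qed
      qed
      from this[of k a' b'] show ?case using Suc.prems by simp
    qed
    obtain n where n: "Max (insert 0 ((\<lambda>i. b i - a i) ` {..<k})) / s < 2 ^ n"
      using real_arch_pow[of 2] by auto
    have "b i - a i \<le> 2 ^ n * s" if "i < k" for i
    proof -
      have "b i - a i \<le> Max (insert 0 ((\<lambda>i. b i - a i) ` {..<k}))" using that by (intro Max_ge) auto
      also have "\<dots> < 2 ^ n * s" using n s by (simp add: divide_simps)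
      finally show ?thesis by simp
    qed
    then show ?thesis using main[of a b n] by simp
  qed
qed

text \<open>The prism is a retract of a cuboid: a map on it extends over the cuboid, is lifted
  there, and the lift is restricted.\<close>

lemma prism_lift:
  assumes f: "continuous_map (top_of_set (prism k)) Y f"
  shows "\<exists>L. lift_on (top_of_set (prism k)) f L"
proof -
  define C where "C = cuboid (k + 2) (\<lambda>_. 0) (\<lambda>_. 1)"
  \<comment> \<open>Coordinate \<open>Suc k\<close> is the time. The first \<open>k\<close>
    coordinates are scaled down when their sum exceeds 1, and coordinate \<open>k\<close> of the
    simplex is what is left to make the total 1.\<close>
  define r where "r x = (x (Suc k), \<lambda>i. if i < k then x i / max 1 (sum_coord k x)
      else if i = k then 1 - sum_coord k x / max 1 (sum_coord k x) else 0)" for x :: "nat \<Rightarrow> real"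
  define e where "e z = (\<lambda>i. if i \<le> k then snd z i else if i = Suc k then fst z else 0)" for z :: "real \<times> (nat \<Rightarrow> real)"
  have "continuous_on C r"
    unfolding r_def
  proof (intro continuous_on_Pair coordinate_continuous continuous_on_coordinatewise_then_product)
    fix i
    have "continuous_on C (\<lambda>x. x i / max 1 (sum_coord k x))"
      "continuous_on C (\<lambda>x. 1 - sum_coord k x / max 1 (sum_coord k x))"
      by (intro continuous_on_divide continuous_on_diff continuous_on_max continuous_on_const
          coordinate_continuous continuous_on_sum_coord; force)+
    then show "continuous_on C (\<lambda>x. if i < k then x i / max 1 (sum_coord k x)
        else if i = k then 1 - sum_coord k x / max 1 (sum_coord k x) else 0)"
      by (cases "i < k"; cases "i = k") simp_all
  qed
  moreover have "r x \<in> prism k" if x: "x \<in> C" for x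
  proof -
    have nn: "0 \<le> x i" if "i < k" for i using x that by (simp add: C_def cuboid_def)
    have s: "0 \<le> sum_coord k x" unfolding sum_coord_def using nn by (intro sum_nonneg) auto
    let ?y = "snd (r x)"
    have pos: "0 \<le> ?y i" for i using nn s by (auto simp: r_def divide_simps max_def)
    have "sum ?y {..k} = (\<Sum>i<k. x i / max 1 (sum_coord k x)) + (1 - sum_coord k x / max 1 (sum_coord k x))"
      by (simp add: r_def lessThan_Suc_atMost[symmetric])
    then have sm: "sum ?y {..k} = 1" by (simp add: sum_coord_def sum_divide_distrib)
    have "?y i \<le> 1" for i
    proof (cases "i \<le> k")
      case True
      then show ?thesis using member_le_sum[of i "{..k}" ?y] pos sm by auto
    qed (simp add: r_def)
    then have "?y \<in> standard_simplex k" using pos sm by (auto simp: standard_simplex_def r_def)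
    moreover have "fst (r x) \<in> {0..1}" using x by (simp add: C_def cuboid_def r_def)
    ultimately show ?thesis by (cases "r x") (simp add: prism_def)
  qed
  ultimately have r: "continuous_map (top_of_set C) (top_of_set (prism k)) r"
    by (auto simp: continuous_map_in_subtopology)
  have "continuous_on (prism k) e"
  proof (rule continuous_on_coordinatewise_then_product)
    fix i
    have "continuous_on (prism k) (\<lambda>z. snd z i)" "continuous_on (prism k) (\<lambda>z :: real \<times> (nat \<Rightarrow> real). fst z)"
      by (rule continuous_on_product_then_coordinatewise, intro continuous_intros) (intro continuous_intros)
    then show "continuous_on (prism k) (\<lambda>z. e z i)"
      unfolding e_def by (cases "i \<le> k"; cases "i = Suc k") simp_all
  qed
  moreover have "e z \<in> C" if "z \<in> prism k" for z
    using that by (auto simp: e_def C_def cuboid_def prism_def standard_simplex_def)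
  ultimately have e: "continuous_map (top_of_set (prism k)) (top_of_set C) e"
    by (auto simp: continuous_map_in_subtopology)
  have re: "r (e z) = z" if z: "z \<in> prism k" for z
  proof -
    have zs: "snd z \<in> standard_simplex k" using z by (auto simp: prism_def)
    have "sum_coord k (e z) = sum_coord k (snd z)" by (simp add: sum_coord_def e_def)
    then have s: "sum_coord k (e z) = 1 - snd z k" using simplex_sum_coord[OF zs] by simp
    have "0 \<le> snd z k" using zs by (simp add: standard_simplex_def)
    then have m: "max 1 (sum_coord k (e z)) = 1" using s by simp
    have "snd (r (e z)) = snd z"
      unfolding r_def m s using zs by (auto simp: e_def fun_eq_iff standard_simplex_def)
    moreover have "fst (r (e z)) = fst z" by (simp add: r_def e_def)
    ultimately show ?thesis by (simp add: prod_eq_iff)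
  qed
  obtain L where L: "lift_on (top_of_set C) (f \<circ> r) L"
    using cuboid_lift[of "k + 2" "\<lambda>_. 0" "\<lambda>_. 1" "f \<circ> r"] continuous_map_compose[OF r f] by (auto simp: C_def)
  have "continuous_map (top_of_set (prism k)) P (L \<circ> e)"
    by (rule continuous_map_compose[OF e]) (use L in \<open>simp add: lift_on_def\<close>)
  moreover have "q (L (e z)) = f z" if "z \<in> prism k" for z
  proof -
    have "e z \<in> C" using e that by (auto simp: continuous_map_in_subtopology)
    then show ?thesis using L re[OF that] by (simp add: lift_on_def)
  qed
  ultimately show ?thesis by (intro exI[of _ "L \<circ> e"]) (simp add: lift_on_def)
qed

text \<open>A lift over the prism is corrected along the retraction of the prism onto the
  horn.\<close>

lemma horn_lift:
  assumes F: "continuous_map (top_of_set (horn k)) P F" and f: "continuous_map (top_of_set (prism k)) Y f"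
    and eq: "\<And>z. z \<in> horn k \<Longrightarrow> q (F z) = f z"
  shows "\<exists>L. continuous_map (top_of_set (prism k)) P L \<and> (\<forall>z\<in>horn k. L z = F z) \<and> (\<forall>z\<in>prism k. q (L z) = f z)"
proof -
  have sub: "subtopology (top_of_set (prism k)) (horn k) = top_of_set (horn k)"
    using horn_subset_prism by (simp add: subtopology_subtopology Int_absorb1)
  obtain L where L: "lift_on (top_of_set (prism k)) f L" using prism_lift[OF f] by blast
  have "lift_on (subtopology (top_of_set (prism k)) (horn k)) f F"
    unfolding sub using F eq by (simp add: lift_on_def)
  from relative_lift[OF L this, of "\<lambda>z. fold_up k (unfold_down k z)"]
  show ?thesis
    unfolding sub using continuous_map_horn_retraction[of k] fold_up_unfold_down[of _ k] horn_subset_prism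
    by (auto simp: lift_on_def Int_absorb1)
qed

end

subsection \<open>Free cyclic actions and weakly contractible base spaces\<close>

text \<open>As \<open>t ^^ m\<close> is the identity, \<open>(t ^^ (m - a)) x \<in> W\<close> says
  that \<open>x\<close> lies in the \<open>a\<close>-th translate of \<open>W\<close>, without
  inverting \<open>t\<close>. By \<open>free\<close> the translates are disjoint, and
  \<open>ix\<close> names the one containing \<open>x\<close>.\<close>

lemma trivial_piece_orbit:
  assumes t: "continuous_map X X t" and per: "\<And>x. x \<in> topspace X \<Longrightarrow> (t ^^ m) x = x" and m: "0 < m"
    and W: "openin X W" and free: "\<And>x i. \<lbrakk>x \<in> W; 0 < i; i < m\<rbrakk> \<Longrightarrow> (t ^^ i) x \<notin> W"
  defines "S \<equiv> {x \<in> topspace X. \<exists>a<m. (t ^^ (m - a)) x \<in> W}"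
    and "ix \<equiv> \<lambda>x. THE a. a < m \<and> (t ^^ (m - a)) x \<in> W"
  shows "trivial_piece X t m S ix" and "W \<subseteq> S"
proof -
  have pt: "(t ^^ i) x \<in> topspace X" if "x \<in> topspace X" for i x
    using continuous_map_funpow[OF t, of i] that by (auto simp: continuous_map_def)
  have uniq': False if "x \<in> topspace X" "a < b" "b < m" "(t ^^ (m - a)) x \<in> W" "(t ^^ (m - b)) x \<in> W" for x a b
  proof -
    have "(t ^^ (b - a)) ((t ^^ (m - b)) x) = (t ^^ ((b - a) + (m - b))) x"
      by (simp only: funpow_add o_apply)
    also have "(b - a) + (m - b) = m - a" using that by simp
    finally have "(t ^^ (b - a)) ((t ^^ (m - b)) x) \<in> W" using that(4) by simp
    moreover have "0 < b - a" "b - a < m" using that by linarith+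
    ultimately show False using free[OF that(5)] by blast
  qed
  have ixI: "ix x = a" if "x \<in> topspace X" "a < m" "(t ^^ (m - a)) x \<in> W" for x a
    unfolding ix_def
  proof (rule the_equality)
    fix b assume "b < m \<and> (t ^^ (m - b)) x \<in> W"
    then show "b = a" using uniq'[of x a b] uniq'[of x b a] that by (cases a b rule: linorder_cases) auto
  qed (use that in simp)
  have opn: "openin X {x \<in> topspace X. (t ^^ i) x \<in> W}" for i
    using continuous_map_funpow[OF t, of i] W by (auto simp: continuous_map_def)
  have Seq: "S = (\<Union>a<m. {x \<in> topspace X. (t ^^ (m - a)) x \<in> W})" by (auto simp: S_def)
  have opS: "openin X S" unfolding Seq using opn by (intro openin_Union) auto
  have ixS: "ix x < m \<and> (t ^^ (m - ix x)) x \<in> W" if "x \<in> S" for x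
    using that ixI unfolding S_def by auto
  have cont: "continuous_map (subtopology X S) (discrete_topology {..<m}) ix"
    unfolding continuous_map_def
  proof (intro conjI allI impI)
    show "ix \<in> topspace (subtopology X S) \<rightarrow> topspace (discrete_topology {..<m})"
      using ixS by auto
    fix U assume "openin (discrete_topology {..<m}) U"
    then have U: "U \<subseteq> {..<m}" by simp
    have "{x \<in> topspace (subtopology X S). ix x \<in> U} = S \<inter> (\<Union>a\<in>U. {x \<in> topspace X. (t ^^ (m - a)) x \<in> W})"
      using ixI ixS U by (auto simp: S_def)
    moreover have "openin X (\<Union>a\<in>U. {x \<in> topspace X. (t ^^ (m - a)) x \<in> W})"
      using opn by (intro openin_Union) auto
    ultimately show "openin (subtopology X S) {x \<in> topspace (subtopology X S). ix x \<in> U}"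
      by (auto simp: openin_subtopology)
  qed
  have step: "t x \<in> S \<and> ix (t x) = Suc (ix x) mod m" if x: "x \<in> S" for x
  proof -
    have xX: "x \<in> topspace X" using x by (simp add: S_def)
    have txX: "t x \<in> topspace X" using pt[OF xX, of 1] by simp
    let ?a = "ix x"
    have a: "?a < m" "(t ^^ (m - ?a)) x \<in> W" using ixS[OF x] by auto
    have "(t ^^ (m - Suc ?a mod m)) (t x) \<in> W"
    proof (cases "Suc ?a = m")
      case True
      then have "m - ?a = 1" by linarith
      then have "t x \<in> W" using a(2) by simp
      then show ?thesis using True per[OF txX] by simp
    next
      case False
      then have "m - ?a = Suc (m - Suc ?a)" "Suc ?a mod m = Suc ?a" using a by auto
      then show ?thesis using a(2) by (simp add: funpow_swap1)
    qed
    moreover have "Suc ?a mod m < m" using m by simp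
    ultimately show ?thesis using ixI[OF txX] txX by (auto simp: S_def)
  qed
  show "trivial_piece X t m S ix" unfolding trivial_piece_def using opS cont step by blast
  show "W \<subseteq> S"
  proof
    fix x assume "x \<in> W"
    then have "x \<in> topspace X" using openin_subset[OF W] by auto
    then show "x \<in> S" using per \<open>x \<in> W\<close> m by (auto simp: S_def intro!: exI[of _ 0])
  qed
qed

context principal_bundle
begin

text \<open>Here \<open>q\<close> is any principal bundle with compact fibre over \<open>y0\<close>,
  and the copy of the contractible space enters only through the equivariant map
  \<open>j\<close>.\<close>

theorem no_free_cyclic_action:
  assumes y0: "y0 \<in> topspace Y"
    and triv: "\<And>i f. \<lbrakk>1 \<le> i; f \<in> spheroids i Y y0\<rbrakk> \<Longrightarrow> (f, \<lambda>_. y0) \<in> spheroid_homotopy i Y y0"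
    and compact: "compactin P {p \<in> topspace P. q p = y0}"
    and t: "continuous_map P P t" and qt: "\<And>p. p \<in> topspace P \<Longrightarrow> q (t p) = q p"
    and per: "\<And>p. p \<in> topspace P \<Longrightarrow> (t ^^ m) p = p" and m: "2 \<le> m"
    and free: "\<And>p. p \<in> topspace P \<Longrightarrow> \<exists>W. openin P W \<and> p \<in> W \<and> (\<forall>x\<in>W. \<forall>i. 0 < i \<and> i < m \<longrightarrow> (t ^^ i) x \<notin> W)"
    and E: "contractible_space E" "e0 \<in> topspace E" "continuous_map E E s" "\<And>e. e \<in> topspace E \<Longrightarrow> (s ^^ m) e = e"
    and j: "continuous_map E P j" "\<And>e. e \<in> topspace E \<Longrightarrow> j (s e) = t (j e)" "q (j e0) = y0"
  shows False
proof -
  \<comment> \<open>The vanishing groups do not make the base path connected, so everything is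
    restricted to the path component of \<open>y0\<close>. The image of \<open>E\<close> lies over
    it because \<open>E\<close> is path connected and \<open>e0\<close> goes to
    \<open>y0\<close>.\<close>
  define K where "K = Collect (path_component_of Y y0)"
  define Y' where "Y' = subtopology Y K"
  define P' where "P' = subtopology P {p. q p \<in> K}"
  define B where "B = {p \<in> topspace P. q p = y0}"
  have y0K: "y0 \<in> K" using y0 by (simp add: K_def path_component_of_refl)
  have q': "continuous_map P' Y' q"
    using q by (auto simp: P'_def Y'_def continuous_map_in_subtopology continuous_map_from_subtopology)
  have inK: "f ` topspace Z \<subseteq> K"
    if f: "continuous_map Z Y f" and Z: "path_connected_space Z" and y: "y0 \<in> f ` topspace Z"
    for Z :: "'z topology" and f
  proof -
    have "path_connectedin Y (f ` topspace Z)"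
      using path_connectedin_continuous_map_image[OF f] Z by (simp add: path_connectedin_topspace)
    then show ?thesis unfolding K_def using y path_component_of_maximal by metis
  qed
  have lift: "\<exists>L. continuous_map (top_of_set (prism k)) P' L \<and> (\<forall>z\<in>horn k. L z = F z) \<and> (\<forall>z\<in>prism k. q (L z) = g z)"
    if F: "continuous_map (top_of_set (horn k)) P' F" and g: "continuous_map (top_of_set (prism k)) Y' g"
      and eq: "\<And>z. z \<in> horn k \<Longrightarrow> q (F z) = g z" for k F g
  proof -
    have gK: "g z \<in> K" if "z \<in> prism k" for z
      using g that by (auto simp: Y'_def continuous_map_in_subtopology)
    obtain L where L: "continuous_map (top_of_set (prism k)) P L" "\<forall>z\<in>horn k. L z = F z" "\<forall>z\<in>prism k. q (L z) = g z"
      using horn_lift[of k F g] F g eq unfolding P'_def Y'_def by (auto simp: continuous_map_in_subtopology)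
    then have "continuous_map (top_of_set (prism k)) P' L"
      using gK by (auto simp: P'_def continuous_map_in_subtopology)
    then show ?thesis using L by blast
  qed
  have null: "\<exists>H. continuous_map (top_of_set (prism k)) Y' H \<and>
          (\<forall>x\<in>standard_simplex k. H (0, x) = f x \<and> H (1, x) = y0) \<and>
          (\<forall>t\<in>{0..1}. \<forall>x\<in>simplex_boundary k. H (t, x) = y0)"
    if f: "continuous_map (top_of_set (standard_simplex k)) Y' f" and fb: "\<And>x. x \<in> simplex_boundary k \<Longrightarrow> f x = y0" for k f
  proof -
    have f': "continuous_map (top_of_set (standard_simplex k)) Y f" and fK: "\<And>x. x \<in> standard_simplex k \<Longrightarrow> f x \<in> K"
      using f by (auto simp: Y'_def continuous_map_in_subtopology)
    have "path_component_of Y (f x) y0" if "x \<in> standard_simplex k" for x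
      using fK[OF that] by (simp add: K_def path_component_of_sym)
    then obtain H where H: "continuous_map (top_of_set (prism k)) Y H"
          "\<forall>x\<in>standard_simplex k. H (0, x) = f x \<and> H (1, x) = y0"
          "\<forall>t\<in>{0..1}. \<forall>x\<in>simplex_boundary k. H (t, x) = y0"
      using simplex_null_homotopy[OF triv f' fb] by blast
    have "(1, simplex_vertex) \<in> prism k" using simplex_vertex_in by (simp add: prism_def)
    then have "y0 \<in> H ` topspace (top_of_set (prism k))"
      using H(2) simplex_vertex_in[of k] by (intro image_eqI[of _ _ "(1, simplex_vertex)"]) auto
    then have "H ` topspace (top_of_set (prism k)) \<subseteq> K"
      by (rule inK[OF H(1) contractible_imp_path_connected_space[OF contractible_prism]])
    then have "continuous_map (top_of_set (prism k)) Y' H"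
      using H(1) by (auto simp: Y'_def continuous_map_in_subtopology)
    then show ?thesis using H by blast
  qed
  have ext: "\<exists>L. continuous_map (top_of_set (prism k)) P' L \<and> (\<forall>z\<in>horn k. L z = F z) \<and> (\<forall>x\<in>standard_simplex k. L (1, x) \<in> B)"
    if F: "continuous_map (top_of_set (horn k)) P' F" and F1: "\<And>x. x \<in> simplex_boundary k \<Longrightarrow> F (1, x) \<in> B" for k F
  proof -
    have "q (F (1, x)) = y0" if "x \<in> simplex_boundary k" for x using F1[OF that] by (simp add: B_def)
    then obtain L where L: "continuous_map (top_of_set (prism k)) P' L" "\<forall>z\<in>horn k. L z = F z"
        "\<forall>x\<in>standard_simplex k. q (L (1, x)) = y0"
      using prism_extension[OF q' lift null F] by blast
    have "L (1, x) \<in> B" if "x \<in> standard_simplex k" for x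
    proof -
      have "L (1, x) \<in> topspace P'"
        using L(1) top_in_prism[OF that, of 1] by (auto simp: continuous_map_def)
      then show ?thesis using L(3) that by (simp add: B_def P'_def)
    qed
    then show ?thesis using L by blast
  qed
  have "continuous_map E Y (q \<circ> j)" by (rule continuous_map_compose[OF j(1) q])
  then have "(q \<circ> j) ` topspace E \<subseteq> K"
    using inK[of E "q \<circ> j"] contractible_imp_path_connected_space[OF E(1)] E(2) j(3) by force
  then have j': "continuous_map E P' j" using j(1) by (auto simp: P'_def continuous_map_in_subtopology)
  have t': "continuous_map P' P' t"
    using t qt by (auto simp: P'_def continuous_map_in_subtopology continuous_map_from_subtopology)
  have tB: "\<And>x. x \<in> B \<Longrightarrow> t x \<in> B" using t qt by (auto simp: B_def continuous_map_def)
  obtain c where c: "\<And>K. tower E s m K c" "aug (c 0) = frag_of (restrict (\<lambda>_. ()) (standard_simplex 0))"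
    using contractible_tower[OF E] by blast
  have "\<And>K. tower P' t m K (\<lambda>n. chain_map n j (c n))"
    by (rule tower_chain_map[OF c(1) j' E(3) j(2)])
  then obtain e where e: "\<And>K. tower (subtopology P' B) t m K e" "aug (e 0) = aug (chain_map 0 j (c 0))"
    using tower_into_subspace[of P' t m "\<lambda>n. chain_map n j (c n)" B] t' tB per relative_boundary_exists[OF ext]
    by (auto simp: P'_def)
  define X where "X = subtopology P' B"
  have XP: "X = subtopology P B"
    using y0K by (auto simp: X_def P'_def subtopology_subtopology B_def intro!: arg_cong[where f = "subtopology P"])
  have topX: "topspace X = B" by (auto simp: XP B_def)
  have tX: "continuous_map X X t"
    using t tB by (auto simp: XP continuous_map_in_subtopology continuous_map_from_subtopology)
  have perX: "\<And>x. x \<in> topspace X \<Longrightarrow> (t ^^ m) x = x" using per topX by (auto simp: B_def)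
  obtain W where W: "\<And>p. p \<in> B \<Longrightarrow> openin P (W p) \<and> p \<in> W p \<and> (\<forall>x\<in>W p. \<forall>i. 0 < i \<and> i < m \<longrightarrow> (t ^^ i) x \<notin> W p)"
    using free unfolding B_def mem_Collect_eq by metis
  obtain C where C: "finite C" "C \<subseteq> B" "B \<subseteq> (\<Union>p\<in>C. W p)"
  proof -
    have "\<exists>F. finite F \<and> F \<subseteq> W ` B \<and> B \<subseteq> \<Union>F"
      using compact W unfolding compactin_def B_def[symmetric] by (metis (no_types, lifting) UN_I imageE subsetI)
    then obtain F where "finite F" "F \<subseteq> W ` B" "B \<subseteq> \<Union>F" by blast
    then obtain C where "finite C" "C \<subseteq> B" "F = W ` C" using finite_subset_image by metis
    then show thesis using that \<open>B \<subseteq> \<Union>F\<close> by blast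
  qed
  \<comment> \<open>The number \<open>M\<close> of pieces is fixed only here, by compactness of the
    fibre; the tower in the fibre has all lengths, in particular length \<open>M\<close>.\<close>
  obtain M and g :: "nat \<Rightarrow> _" where g: "C = g ` {i. i < M}"
    using finite_imp_nat_seg_image_inj_on[OF C(1)] by blast
  define V where "V i = W (g i) \<inter> B" for i
  define S where "S i = {x \<in> topspace X. \<exists>a<m. (t ^^ (m - a)) x \<in> V i}" for i
  define ix where "ix i = (\<lambda>x. THE a. a < m \<and> (t ^^ (m - a)) x \<in> V i)" for i
  have pieces: "trivial_piece X t m (S i) (ix i)" "V i \<subseteq> S i" if "i < M" for i
  proof -
    have gi: "g i \<in> B" using C(2) g that by auto
    have "openin X (V i)" using W[OF gi] unfolding XP V_def openin_subtopology by blast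
    moreover have "(t ^^ a) x \<notin> V i" if "x \<in> V i" "0 < a" "a < m" for x a
      using W[OF gi] that by (auto simp: V_def)
    ultimately show "trivial_piece X t m (S i) (ix i)" "V i \<subseteq> S i"
      using trivial_piece_orbit[OF tX perX, of "V i"] m unfolding S_def ix_def by auto
  qed
  have "topspace X = (\<Union>i<M. S i)"
  proof
    show "(\<Union>i<M. S i) \<subseteq> topspace X" by (auto simp: S_def)
    show "topspace X \<subseteq> (\<Union>i<M. S i)"
    proof
      fix x assume x: "x \<in> topspace X"
      then obtain i where "i < M" "x \<in> W (g i)" using C(3) topX g by auto
      then show "x \<in> (\<Union>i<M. S i)" using pieces(2)[of i] x topX by (auto simp: V_def)
    qed
  qed
  then obtain d where "aug (e 0) = frag_cmul (int m) d"
    using tower_cover[where m = m and M = M and X = X and t = t and S = S and ix = ix and c = e] pieces(1) tX perX e(1)[of M, folded X_def] m by auto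
  then have "frag_of (restrict (\<lambda>_. ()) (standard_simplex 0)) = frag_cmul (int m) d"
    using e(2) c(2) by simp
  then show False by (rule notE[OF aug_point_not_multiple[OF m]])
qed

end

subsection \<open>Smooth maps\<close>

lemma Ck_on_SucI:
  assumes "open S" "\<And>x. x \<in> S \<Longrightarrow> (f has_derivative f' x) (at x)" "\<And>v. Ck_on k S (\<lambda>x. f' x v)"
  shows "Ck_on (Suc k) S f"
proof -
  have fr: "frechet_derivative f (at x) = f' x" if "x \<in> S" for x
    using frechet_derivative_at[OF assms(2)[OF that]] by simp
  have "Ck_on k S (\<lambda>x. frechet_derivative f (at x) v)" for v
    by (rule Ck_on_cong[OF assms(1) _ assms(3)[of v]]) (simp add: fr)
  then show ?thesis using assms(2) by (auto simp: differentiable_def)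
qed

lemma Ck_on_SucD:
  assumes "Ck_on (Suc k) S f"
  shows "x \<in> S \<Longrightarrow> (f has_derivative frechet_derivative f (at x)) (at x)"
    and "Ck_on k S (\<lambda>x. frechet_derivative f (at x) v)"
  using assms by (auto simp flip: frechet_derivative_works)

lemma Ck_on_subset: "Ck_on k S f \<Longrightarrow> T \<subseteq> S \<Longrightarrow> Ck_on k T f"
  by (induction k arbitrary: f) (auto intro: continuous_on_subset)

lemma Ck_on_Suc_imp: "Ck_on (Suc k) S f \<Longrightarrow> Ck_on k S f"
proof (induction k arbitrary: f)
  case 0
  then show ?case
    by (auto intro!: continuous_at_imp_continuous_on differentiable_imp_continuous_within)
next
  case (Suc k)
  have "\<forall>x\<in>S. f differentiable at x" using Suc.prems by simp
  moreover have "Ck_on k S (\<lambda>x. frechet_derivative f (at x) v)" for v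
    using Suc.prems by (intro Suc.IH) simp
  ultimately show ?case by simp
qed

lemma Ck_on_const: "open S \<Longrightarrow> Ck_on k S (\<lambda>_. c)"
proof (induction k arbitrary: c)
  case (Suc k)
  show ?case by (rule Ck_on_SucI[of _ _ "\<lambda>_ _. 0"]) (use Suc in auto)
qed simp

lemma Ck_on_add:
  assumes "open S" "Ck_on k S f" "Ck_on k S g"
  shows "Ck_on k S (\<lambda>x. f x + g x)"
  using assms(2,3)
proof (induction k arbitrary: f g)
  case (Suc k)
  show ?case
    by (rule Ck_on_SucI[OF assms(1) has_derivative_add])
      (use Ck_on_SucD[OF Suc.prems(1)] Ck_on_SucD[OF Suc.prems(2)] Suc.IH in auto)
qed (auto intro: continuous_on_add)

lemma Ck_on_sum:
  assumes "open S" "finite I" "\<And>i. i \<in> I \<Longrightarrow> Ck_on k S (f i)"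
  shows "Ck_on k S (\<lambda>x. \<Sum>i\<in>I. f i x)"
  using assms(2,3) by (induction I rule: finite_induct) (auto intro: Ck_on_const Ck_on_add assms(1))

lemma Ck_on_scaleR:
  assumes "open S" "Ck_on k S u" "Ck_on k S f"
  shows "Ck_on k S (\<lambda>x. u x *\<^sub>R f x)"
  using assms(2,3)
proof (induction k arbitrary: u f)
  case (Suc k)
  note u = Ck_on_SucD[OF Suc.prems(1)] and f = Ck_on_SucD[OF Suc.prems(2)]
  show ?case
    by (rule Ck_on_SucI[OF assms(1) has_derivative_scaleR])
      (use u f in \<open>auto intro!: Ck_on_add assms(1) Suc.IH Ck_on_Suc_imp[OF Suc.prems(1)] Ck_on_Suc_imp[OF Suc.prems(2)]\<close>)
qed (auto intro: continuous_on_scaleR)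

lemma Ck_on_inner_const:
  assumes "open S" "Ck_on k S f"
  shows "Ck_on k S (\<lambda>x. f x \<bullet> b)"
  using assms(2)
proof (induction k arbitrary: f)
  case (Suc k)
  show ?case
    by (rule Ck_on_SucI[OF assms(1) has_derivative_inner_left]) (use Ck_on_SucD[OF Suc.prems] Suc.IH in auto)
qed (auto intro: continuous_on_inner continuous_on_const)

lemma Ck_on_compose:
  fixes g :: "'a::real_normed_vector \<Rightarrow> 'b::euclidean_space"
  assumes S: "open S" and g: "Ck_on k S g" and f: "Ck_on k T f" and gT: "g ` S \<subseteq> T"
  shows "Ck_on k S (\<lambda>x. f (g x))"
  using g f
proof (induction k arbitrary: f)
  case 0
  then show ?case using continuous_on_compose2[of T f S g] gT by simp
next
  case (Suc k)
  note g = Ck_on_SucD[OF Suc.prems(1)] and f = Ck_on_SucD[OF Suc.prems(2)]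
  let ?g' = "\<lambda>x. frechet_derivative g (at x)" and ?f' = "\<lambda>y. frechet_derivative f (at y)"
  \<comment> \<open>The vector \<open>?g' x v\<close> moves with \<open>x\<close>, while
    \<open>Ck_on\<close> differentiates in fixed directions. Expanding it in the basis gives fixed
    directions with differentiable coefficients.\<close>
  have der: "((\<lambda>x. f (g x)) has_derivative (\<lambda>v. \<Sum>i\<in>Basis. (?g' x v \<bullet> i) *\<^sub>R ?f' (g x) i)) (at x)" if x: "x \<in> S" for x
  proof -
    have gx: "g x \<in> T" using gT x by auto
    have fg: "((\<lambda>x. f (g x)) has_derivative (\<lambda>v. ?f' (g x) (?g' x v))) (at x)"
      using has_derivative_compose[OF g(1)[OF x] f(1)[OF gx]] .
    have rep: "?f' (g x) w = (\<Sum>i\<in>Basis. (w \<bullet> i) *\<^sub>R ?f' (g x) i)" for w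
    proof -
      have lin: "linear (?f' (g x))" using f(1)[OF gx] has_derivative_linear by blast
      have "?f' (g x) w = ?f' (g x) (\<Sum>i\<in>Basis. (w \<bullet> i) *\<^sub>R i)" by (simp add: euclidean_representation)
      also have "\<dots> = (\<Sum>i\<in>Basis. (w \<bullet> i) *\<^sub>R ?f' (g x) i)"
        using lin by (simp add: linear_sum linear_cmul)
      finally show ?thesis .
    qed
    have "(\<lambda>v. ?f' (g x) (?g' x v)) = (\<lambda>v. \<Sum>i\<in>Basis. (?g' x v \<bullet> i) *\<^sub>R ?f' (g x) i)"
      by (rule ext) (rule rep)
    then show ?thesis using fg by (simp only:)
  qed
  show ?case
  proof (rule Ck_on_SucI[OF S der])
    fix v
    show "Ck_on k S (\<lambda>x. \<Sum>i\<in>Basis. (?g' x v \<bullet> i) *\<^sub>R ?f' (g x) i)"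
      using g(2) f(2) Ck_on_Suc_imp[OF Suc.prems(1)]
      by (intro Ck_on_sum Ck_on_scaleR Ck_on_inner_const Suc.IH S) auto
  qed
qed

lemma smooth_on_subset: "smooth_on S f \<Longrightarrow> T \<subseteq> S \<Longrightarrow> smooth_on T f"
  by (auto simp: smooth_on_def intro: Ck_on_subset)

lemma smooth_on_compose:
  fixes g :: "'a::real_normed_vector \<Rightarrow> 'b::euclidean_space"
  assumes "open S" "smooth_on S g" "smooth_on T f" "g ` S \<subseteq> T"
  shows "smooth_on S (\<lambda>x. f (g x))"
  unfolding smooth_on_def
proof
  fix k show "Ck_on k S (\<lambda>x. f (g x))"
    by (rule Ck_on_compose[OF assms(1) _ _ assms(4)]) (use assms(2,3) in \<open>simp_all add: smooth_on_def\<close>)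
qed

lemma smooth_on_cong:
  assumes "open S" "\<And>x. x \<in> S \<Longrightarrow> f x = f' x" "smooth_on S f"
  shows "smooth_on S f'"
  using Ck_on_cong[OF assms(1,2)] assms(3) unfolding smooth_on_def by simp

lemma smooth_on_continuous: "smooth_on S f \<Longrightarrow> continuous_on S f"
  unfolding smooth_on_def by (metis Ck_on.simps(1))

lemma smooth_on_has_derivative:
  fixes f :: "real^'n \<Rightarrow> real^'m"
  assumes "smooth_on S f" "x \<in> S"
  shows "(f has_derivative (*v) (jacobian f (at x))) (at x)"
proof -
  have "Ck_on (Suc 0) S f" using assms(1) unfolding smooth_on_def by blast
  then have "f differentiable at x" using assms(2) by simp
  then show ?thesis by (simp add: jacobian_works[symmetric])
qed

lemma jacobian_eq:
  fixes f :: "real^'n \<Rightarrow> real^'m"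
  assumes "(f has_derivative (*v) A) (at x)"
  shows "jacobian f (at x) = A"
  unfolding jacobian_def using frechet_derivative_at[OF assms] by (metis matrix_of_matrix_vector_mul)

lemma jacobian_compose:
  fixes f :: "real^'m \<Rightarrow> real^'l" and h :: "real^'n \<Rightarrow> real^'m"
  assumes "smooth_on S h" "x \<in> S" "smooth_on T f" "h x \<in> T"
  shows "jacobian (\<lambda>x. f (h x)) (at x) = jacobian f (at (h x)) ** jacobian h (at x)"
proof (rule jacobian_eq)
  have "((\<lambda>x. f (h x)) has_derivative (\<lambda>v. jacobian f (at (h x)) *v (jacobian h (at x) *v v))) (at x)"
    by (rule has_derivative_compose[OF smooth_on_has_derivative[OF assms(1,2)] smooth_on_has_derivative[OF assms(3,4)]])
  then show "((\<lambda>x. f (h x)) has_derivative (*v) (jacobian f (at (h x)) ** jacobian h (at x))) (at x)"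
    by (simp add: matrix_vector_mul_assoc)
qed

lemma jacobian_cong:
  fixes f :: "real^'n \<Rightarrow> real^'m"
  assumes "open S" "x \<in> S" "\<And>y. y \<in> S \<Longrightarrow> f y = f' y" "smooth_on S f"
  shows "jacobian f (at x) = jacobian f' (at x)"
proof -
  have "(f' has_derivative (*v) (jacobian f (at x))) (at x)"
    by (rule has_derivative_transform_within_open[OF smooth_on_has_derivative[OF assms(4,2)] assms(1,2,3)])
  then show ?thesis by (rule jacobian_eq[symmetric])
qed

lemma jacobian_identity:
  fixes f :: "real^'n \<Rightarrow> real^'n"
  assumes "open S" "x \<in> S" "\<And>y. y \<in> S \<Longrightarrow> f y = y"
  shows "jacobian f (at x) = mat 1"
proof (rule jacobian_eq)
  have "(*v) (mat 1 :: real^'n^'n) = (\<lambda>v. v)" by (rule ext) (rule matrix_vector_mul_lid)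
  then have "((\<lambda>y. y) has_derivative (*v) (mat 1 :: real^'n^'n)) (at x)" by simp
  then show "(f has_derivative (*v) (mat 1)) (at x)"
    by (rule has_derivative_transform_within_open[OF _ assms(1,2)]) (simp add: assms(3))
qed

lemma continuous_on_matrix:
  fixes F :: "'a::topological_space \<Rightarrow> real^'n^'m"
  assumes "\<And>i j. continuous_on S (\<lambda>x. F x $ i $ j)"
  shows "continuous_on S F"
proof -
  have "continuous_on S (\<lambda>x. \<chi> i. \<chi> j. F x $ i $ j)"
    by (intro continuous_on_vec_lambda assms)
  then show ?thesis by simp
qed

lemma smooth_on_continuous_jacobian:
  fixes f :: "real^'n \<Rightarrow> real^'m"
  assumes "smooth_on S f"
  shows "continuous_on S (\<lambda>x. jacobian f (at x))"
proof (rule continuous_on_matrix)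
  fix i j
  have "Ck_on (Suc 0) S f" using assms unfolding smooth_on_def by blast
  then have "continuous_on S (\<lambda>x. frechet_derivative f (at x) (axis j 1))" by simp
  then have "continuous_on S (\<lambda>x. frechet_derivative f (at x) (axis j 1) $ i)"
    by (intro continuous_on_component)
  then show "continuous_on S (\<lambda>x. jacobian f (at x) $ i $ j)"
    by (simp add: jacobian_def matrix_def)
qed

lemma continuous_on_matrix_mult [continuous_intros]:
  fixes F :: "'a::topological_space \<Rightarrow> real^'n^'m" and G :: "'a \<Rightarrow> real^'l^'n"
  assumes "continuous_on S F" "continuous_on S G"
  shows "continuous_on S (\<lambda>x. F x ** G x)"
  unfolding matrix_matrix_mult_def
  by (intro continuous_on_vec_lambda continuous_on_sum continuous_on_mult continuous_on_component assms)

lemma continuous_on_transpose [continuous_intros]: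
  fixes F :: "'a::topological_space \<Rightarrow> real^'n^'m"
  assumes "continuous_on S F"
  shows "continuous_on S (\<lambda>x. transpose (F x))"
  unfolding transpose_def by (intro continuous_on_vec_lambda continuous_on_component assms)

lemma continuous_on_matrix_vector_mult [continuous_intros]:
  fixes F :: "'a::topological_space \<Rightarrow> real^'n^'m"
  assumes "continuous_on S F" "continuous_on S v"
  shows "continuous_on S (\<lambda>x. F x *v v x)"
  unfolding matrix_vector_mult_def
  by (intro continuous_on_vec_lambda continuous_on_sum continuous_on_mult continuous_on_component assms)

subsection \<open>Changes of charts\<close>

lemma diffeomorphismD:
  assumes "diffeomorphism V W h"
  shows "smooth_on V h" "h ` V = W" "inj_on h V" "smooth_on W (inv_into V h)"
    "x \<in> V \<Longrightarrow> h x \<in> W" "x \<in> V \<Longrightarrow> inv_into V h (h x) = x"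
    "y \<in> W \<Longrightarrow> inv_into V h y \<in> V" "y \<in> W \<Longrightarrow> h (inv_into V h y) = y"
  using assms by (auto simp: diffeomorphism_def bij_betw_def inv_into_f_f f_inv_into_f inv_into_into)

lemma diffeomorphismI:
  assumes "open W" "smooth_on V h" "smooth_on W k" "\<And>x. x \<in> V \<Longrightarrow> h x \<in> W \<and> k (h x) = x" "\<And>y. y \<in> W \<Longrightarrow> k y \<in> V \<and> h (k y) = y"
  shows "diffeomorphism V W h"
proof -
  have bij: "bij_betw h V W" by (rule bij_betwI[of _ _ _ k]) (use assms in auto)
  then have "inv_into V h y = k y" if "y \<in> W" for y
    using that assms(5)[OF that] by (metis bij_betw_inv_into_left)
  then have "smooth_on W (inv_into V h)" using smooth_on_cong[OF assms(1) _ assms(3)] by metis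
  then show ?thesis using bij assms(2) by (simp add: diffeomorphism_def)
qed

lemma chart_changeD:
  assumes "chart_change c d V W h"
  shows "open V" "open W" "V \<subseteq> chart_dom c" "W \<subseteq> chart_dom d" "diffeomorphism V W h"
    "x \<in> V \<Longrightarrow> chart_map d (h x) = chart_map c x"
  using assms by (auto simp: chart_change_def)

lemma chart_change_inverse:
  assumes "chart_change c d V W h"
  shows "chart_change d c W V (inv_into V h)"
proof -
  note ch = chart_changeD[OF assms] and di = diffeomorphismD[OF chart_changeD(5)[OF assms]]
  have "diffeomorphism W V (inv_into V h)"
    by (rule diffeomorphismI[of _ _ _ h]) (use ch di in auto)
  moreover have "chart_map c (inv_into V h y) = chart_map d y" if "y \<in> W" for y
    using ch(6)[of "inv_into V h y"] di(7,8)[OF that] by simp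
  ultimately show ?thesis using ch by (simp add: chart_change_def)
qed

lemma chart_change_compose:
  assumes h: "chart_change c d V W h" and h': "chart_change d e V' W' h'"
  shows "\<exists>V'' W''. chart_change c e V'' W'' (\<lambda>x. h' (h x)) \<and> V'' = {x \<in> V. h x \<in> V'}"
proof -
  note ch = chart_changeD[OF h] and di = diffeomorphismD[OF chart_changeD(5)[OF h]]
  note ch' = chart_changeD[OF h'] and di' = diffeomorphismD[OF chart_changeD(5)[OF h']]
  define V'' where "V'' = {x \<in> V. h x \<in> V'}"
  define W'' where "W'' = {z \<in> W'. inv_into V' h' z \<in> W}"
  have op: "open {x \<in> A. f x \<in> B}" if "open A" "open B" "continuous_on A f" for A B and f :: "real^'n \<Rightarrow> real^'n"
    using continuous_open_preimage[OF that(3,1,2)] by (simp add: vimage_def Int_def conj_commute)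
  have oV: "open V''" unfolding V''_def by (intro op ch ch' smooth_on_continuous di)
  have oW: "open W''" unfolding W''_def by (intro op ch ch' smooth_on_continuous di')
  have "diffeomorphism V'' W'' (\<lambda>x. h' (h x))"
  proof (rule diffeomorphismI[of _ _ _ "\<lambda>z. inv_into V h (inv_into V' h' z)"])
    show "smooth_on V'' (\<lambda>x. h' (h x))"
      by (rule smooth_on_compose[OF oV smooth_on_subset[OF di(1)] di'(1)]) (auto simp: V''_def)
    show "smooth_on W'' (\<lambda>z. inv_into V h (inv_into V' h' z))"
      by (rule smooth_on_compose[OF oW smooth_on_subset[OF di'(4)] di(4)]) (auto simp: W''_def)
  qed (use oW di di' in \<open>auto simp: V''_def W''_def\<close>)
  then have "chart_change c e V'' W'' (\<lambda>x. h' (h x))"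
    using ch ch' oV oW by (auto simp: chart_change_def V''_def W''_def)
  then show ?thesis unfolding V''_def by blast
qed

subsection \<open>Isotropy\<close>

lemma smooth_on_id: "open S \<Longrightarrow> smooth_on S (\<lambda>x. x)"
proof -
  assume S: "open S"
  have "Ck_on k S (\<lambda>x. x)" for k
  proof (cases k)
    case (Suc j)
    show ?thesis unfolding Suc
      by (rule Ck_on_SucI[OF S has_derivative_ident]) (rule Ck_on_const[OF S])
  qed simp
  then show ?thesis by (simp add: smooth_on_def)
qed

lemma smooth_on_funpow:
  fixes f :: "real^'n \<Rightarrow> real^'n"
  assumes "open D" "smooth_on D f" "f ` D \<subseteq> D"
  shows "smooth_on D (f ^^ i) \<and> (f ^^ i) ` D \<subseteq> D"
proof (induction i)
  case 0
  then show ?case using smooth_on_id[OF assms(1)] by (simp add: id_def)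
next
  case (Suc i)
  then show ?case
    using smooth_on_compose[OF assms(1) _ assms(2), of "f ^^ i"] assms(3) by (auto simp: o_def)
qed

lemma onorm_matrix_continuous:
  fixes J :: "'a::metric_space \<Rightarrow> real^'n^'m"
  assumes "continuous_on D J" "open D" "x \<in> D" "0 < e"
  shows "\<exists>d>0. \<forall>z. dist x z < d \<longrightarrow> onorm (\<lambda>v. J z *v v - J x *v v) < e"
proof -
  define K where "K = real CARD('m) * real CARD('n)"
  have K: "0 < K" by (simp add: K_def)
  have "isCont J x" using assms(1-3) by (simp add: continuous_on_eq_continuous_at)
  then obtain d where d: "0 < d" "\<And>z. dist z x < d \<Longrightarrow> dist (J z) (J x) < e / (2 * K)"
    unfolding continuous_at_eps_delta using K assms(4) by (metis divide_pos_pos mult_pos_pos zero_less_numeral)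
  have "onorm (\<lambda>v. J z *v v - J x *v v) < e" if "dist x z < d" for z
  proof -
    have nrm: "norm (J z - J x) < e / (2 * K)" using d(2)[of z] that by (simp add: dist_norm dist_commute)
    have "\<bar>(J z - J x) $ i $ j\<bar> \<le> e / (2 * K)" for i j
    proof -
      have "\<bar>(J z - J x) $ i $ j\<bar> \<le> norm ((J z - J x) $ i)" by (rule component_le_norm_cart)
      also have "\<dots> \<le> norm (J z - J x)" by (rule Finite_Cartesian_Product.norm_nth_le)
      finally show ?thesis using nrm by simp
    qed
    then have "onorm ((*v) (J z - J x)) \<le> real CARD('m) * real CARD('n) * (e / (2 * K))"
      by (rule onorm_le_matrix_component)
    also have "\<dots> = e / 2" using K unfolding K_def[symmetric] by simp
    also have "\<dots> < e" using assms(4) by simp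
    also have "(*v) (J z - J x) = (\<lambda>v. J z *v v - J x *v v)"
      by (rule ext) (rule matrix_vector_mult_diff_rdistrib)
    finally show ?thesis .
  qed
  then show ?thesis using d(1) by blast
qed

text \<open>Averaging over the powers of \<open>f\<close> gives a map \<open>\<phi>\<close> with \<open>\<phi> \<circ> f = \<phi>\<close> which is injective near a
  fixed point where the derivative of \<open>f\<close> is the identity.\<close>

lemma finite_order_locally_identity:
  fixes f :: "real^'n \<Rightarrow> real^'n"
  assumes D: "open D" and f: "smooth_on D f" "f ` D \<subseteq> D" and n: "0 < n" "\<And>z. z \<in> D \<Longrightarrow> (f ^^ n) z = z"
    and x: "x \<in> D" "f x = x" "jacobian f (at x) = mat 1"
  shows "\<exists>U. open U \<and> x \<in> U \<and> U \<subseteq> D \<and> (\<forall>z\<in>U. f z = z)"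
proof -
  note fi = smooth_on_funpow[OF D f]
  have xi: "(f ^^ i) x = x" for i by (induction i) (auto simp: x)
  have ji: "jacobian (f ^^ i) (at x) = mat 1" for i
  proof (induction i)
    case 0
    show ?case by (rule jacobian_identity[OF D x(1)]) simp
  next
    case (Suc i)
    have "jacobian (f ^^ Suc i) (at x) = jacobian (\<lambda>z. f ((f ^^ i) z)) (at x)" by (simp add: o_def)
    also have "\<dots> = jacobian f (at ((f ^^ i) x)) ** jacobian (f ^^ i) (at x)"
      by (rule jacobian_compose[where S = D and T = D]) (use fi[of i] f x xi in auto)
    finally show ?case by (simp only: Suc xi x matrix_mul_lid)
  qed
  define \<phi> where "\<phi> z = (\<Sum>i<n. (f ^^ i) z)" for z
  define J where "J z = (\<Sum>i<n. jacobian (f ^^ i) (at z))" for z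
  have sum_mult: "(\<Sum>i\<in>I. A i) *v v = (\<Sum>i\<in>I. A i *v v)" if "finite I" for I and A :: "nat \<Rightarrow> real^'n^'n" and v
    using that by (induction I rule: finite_induct) (auto simp: matrix_vector_mult_add_rdistrib)
  have der: "(\<phi> has_derivative (*v) (J z)) (at z)" if z: "z \<in> D" for z
  proof -
    have "((\<lambda>z. \<Sum>i<n. (f ^^ i) z) has_derivative (\<lambda>v. \<Sum>i<n. jacobian (f ^^ i) (at z) *v v)) (at z)"
      by (rule has_derivative_sum) (rule smooth_on_has_derivative[OF conjunct1[OF fi] z])
    moreover have "(\<lambda>v. \<Sum>i<n. jacobian (f ^^ i) (at z) *v v) = (*v) (J z)"
      unfolding J_def by (rule ext) (simp add: sum_mult)
    ultimately show ?thesis unfolding \<phi>_def by simp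
  qed
  have Jc: "continuous_on D J"
    unfolding J_def by (intro continuous_on_sum smooth_on_continuous_jacobian) (use fi in blast)
  \<comment> \<open>At \<open>x\<close> every power of \<open>f\<close> has derivative the identity,
    so the derivative of \<open>\<phi>\<close> is \<open>n\<close> times the identity, and
    \<open>\<phi>\<close> is injective near \<open>x\<close>.\<close>
  have "J x *v v = real n *\<^sub>R v" for v
    unfolding J_def sum_mult[OF finite_lessThan] ji by (simp only: matrix_vector_mul_lid sum_constant_scaleR card_lessThan)
  then have inv: "(\<lambda>v. (1 / real n) *\<^sub>R v) \<circ> (*v) (J x) = id"
    using n by (auto simp: fun_eq_iff)
  obtain r where r: "0 < r" "ball x r \<subseteq> D" "inj_on \<phi> (ball x r)"
    using has_derivative_locally_injective[OF x(1) D bounded_linear_scaleR_right inv der onorm_matrix_continuous[OF Jc D x(1)]]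
    by blast
  have cf: "continuous_on D f" by (rule smooth_on_continuous[OF f(1)])
  \<comment> \<open>Both \<open>z\<close> and \<open>f z\<close> must lie in the ball on which
    \<open>\<phi>\<close> is injective.\<close>
  define U where "U = ball x r \<inter> (D \<inter> f -` ball x r)"
  have "open U" unfolding U_def by (intro open_Int continuous_open_preimage cf D open_ball)
  moreover have "x \<in> U" using r x by (simp add: U_def)
  moreover have "f z = z" if z: "z \<in> U" for z
  proof -
    have zD: "z \<in> D" using z by (simp add: U_def)
    have "\<phi> (f z) = (\<Sum>i<n. (f ^^ Suc i) z)" by (simp add: \<phi>_def funpow_swap1)
    also have "\<dots> = \<phi> z"
    proof -
      have "(\<Sum>i<n. (f ^^ Suc i) z - (f ^^ i) z) = (f ^^ n) z - (f ^^ 0) z"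
        by (rule sum_lessThan_telescope)
      then show ?thesis using n(2)[OF zD] by (simp add: sum_subtractf \<phi>_def)
    qed
    finally show ?thesis using inj_onD[OF r(3)] z by (auto simp: U_def)
  qed
  ultimately show ?thesis by (intro exI[of _ U]) (auto simp: U_def)
qed

text \<open>The points fixed by \<open>f\<close> with trivial derivative form a closed set, and an
  open one by the local statement; the domain is connected.\<close>

lemma finite_order_identity:
  fixes f :: "real^'n \<Rightarrow> real^'n"
  assumes D: "open D" "connected D" and f: "smooth_on D f" "f ` D \<subseteq> D" and n: "0 < n" "\<And>z. z \<in> D \<Longrightarrow> (f ^^ n) z = z"
    and x: "x \<in> D" "f x = x" "jacobian f (at x) = mat 1" and z: "z \<in> D"
  shows "f z = z"
proof -
  define A where "A = {z \<in> D. f z = z \<and> jacobian f (at z) = mat 1}"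
  have "\<exists>U. open U \<and> z \<in> U \<and> U \<subseteq> A" if "z \<in> A" for z
  proof -
    obtain U where U: "open U" "z \<in> U" "U \<subseteq> D" "\<forall>z\<in>U. f z = z"
      using finite_order_locally_identity[OF D(1) f n] \<open>z \<in> A\<close> unfolding A_def by blast
    then have "U \<subseteq> A" using jacobian_identity[OF U(1)] by (auto simp: A_def)
    then show ?thesis using U by blast
  qed
  then have "open A" by (subst open_subopen) blast
  moreover have "closedin (top_of_set D) A"
  proof -
    have "closedin (top_of_set D) {z \<in> D. f z - z = 0}"
      by (intro continuous_closedin_preimage_constant continuous_on_diff smooth_on_continuous[OF f(1)] continuous_on_id)
    moreover have "closedin (top_of_set D) {z \<in> D. jacobian f (at z) = mat 1}"
      by (intro continuous_closedin_preimage_constant smooth_on_continuous_jacobian[OF f(1)])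
    ultimately have "closedin (top_of_set D) ({z \<in> D. f z - z = 0} \<inter> {z \<in> D. jacobian f (at z) = mat 1})"
      by (rule closedin_Int)
    moreover have "{z \<in> D. f z - z = 0} \<inter> {z \<in> D. jacobian f (at z) = mat 1} = A" by (auto simp: A_def)
    ultimately show ?thesis by simp
  qed
  moreover have "openin (top_of_set D) A"
    using \<open>open A\<close> by (auto simp: A_def intro!: open_subset)
  ultimately have "A = {} \<or> A = D" using D(2) connected_clopen by blast
  moreover have "x \<in> A" using x by (simp add: A_def)
  ultimately show ?thesis using z by (auto simp: A_def)
qed

context
  fixes X :: "'x topology" and c :: "('n::finite, 'g, 'x) orbifold_chart"
  assumes c: "orbifold_chart X c"
begin

lemma chart_action: "group_action (chart_group c) (chart_dom c) (chart_act c)"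
  using c by (auto simp: orbifold_chart_def faithful_action_def)

lemma chart_group: "group (chart_group c)"
  using chart_action group_action.group_hom group_hom.axioms(1) by blast

lemma chart_props:
  shows "open (chart_dom c)" "connected (chart_dom c)" "finite (carrier (chart_group c))"
    and "\<gamma> \<in> carrier (chart_group c) \<Longrightarrow> smooth_on (chart_dom c) (chart_act c \<gamma>)"
    and "\<lbrakk>\<gamma> \<in> carrier (chart_group c); x \<in> chart_dom c\<rbrakk> \<Longrightarrow> chart_act c \<gamma> x \<in> chart_dom c"
    and "x \<in> chart_dom c \<Longrightarrow> chart_act c \<one>\<^bsub>chart_group c\<^esub> x = x"
    and "\<gamma> \<in> carrier (chart_group c) \<Longrightarrow> chart_act c \<gamma> ` chart_dom c \<subseteq> chart_dom c"
proof -
  interpret group_action "chart_group c" "chart_dom c" "chart_act c" by (rule chart_action)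
  show "open (chart_dom c)" "connected (chart_dom c)" "finite (carrier (chart_group c))"
    "\<gamma> \<in> carrier (chart_group c) \<Longrightarrow> smooth_on (chart_dom c) (chart_act c \<gamma>)"
    using c by (auto simp: orbifold_chart_def)
  show "\<lbrakk>\<gamma> \<in> carrier (chart_group c); x \<in> chart_dom c\<rbrakk> \<Longrightarrow> chart_act c \<gamma> x \<in> chart_dom c"
    using element_image by blast
  show "\<gamma> \<in> carrier (chart_group c) \<Longrightarrow> chart_act c \<gamma> ` chart_dom c \<subseteq> chart_dom c"
    using surj_prop by blast
  show "x \<in> chart_dom c \<Longrightarrow> chart_act c \<one>\<^bsub>chart_group c\<^esub> x = x"
    using id_eq_one by (metis restrict_apply')
qed

lemma chart_act_funpow:
  assumes "\<gamma> \<in> carrier (chart_group c)" "z \<in> chart_dom c"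
  shows "chart_act c (\<gamma> [^]\<^bsub>chart_group c\<^esub> (i::nat)) z = (chart_act c \<gamma> ^^ i) z"
proof (induction i)
  case 0
  interpret group "chart_group c" by (rule chart_group)
  show ?case using chart_props(6)[OF assms(2)] by simp
next
  case (Suc i)
  interpret group "chart_group c" by (rule chart_group)
  have "\<gamma> [^]\<^bsub>chart_group c\<^esub> Suc i = \<gamma> \<otimes>\<^bsub>chart_group c\<^esub> \<gamma> [^]\<^bsub>chart_group c\<^esub> i"
    by (rule nat_pow_Suc2[OF assms(1)])
  then show ?case
    using group_action.composition_rule[OF chart_action assms(2,1) nat_pow_closed[OF assms(1)], of i] Suc by simp
qed

lemma chart_act_finite_order:
  assumes "\<gamma> \<in> carrier (chart_group c)"
  obtains n where "0 < n" "\<And>z. z \<in> chart_dom c \<Longrightarrow> (chart_act c \<gamma> ^^ n) z = z"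
proof -
  interpret group "chart_group c" by (rule chart_group)
  have "0 < order (chart_group c)" using chart_props(3) by (simp add: order_gt_0_iff_finite)
  moreover have "(chart_act c \<gamma> ^^ order (chart_group c)) z = z" if "z \<in> chart_dom c" for z
    using chart_act_funpow[OF assms that, of "order (chart_group c)"] pow_order_eq_1[OF assms] chart_props(6)[OF that] by simp
  ultimately show thesis using that by blast
qed

text \<open>The isotropy representation on the tangent space is faithful: the element acts as the
  identity on the whole connected chart, and chart groups act effectively.\<close>

lemma isotropy_faithful:
  assumes \<gamma>: "\<gamma> \<in> carrier (chart_group c)" and x: "x \<in> chart_dom c" "chart_act c \<gamma> x = x"
    "jacobian (chart_act c \<gamma>) (at x) = mat 1"
  shows "\<gamma> = \<one>\<^bsub>chart_group c\<^esub>"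
proof -
  interpret group "chart_group c" by (rule chart_group)
  interpret faithful_action "chart_group c" "chart_dom c" "chart_act c"
    using c by (simp add: orbifold_chart_def)
  obtain n where n: "0 < n" "\<And>z. z \<in> chart_dom c \<Longrightarrow> (chart_act c \<gamma> ^^ n) z = z"
    using chart_act_finite_order[OF \<gamma>] by blast
  have "chart_act c \<gamma> z = z" if "z \<in> chart_dom c" for z
    by (rule finite_order_identity[OF chart_props(1,2) chart_props(4,7)[OF \<gamma>] n x that])
  \<comment> \<open>Group actions consist of extensional functions, so agreement on the chart gives
    equality of functions.\<close>
  moreover have "chart_act c \<gamma> \<in> extensional (chart_dom c)"
    using bij_prop0[OF \<gamma>] by (simp add: Bij_def)
  ultimately have "chart_act c \<gamma> = (\<lambda>z\<in>chart_dom c. z)"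
    by (auto simp: fun_eq_iff extensional_def)
  then have "chart_act c \<gamma> = chart_act c \<one>\<^bsub>chart_group c\<^esub>" using id_eq_one by simp
  then show ?thesis using inj_onD[OF faithful] \<gamma> one_closed by blast
qed

text \<open>The induced map on the orbit space is injective, being a homeomorphism onto its
  image.\<close>

lemma chart_fibre_orbit:
  assumes "x \<in> chart_dom c" "y \<in> chart_dom c" "chart_map c x = chart_map c y"
  shows "\<exists>\<gamma>\<in>carrier (chart_group c). y = chart_act c \<gamma> x"
proof -
  interpret group "chart_group c" by (rule chart_group)
  let ?o = "orbit (chart_group c) (chart_act c)"
  have "homeomorphic_map (quotient_topology (top_of_set (chart_dom c)) ?o)
       (subtopology X (chart_map c ` chart_dom c)) (\<lambda>p. the_elem (chart_map c ` p))"
    using c by (simp add: orbifold_chart_def)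
  then have "inj_on (\<lambda>p. the_elem (chart_map c ` p)) (topspace (quotient_topology (top_of_set (chart_dom c)) ?o))"
    by (simp add: homeomorphic_eq_everything_map)
  then have inj: "inj_on (\<lambda>p. the_elem (chart_map c ` p)) (?o ` chart_dom c)" by simp
  have el: "the_elem (chart_map c ` ?o z) = chart_map c z" if "z \<in> chart_dom c" for z
  proof -
    have "chart_map c ` ?o z = {chart_map c z}"
    proof (intro subset_antisym subsetI)
      fix p assume "p \<in> chart_map c ` ?o z"
      then obtain \<gamma> where "\<gamma> \<in> carrier (chart_group c)" "p = chart_map c (chart_act c \<gamma> z)"
        by (auto simp: orbit_def)
      then show "p \<in> {chart_map c z}" using c that by (simp add: orbifold_chart_def)
    next
      fix p assume "p \<in> {chart_map c z}"
      moreover have "z \<in> ?o z" using chart_props(6)[OF that] one_closed unfolding orbit_def by (metis (mono_tags, lifting) mem_Collect_eq)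
      ultimately show "p \<in> chart_map c ` ?o z" by blast
    qed
    then show ?thesis by simp
  qed
  have "?o x = ?o y"
    by (rule inj_onD[OF inj]) (use assms el in auto)
  moreover have "y \<in> ?o y" using chart_props(6)[OF assms(2)] one_closed unfolding orbit_def by (metis (mono_tags, lifting) mem_Collect_eq)
  ultimately show ?thesis by (auto simp: orbit_def)
qed

text \<open>The finite case of the Baire theorem: a \<open>C i\<close> that does not contain
  \<open>U\<close> is removed from \<open>U\<close>. The last hypothesis says that each
  \<open>C i\<close> is closed relative to \<open>U\<close>, in a form that passes to smaller open
  sets.\<close>

lemma finite_cover_interior:
  assumes "finite I" "open U" "U \<noteq> {}" "U \<subseteq> (\<Union>i\<in>I. C i)"
    "\<And>i U'. \<lbrakk>i \<in> I; open U'; U' \<subseteq> U\<rbrakk> \<Longrightarrow> open (U' - C i)"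
  shows "\<exists>i\<in>I. \<exists>U'\<subseteq>U. open U' \<and> U' \<noteq> {} \<and> U' \<subseteq> C i"
  using assms
proof (induction I arbitrary: U rule: finite_induct)
  case (insert i I)
  show ?case
  proof (cases "U \<subseteq> C i")
    case True
    then show ?thesis using insert.prems by blast
  next
    case False
    have "open (U - C i)" using insert.prems by blast
    moreover have "U - C i \<noteq> {}" using False by blast
    moreover have "U - C i \<subseteq> (\<Union>i\<in>I. C i)" using insert.prems by blast
    moreover have "open (U' - C i')" if "i' \<in> I" "open U'" "U' \<subseteq> U - C i" for i' U'
      by (rule insert.prems(4)) (use that in auto)
    ultimately have "\<exists>i'\<in>I. \<exists>U'\<subseteq>U - C i. open U' \<and> U' \<noteq> {} \<and> U' \<subseteq> C i'"
      by (rule insert.IH)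
    then obtain i' U' where "i' \<in> I" "U' \<subseteq> U" "open U'" "U' \<noteq> {}" "U' \<subseteq> C i'" by blast
    then show ?thesis by (intro bexI[of _ i'] exI[of _ U']) auto
  qed
qed simp

text \<open>Near every point a change of charts coincides with a group element on some open set, by a finite
  Baire argument; continuity transports values and derivatives to the point itself.\<close>

lemma chart_change_self:
  assumes h: "chart_change c c V W h" and x: "x \<in> V"
  shows "\<exists>\<gamma>\<in>carrier (chart_group c). h x = chart_act c \<gamma> x \<and> jacobian h (at x) = jacobian (chart_act c \<gamma>) (at x)"
proof (rule ccontr)
  assume neg: "\<not> ?thesis"
  note ch = chart_changeD[OF h] and di = diffeomorphismD[OF chart_changeD(5)[OF h]]
  let ?\<Gamma> = "carrier (chart_group c)"
  have sm: "smooth_on V (chart_act c \<gamma>)" if "\<gamma> \<in> ?\<Gamma>" for \<gamma>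
    by (rule smooth_on_subset[OF chart_props(4)[OF that] ch(3)])
  define \<Delta> where "\<Delta> \<gamma> z = (h z - chart_act c \<gamma> z, jacobian h (at z) - jacobian (chart_act c \<gamma>) (at z))" for \<gamma> z
  have cont: "continuous_on V (\<Delta> \<gamma>)" if "\<gamma> \<in> ?\<Gamma>" for \<gamma>
    unfolding \<Delta>_def using sm[OF that] di(1)
    by (intro continuous_on_Pair continuous_on_diff smooth_on_continuous smooth_on_continuous_jacobian)
  \<comment> \<open>The set where no group element matches both \<open>h\<close> and its derivative.
    It is open, and by assumption it contains \<open>x\<close>.\<close>
  define U where "U = V \<inter> (\<Inter>\<gamma>\<in>?\<Gamma>. {z \<in> V. \<Delta> \<gamma> z \<noteq> 0})"
  have opn: "open {z \<in> V. \<Delta> \<gamma> z \<noteq> 0}" if "\<gamma> \<in> ?\<Gamma>" for \<gamma>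
  proof -
    have "open (V \<inter> \<Delta> \<gamma> -` (- {0}))" by (rule continuous_open_preimage[OF cont[OF that] ch(1)]) auto
    moreover have "V \<inter> \<Delta> \<gamma> -` (- {0}) = {z \<in> V. \<Delta> \<gamma> z \<noteq> 0}" by auto
    ultimately show ?thesis by simp
  qed
  have oU: "open U" unfolding U_def using chart_props(3) ch(1) opn by (intro open_Int open_INT) auto
  have xU: "x \<in> U" using neg x by (auto simp: U_def \<Delta>_def zero_prod_def)
  define C where "C \<gamma> = {z. h z = chart_act c \<gamma> z}" for \<gamma>
  have "\<exists>\<gamma>\<in>?\<Gamma>. \<exists>U'\<subseteq>U. open U' \<and> U' \<noteq> {} \<and> U' \<subseteq> C \<gamma>"
  proof (rule finite_cover_interior[OF chart_props(3) oU])
    show "U \<noteq> {}" using xU by blast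
    show "U \<subseteq> (\<Union>\<gamma>\<in>?\<Gamma>. C \<gamma>)"
    proof
      fix z assume "z \<in> U"
      then have z: "z \<in> V" by (simp add: U_def)
      have "chart_map c z = chart_map c (h z)" using ch(6)[OF z] by simp
      moreover have "z \<in> chart_dom c" "h z \<in> chart_dom c" using z ch(3,4) di(5)[OF z] by auto
      ultimately obtain \<gamma> where "\<gamma> \<in> ?\<Gamma>" "h z = chart_act c \<gamma> z" using chart_fibre_orbit by blast
      then show "z \<in> (\<Union>\<gamma>\<in>?\<Gamma>. C \<gamma>)" by (auto simp: C_def)
    qed
    fix \<gamma> U' assume \<gamma>: "\<gamma> \<in> ?\<Gamma>" and U': "open U'" "U' \<subseteq> U"
    have "continuous_on U' (\<lambda>z. h z - chart_act c \<gamma> z)"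
      using continuous_on_subset[OF _ order_trans[OF U'(2)]] sm[OF \<gamma>] di(1) U'(2)
      by (intro continuous_on_diff smooth_on_continuous) (auto intro: smooth_on_subset simp: U_def)
    then have "open (U' \<inter> (\<lambda>z. h z - chart_act c \<gamma> z) -` (- {0}))"
      by (rule continuous_open_preimage[OF _ U'(1)]) auto
    moreover have "U' \<inter> (\<lambda>z. h z - chart_act c \<gamma> z) -` (- {0}) = U' - C \<gamma>" by (auto simp: C_def)
    ultimately show "open (U' - C \<gamma>)" by simp
  qed
  then obtain \<gamma> U' where \<gamma>: "\<gamma> \<in> ?\<Gamma>" and U': "U' \<subseteq> U" "open U'" "U' \<noteq> {}" "U' \<subseteq> C \<gamma>" by blast
  obtain z where z: "z \<in> U'" using U'(3) by blast
  have UV: "U' \<subseteq> V" using U'(1) by (auto simp: U_def)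
  \<comment> \<open>On the open set \<open>U'\<close> the map \<open>h\<close> is a group element,
    so the derivatives agree as well, contrary to the choice of \<open>U\<close>.\<close>
  have "jacobian h (at z) = jacobian (chart_act c \<gamma>) (at z)"
    by (rule jacobian_cong[OF U'(2) z _ smooth_on_subset[OF di(1) UV]]) (use U'(4) in \<open>auto simp: C_def\<close>)
  then have "\<Delta> \<gamma> z = 0" using z U'(4) by (auto simp: \<Delta>_def C_def zero_prod_def)
  then show False using z U'(1) \<gamma> by (auto simp: U_def)
qed

end

subsection \<open>Orthonormal frames\<close>

text \<open>The standard basis is orthonormalised for an inner product that varies continuously with
  \<open>x\<close>. The induction runs over finite sets of indices, since the index type carries no
  order.\<close>

lemma gram_schmidt:
  fixes g :: "'a::topological_space \<Rightarrow> real^'n^'n"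
  assumes g: "continuous_on D g" "\<And>x. x \<in> D \<Longrightarrow> transpose (g x) = g x"
    "\<And>x v. \<lbrakk>x \<in> D; v \<noteq> 0\<rbrakk> \<Longrightarrow> v \<bullet> (g x *v v) > 0"
  obtains s :: "'a \<Rightarrow> real^'n^'n" where "continuous_on D s" "\<And>x. x \<in> D \<Longrightarrow> transpose (s x) ** g x ** s x = mat 1"
proof -
  have sym: "u \<bullet> (g x *v v) = v \<bullet> (g x *v u)" if "x \<in> D" for x u v
    using g(2)[OF that] by (metis dot_lmul_matrix inner_commute transpose_matrix_vector vector_transpose_matrix)
  \<comment> \<open>The span condition keeps the next vector nonzero: \<open>axis k 1\<close> is not
    in the span of the other axes.\<close>
  have "\<exists>b. \<forall>i\<in>I. continuous_on D (b i) \<and> (\<forall>x\<in>D. b i x \<in> span ((\<lambda>j. axis j 1) ` I) \<and>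
      (\<forall>j\<in>I. b i x \<bullet> (g x *v b j x) = (if i = j then 1 else 0)))" if "finite I" for I :: "'n set"
    using that
  proof (induction I rule: finite_induct)
    case (insert k I)
    then obtain b where b: "\<And>i. i \<in> I \<Longrightarrow> continuous_on D (b i)"
      "\<And>i x. \<lbrakk>i \<in> I; x \<in> D\<rbrakk> \<Longrightarrow> b i x \<in> span ((\<lambda>j. axis j 1) ` I)"
      "\<And>i j x. \<lbrakk>i \<in> I; j \<in> I; x \<in> D\<rbrakk> \<Longrightarrow> b i x \<bullet> (g x *v b j x) = (if i = j then 1 else 0)"
      by metis
    define p where "p x = (\<Sum>i\<in>I. (b i x \<bullet> (g x *v axis k 1)) *\<^sub>R b i x)" for x
    define v where "v x = axis k 1 - p x" for x
    define w where "w x = (1 / sqrt (v x \<bullet> (g x *v v x))) *\<^sub>R v x" for x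
    have pspan: "p x \<in> span ((\<lambda>j. axis j 1) ` I)" if "x \<in> D" for x
      unfolding p_def using b(2) that by (intro span_sum span_scale) auto
    have v0: "v x \<noteq> 0" if "x \<in> D" for x
    proof
      assume "v x = 0"
      then have "axis k 1 \<in> span ((\<lambda>j. axis j (1::real)) ` I)" using pspan[OF that] by (simp add: v_def)
      moreover have "span ((\<lambda>j. axis j (1::real)) ` I) \<subseteq> {u. u $ k = 0}"
        by (rule span_minimal) (use insert.hyps in \<open>auto simp: axis_def subspace_def\<close>)
      ultimately show False by (auto simp: axis_def)
    qed
    have cp: "continuous_on D p"
      unfolding p_def using b(1) g(1)
      by (intro continuous_on_sum continuous_on_scaleR continuous_on_inner continuous_on_matrix_vector_mult continuous_on_const) auto
    have cv: "continuous_on D v" unfolding v_def by (intro continuous_on_diff continuous_on_const cp)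
    have cw: "continuous_on D w"
      unfolding w_def using g(3) v0
      by (intro continuous_on_scaleR continuous_on_divide continuous_on_const continuous_on_real_sqrt
          continuous_on_inner continuous_on_matrix_vector_mult cv g(1)) (auto simp: less_imp_neq[symmetric] dest!: g(3))
    have orth: "b j x \<bullet> (g x *v v x) = 0" if "j \<in> I" "x \<in> D" for j x
    proof -
      have "b j x \<bullet> (g x *v p x) = (\<Sum>i\<in>I. (b i x \<bullet> (g x *v axis k 1)) * (b j x \<bullet> (g x *v b i x)))"
        unfolding p_def by (simp add: linear_sum[OF matrix_vector_mul_linear] inner_sum_right matrix_vector_mult_scaleR)
      also have "\<dots> = (\<Sum>i\<in>I. if i = j then b i x \<bullet> (g x *v axis k 1) else 0)"
        using that b(3) by (intro sum.cong) auto
      also have "\<dots> = b j x \<bullet> (g x *v axis k 1)" using that insert.hyps by simp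
      finally show ?thesis by (simp add: v_def matrix_vector_mult_diff_distrib inner_diff_right)
    qed
    define b' where "b' i = (if i = k then w else b i)" for i
    have "continuous_on D (b' i)" if "i \<in> insert k I" for i
      using that cw b(1) by (auto simp: b'_def)
    moreover have "b' i x \<in> span ((\<lambda>j. axis j 1) ` insert k I)" if "i \<in> insert k I" "x \<in> D" for i x
    proof -
      have mono: "span ((\<lambda>j. axis j (1::real)) ` I) \<subseteq> span ((\<lambda>j. axis j 1) ` insert k I)"
        by (intro span_mono) auto
      have "axis k 1 \<in> span ((\<lambda>j. axis j (1::real)) ` insert k I)" by (intro span_base) auto
      then have "w x \<in> span ((\<lambda>j. axis j 1) ` insert k I)"
        unfolding w_def v_def using pspan[OF that(2)] mono by (intro span_scale span_diff) auto
      then show ?thesis using that b(2)[of i x] mono by (auto simp: b'_def)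
    qed
    moreover have "b' i x \<bullet> (g x *v b' j x) = (if i = j then 1 else 0)"
      if "i \<in> insert k I" "j \<in> insert k I" "x \<in> D" for i j x
    proof -
      have pos: "v x \<bullet> (g x *v v x) > 0" using g(3)[OF that(3) v0[OF that(3)]] .
      have ww: "w x \<bullet> (g x *v w x) = 1"
        using pos by (simp add: w_def matrix_vector_mult_scaleR real_sqrt_mult_self[unfolded abs_of_pos] field_simps flip: power2_eq_square)
      have bw: "b j x \<bullet> (g x *v w x) = 0" if "j \<in> I" for j
        using orth[OF that \<open>x \<in> D\<close>] by (simp add: w_def matrix_vector_mult_scaleR)
      have wb: "w x \<bullet> (g x *v b j x) = 0" if "j \<in> I" for j
        using bw[OF that] sym[OF \<open>x \<in> D\<close>] by simp
      show ?thesis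
        using that ww bw wb b(3) insert.hyps(2) by (auto simp: b'_def)
    qed
    ultimately show ?case by (intro exI[of _ b']) blast
  qed simp
  from this[of UNIV, OF finite] obtain b :: "'n \<Rightarrow> 'a \<Rightarrow> real^'n" where B: "\<forall>i\<in>UNIV. continuous_on D (b i) \<and> (\<forall>x\<in>D. b i x \<in> span (range (\<lambda>j. axis j 1)) \<and>
      (\<forall>j\<in>UNIV. b i x \<bullet> (g x *v b j x) = (if i = j then 1 else 0)))" ..
  have b: "continuous_on D (b i)" "x \<in> D \<Longrightarrow> b i x \<bullet> (g x *v b j x) = (if i = j then 1 else 0)" for i j x
    using B by blast+
  define s where "s x = (\<chi> a i. b i x $ a)" for x
  have cs: "continuous_on D s"
    by (rule continuous_on_matrix) (simp add: s_def continuous_on_component b(1))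
  have ss: "transpose (s x) ** g x ** s x = mat 1" if "x \<in> D" for x
  proof -
    have entry: "(transpose (s x) ** (g x ** s x)) $ i $ j = b i x \<bullet> (g x *v b j x)" for i j
      by (simp only: matrix_matrix_mult_def transpose_def s_def matrix_vector_mult_def inner_vec_def
          vec_lambda_beta inner_real_def)
    have "(transpose (s x) ** (g x ** s x)) $ i $ j = (mat 1 :: real^'n^'n) $ i $ j" for i j
      unfolding entry b(2)[OF that] by (simp add: mat_def)
    then have "transpose (s x) ** (g x ** s x) = mat 1"
      by (simp only: vec_eq_iff simp_thms)
    then show ?thesis unfolding matrix_mul_assoc .
  qed
  show thesis by (rule that[OF cs ss])
qed

subsection \<open>The frame bundle\<close>

lemma open_map_prod_id:
  assumes "open_map X X' f"
  shows "open_map (prod_topology X Z) (prod_topology X' Z) (\<lambda>(x, z). (f x, z))"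
  unfolding open_map_def
proof (intro allI impI)
  fix S assume S: "openin (prod_topology X Z) S"
  show "openin (prod_topology X' Z) ((\<lambda>(x, z). (f x, z)) ` S)"
    unfolding openin_prod_topology_alt
  proof (intro allI impI)
    fix y z assume "(y, z) \<in> (\<lambda>(x, z). (f x, z)) ` S"
    then obtain x where x: "(x, z) \<in> S" "y = f x" by auto
    obtain U V where UV: "openin X U" "openin Z V" "x \<in> U" "z \<in> V" "U \<times> V \<subseteq> S"
      using S x(1) unfolding openin_prod_topology_alt by meson
    have "openin X' (f ` U)" using assms UV(1) by (simp add: open_map_def)
    moreover have "f ` U \<times> V \<subseteq> (\<lambda>(x, z). (f x, z)) ` S" using UV(5) by force
    ultimately show "\<exists>U V. openin X' U \<and> openin Z V \<and> y \<in> U \<and> z \<in> V \<and> U \<times> V \<subseteq> (\<lambda>(x, z). (f x, z)) ` S"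
      using UV x(2) by blast
  qed
qed

lemma orthogonal_transpose:
  fixes Q :: "real^'n^'n"
  assumes "orthogonal_matrix Q"
  shows "transpose Q ** Q = mat 1" "Q ** transpose Q = mat 1"
  using assms by (auto simp: orthogonal_matrix_def)

locale orbifold_bundle =
  fixes X :: "'x topology" and \<A> :: "('n::finite, 'g, 'x) orbifold_chart set"
    and g :: "('n, 'g, 'x) orbifold_chart \<Rightarrow> real^'n \<Rightarrow> real^'n^'n"
    and E :: "'e topology" and \<sigma> :: "real^'n^'n \<Rightarrow> 'e \<Rightarrow> 'e"
  assumes orb: "smooth_orbifold X \<A>" and metric: "orbifold_metric \<A> g"
    and univ: "universal_orthogonal_space E \<sigma>"
begin

lemma chart: "c \<in> \<A> \<Longrightarrow> orbifold_chart X c"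
  using orb by (simp add: smooth_orbifold_def)

lemma metric_change:
  "\<lbrakk>c \<in> \<A>; d \<in> \<A>; chart_change c d V W h; x \<in> V\<rbrakk> \<Longrightarrow>
    transpose (jacobian h (at x)) ** g d (h x) ** jacobian h (at x) = g c x"
  using metric unfolding orbifold_metric_def by blast

lemma metric_props:
  assumes "c \<in> \<A>"
  shows "continuous_on (chart_dom c) (g c)"
    and "x \<in> chart_dom c \<Longrightarrow> transpose (g c x) = g c x"
    and "\<lbrakk>x \<in> chart_dom c; v \<noteq> 0\<rbrakk> \<Longrightarrow> v \<bullet> (g c x *v v) > 0"
  using metric assms smooth_on_continuous unfolding orbifold_metric_def by blast+

definition frames :: "('n, 'g, 'x) orbifold_chart \<Rightarrow> ((real^'n) \<times> (real^'n^'n)) set" where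
  "frames c = {(x, F). x \<in> chart_dom c \<and> transpose F ** g c x ** F = mat 1}"

lemma chart_frames_eq: "chart_frames g c = top_of_set (frames c)"
  by (simp add: chart_frames_def frames_def)

lemma frame_inverse:
  assumes "(x, F) \<in> frames c"
  shows "(transpose F ** g c x) ** F = mat 1" "F ** (transpose F ** g c x) = mat 1"
  using assms matrix_left_right_inverse by (auto simp: frames_def)

lemma frame_push:
  assumes "c \<in> \<A>" "d \<in> \<A>" "chart_change c d V W h" "x \<in> V" "(x, F) \<in> frames c"
  shows "(h x, jacobian h (at x) ** F) \<in> frames d"
proof -
  let ?J = "jacobian h (at x)"
  have "transpose (?J ** F) ** g d (h x) ** (?J ** F) = transpose F ** (transpose ?J ** g d (h x) ** ?J) ** F"
    by (simp only: matrix_transpose_mul matrix_mul_assoc)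
  also have "\<dots> = mat 1"
    unfolding metric_change[OF assms(1-4)] using assms(5) by (simp add: frames_def)
  finally show ?thesis
    using chart_changeD(4)[OF assms(3)] diffeomorphismD(5)[OF chart_changeD(5)[OF assms(3)] assms(4)]
    by (auto simp: frames_def)
qed

lemma frame_rotate:
  assumes "(x, F) \<in> frames c" "orthogonal_matrix Q"
  shows "(x, F ** transpose Q) \<in> frames c"
proof -
  have "transpose (F ** transpose Q) ** g c x ** (F ** transpose Q) = Q ** (transpose F ** g c x ** F) ** transpose Q"
    by (simp only: matrix_transpose_mul transpose_transpose matrix_mul_assoc)
  then show ?thesis using assms by (simp add: frames_def orthogonal_transpose)
qed

text \<open>The inverse of an orthonormal frame \<open>F\<close> is
  \<open>transpose F ** g c x\<close>, so the matrix is the change of basis between two orthonormal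
  frames.\<close>

lemma frame_ratio_orthogonal:
  assumes "(x, F) \<in> frames c" "(x, F') \<in> frames c"
  shows "orthogonal_matrix (transpose F ** g c x ** F')"
proof -
  let ?M = "transpose F ** g c x ** F'"
  have "F ** ?M = (F ** (transpose F ** g c x)) ** F'" by (simp only: matrix_mul_assoc)
  then have FM: "F ** ?M = F'" by (simp add: frame_inverse[OF assms(1)])
  have "transpose ?M ** ?M = transpose ?M ** (transpose F ** g c x ** F) ** ?M"
    using assms(1) by (simp add: frames_def)
  also have "\<dots> = transpose (F ** ?M) ** g c x ** (F ** ?M)"
    by (simp only: matrix_transpose_mul matrix_mul_assoc)
  also have "\<dots> = mat 1" unfolding FM using assms(2) by (simp add: frames_def)
  finally show ?thesis by (simp add: orthogonal_matrix)
qed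

lemma frame_rel_iff:
  "((c, x, F), (d, y, G)) \<in> frame_rel \<A> g \<longleftrightarrow> c \<in> \<A> \<and> d \<in> \<A> \<and> (x, F) \<in> frames c \<and> (y, G) \<in> frames d \<and>
    (\<exists>V W h. chart_change c d V W h \<and> x \<in> V \<and> h x = y \<and> jacobian h (at x) ** F = G)"
  by (auto simp: frame_rel_def chart_frames_eq)

lemma frame_rel_change:
  assumes "c \<in> \<A>" "d \<in> \<A>" "chart_change c d V W h" "x \<in> V" "(x, F) \<in> frames c"
  shows "((c, x, F), (d, h x, jacobian h (at x) ** F)) \<in> frame_rel \<A> g"
  unfolding frame_rel_iff using assms frame_push[OF assms] by blast

lemma equiv_frame_rel: "equiv (topspace (sum_topology (chart_frames g) \<A>)) (frame_rel \<A> g)"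
proof (rule equivI)
  let ?S = "topspace (sum_topology (chart_frames g) \<A>)"
  show "frame_rel \<A> g \<subseteq> ?S \<times> ?S" unfolding frame_rel_def by blast
  show "refl_on ?S (frame_rel \<A> g)"
    unfolding refl_on_def
  proof
    fix p assume "p \<in> ?S"
    then obtain c x F where p: "p = (c, x, F)" "c \<in> \<A>" "(x, F) \<in> frames c"
      by (auto simp: chart_frames_eq)
    let ?e = "\<one>\<^bsub>chart_group c\<^esub>"
    note ch = chart[OF p(2)]
    have e: "?e \<in> carrier (chart_group c)" using chart_group[OF ch] by (simp add: group.is_monoid monoid.one_closed)
    have x: "x \<in> chart_dom c" using p(3) by (simp add: frames_def)
    have "jacobian (chart_act c ?e) (at x) = mat 1"
      by (rule jacobian_identity[OF chart_props(1)[OF ch] x chart_props(6)[OF ch]])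
    then show "(p, p) \<in> frame_rel \<A> g"
      using frame_rel_change[OF p(2,2) chart_change_act[OF ch e] x p(3)] chart_props(6)[OF ch x] p(1) by simp
  qed
  show "sym (frame_rel \<A> g)"
  proof (rule symI)
    fix p p' assume "(p, p') \<in> frame_rel \<A> g"
    then obtain c x F d y G V W h where p: "p = (c, x, F)" "p' = (d, y, G)" "c \<in> \<A>" "d \<in> \<A>" "(x, F) \<in> frames c" "(y, G) \<in> frames d"
      and h: "chart_change c d V W h" "x \<in> V" "h x = y" "jacobian h (at x) ** F = G"
      by (cases p, cases p') (auto simp: frame_rel_iff)
    note di = diffeomorphismD[OF chart_changeD(5)[OF h(1)]]
    let ?k = "inv_into V h"
    have "jacobian (\<lambda>x. ?k (h x)) (at x) = jacobian ?k (at (h x)) ** jacobian h (at x)"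
      by (rule jacobian_compose[OF di(1) h(2) di(4)]) (use di h in auto)
    moreover have "jacobian (\<lambda>x. ?k (h x)) (at x) = mat 1"
      by (rule jacobian_identity[OF chart_changeD(1)[OF h(1)] h(2)]) (use di in auto)
    ultimately have "jacobian ?k (at y) ** jacobian h (at x) = mat 1" using h(3) by simp
    then have "jacobian ?k (at y) ** G = F"
      unfolding h(4)[symmetric] matrix_mul_assoc by simp
    moreover have "?k y = x" "y \<in> W" using di h by auto
    ultimately show "(p', p) \<in> frame_rel \<A> g"
      using frame_rel_change[OF p(4,3) chart_change_inverse[OF h(1)] _ p(6)] p(1,2) by simp
  qed
  show "trans (frame_rel \<A> g)"
  proof (rule transI)
    fix p p' p'' assume "(p, p') \<in> frame_rel \<A> g" "(p', p'') \<in> frame_rel \<A> g"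
    then obtain c x F d y G e z H V W h V' W' h'
      where p: "p = (c, x, F)" "p' = (d, y, G)" "p'' = (e, z, H)" "c \<in> \<A>" "d \<in> \<A>" "e \<in> \<A>" "(x, F) \<in> frames c"
      and h: "chart_change c d V W h" "x \<in> V" "h x = y" "jacobian h (at x) ** F = G"
      and h': "chart_change d e V' W' h'" "y \<in> V'" "h' y = z" "jacobian h' (at y) ** G = H"
      by (cases p, cases p', cases p'') (auto simp: frame_rel_iff)
    obtain V'' W'' where c: "chart_change c e V'' W'' (\<lambda>x. h' (h x))" "V'' = {x \<in> V. h x \<in> V'}"
      using chart_change_compose[OF h(1) h'(1)] by blast
    have "jacobian (\<lambda>x. h' (h x)) (at x) = jacobian h' (at (h x)) ** jacobian h (at x)"
      by (rule jacobian_compose[OF diffeomorphismD(1)[OF chart_changeD(5)[OF h(1)]] h(2)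
          diffeomorphismD(1)[OF chart_changeD(5)[OF h'(1)]]]) (use h h' in simp)
    then have "jacobian (\<lambda>x. h' (h x)) (at x) ** F = H"
      using h(3,4) h'(4) by (simp flip: matrix_mul_assoc)
    then show "(p, p'') \<in> frame_rel \<A> g"
      using frame_rel_change[OF p(4,6) c(1) _ p(7)] c(2) h h' p(1,3) by simp
  qed
qed

definition frame_class :: "('n, 'g, 'x) orbifold_chart \<Rightarrow> (real^'n) \<times> (real^'n^'n) \<Rightarrow>
    (('n, 'g, 'x) orbifold_chart \<times> (real^'n) \<times> (real^'n^'n)) set" where
  "frame_class c z = frame_rel \<A> g `` {(c, z)}"

lemma in_total: "\<lbrakk>c \<in> \<A>; z \<in> frames c\<rbrakk> \<Longrightarrow> (c, z) \<in> topspace (sum_topology (chart_frames g) \<A>)"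
  by (simp add: chart_frames_eq)

lemma frame_class_eq_iff:
  assumes "c \<in> \<A>" "z \<in> frames c" "d \<in> \<A>" "w \<in> frames d"
  shows "frame_class c z = frame_class d w \<longleftrightarrow> ((c, z), (d, w)) \<in> frame_rel \<A> g"
  unfolding frame_class_def using eq_equiv_class_iff[OF equiv_frame_rel in_total in_total] assms by blast

lemma topspace_frame_bundle: "topspace (frame_bundle \<A> g) = (\<Union>c\<in>\<A>. frame_class c ` frames c)"
  by (auto simp: frame_bundle_def frame_class_def chart_frames_eq)

lemma continuous_map_frame_class:
  assumes "c \<in> \<A>"
  shows "continuous_map (top_of_set (frames c)) (frame_bundle \<A> g) (frame_class c)"
proof -
  have "continuous_map (sum_topology (chart_frames g) \<A>) (frame_bundle \<A> g) (\<lambda>p. frame_rel \<A> g `` {p})"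
    unfolding frame_bundle_def by (rule quotient_imp_continuous_map[OF quotient_map_quotient_topology])
  from continuous_map_compose[OF continuous_map_component_injection[OF assms] this]
  show ?thesis by (simp add: chart_frames_eq o_def frame_class_def[abs_def])
qed

text \<open>Frames are glued along derivatives of diffeomorphisms; near each of its points, the
  saturation of an open set therefore contains the preimage of an open set under a continuous map of
  frames.\<close>

lemma open_map_frame_class:
  assumes c: "c \<in> \<A>"
  shows "open_map (top_of_set (frames c)) (frame_bundle \<A> g) (frame_class c)"
  unfolding open_map_def
proof (intro allI impI)
  fix U assume U: "openin (top_of_set (frames c)) U"
  then obtain O' where O': "open O'" "U = frames c \<inter> O'" by (auto simp: openin_open)
  let ?P = "{p \<in> topspace (sum_topology (chart_frames g) \<A>). frame_rel \<A> g `` {p} \<in> frame_class c ` U}"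
  have "openin (top_of_set (frames d)) {z. (d, z) \<in> ?P}" if d: "d \<in> \<A>" for d
  proof (subst openin_subopen, intro ballI)
    fix w assume "w \<in> {z. (d, z) \<in> ?P}"
    then obtain z where w: "w \<in> frames d" and z: "z \<in> U" "frame_class d w = frame_class c z"
      by (auto simp: chart_frames_eq frame_class_def)
    obtain x F y G where xy: "z = (x, F)" "w = (y, G)" by fastforce
    have "((d, w), (c, z)) \<in> frame_rel \<A> g" using frame_class_eq_iff[OF d w c, of z] z O'(2) by simp
    then obtain V W h where h: "chart_change d c V W h" "y \<in> V" "h y = x" "jacobian h (at y) ** G = F"
      by (auto simp: frame_rel_iff xy)
    note di = diffeomorphismD[OF chart_changeD(5)[OF h(1)]]
    define \<psi> where "\<psi> = (\<lambda>(y, G :: real^'n^'n). (h y, jacobian h (at y) ** G))"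
    have "continuous_on (V \<times> UNIV) \<psi>"
    proof -
      have fst: "continuous_on (V \<times> UNIV) (fst :: (real^'n) \<times> (real^'n^'n) \<Rightarrow> _)" by (intro continuous_intros)
      have im: "fst ` (V \<times> (UNIV :: (real^'n^'n) set)) \<subseteq> V" by auto
      have "continuous_on (V \<times> UNIV) (\<lambda>p :: (real^'n) \<times> (real^'n^'n). (h (fst p), jacobian h (at (fst p)) ** snd p))"
        by (intro continuous_on_Pair continuous_on_matrix_mult continuous_on_snd continuous_on_id
            continuous_on_compose2[OF smooth_on_continuous[OF di(1)] fst im]
            continuous_on_compose2[OF smooth_on_continuous_jacobian[OF di(1)] fst im])
      then show ?thesis by (simp add: \<psi>_def case_prod_unfold)
    qed
    then have op: "open ((V \<times> UNIV) \<inter> \<psi> -` O')"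
      by (rule continuous_open_preimage) (use chart_changeD(1)[OF h(1)] O' in \<open>auto intro: open_Times\<close>)
    let ?N = "frames d \<inter> ((V \<times> UNIV) \<inter> \<psi> -` O')"
    have "openin (top_of_set (frames d)) ?N" using op by auto
    moreover have "w \<in> ?N" using w xy h z O' by (auto simp: \<psi>_def)
    moreover have "?N \<subseteq> {z. (d, z) \<in> ?P}"
    proof
      fix v assume v: "v \<in> ?N"
      obtain y' G' where v': "v = (y', G')" by fastforce
      have yG: "(y', G') \<in> frames d" "y' \<in> V" "\<psi> (y', G') \<in> O'" using v v' by auto
      have "\<psi> (y', G') \<in> frames c" unfolding \<psi>_def using frame_push[OF d c h(1) yG(2,1)] by simp
      moreover have "((d, y', G'), (c, \<psi> (y', G'))) \<in> frame_rel \<A> g"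
        unfolding \<psi>_def using frame_rel_change[OF d c h(1) yG(2,1)] by simp
      ultimately have "frame_class d (y', G') = frame_class c (\<psi> (y', G'))" "\<psi> (y', G') \<in> U"
        using frame_class_eq_iff[OF d yG(1) c, of "\<psi> (y', G')"] yG(3) O'(2) by simp_all
      then show "v \<in> {z. (d, z) \<in> ?P}"
        using in_total[OF d yG(1)] v' by (auto simp: frame_class_def)
    qed
    ultimately show "\<exists>T. openin (top_of_set (frames d)) T \<and> w \<in> T \<and> T \<subseteq> {z. (d, z) \<in> ?P}" by blast
  qed
  then have "openin (sum_topology (chart_frames g) \<A>) ?P"
    unfolding openin_sum_topology by (auto simp: chart_frames_eq)
  moreover have "frame_class c ` U \<subseteq> (\<lambda>p. frame_rel \<A> g `` {p}) ` topspace (sum_topology (chart_frames g) \<A>)"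
    using in_total[OF c] O'(2) by (auto simp: frame_class_def)
  ultimately show "openin (frame_bundle \<A> g) (frame_class c ` U)"
    unfolding frame_bundle_def openin_quotient_topology by blast
qed

text \<open>The product of a quotient map with an identity need not be a quotient map. But the maps
  \<open>frame_class c\<close> are open, and openness survives products.\<close>

lemma continuous_map_chartwise:
  assumes "\<And>c. c \<in> \<A> \<Longrightarrow> continuous_map (prod_topology (top_of_set (frames c)) Z) Y (\<lambda>(w, z). f (frame_class c w, z))"
  shows "continuous_map (prod_topology (frame_bundle \<A> g) Z) Y f"
  unfolding continuous_map_def
proof (intro conjI allI impI)
  show "f \<in> topspace (prod_topology (frame_bundle \<A> g) Z) \<rightarrow> topspace Y"
  proof
    fix p assume "p \<in> topspace (prod_topology (frame_bundle \<A> g) Z)"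
    then obtain c w z where "c \<in> \<A>" "w \<in> frames c" "z \<in> topspace Z" "p = (frame_class c w, z)"
      by (auto simp: topspace_frame_bundle)
    then show "f p \<in> topspace Y" using assms[of c] by (force simp: continuous_map_def)
  qed
  fix U assume U: "openin Y U"
  let ?k = "\<lambda>c (w, z). (frame_class c w, z)"
  let ?N = "\<lambda>c. {p \<in> topspace (prod_topology (top_of_set (frames c)) Z). (case p of (w, z) \<Rightarrow> f (frame_class c w, z)) \<in> U}"
  have "openin (prod_topology (frame_bundle \<A> g) Z) (?k c ` ?N c)" if c: "c \<in> \<A>" for c
  proof -
    have "openin (prod_topology (top_of_set (frames c)) Z) (?N c)"
      by (rule openin_continuous_map_preimage[OF assms[OF c] U])
    then show ?thesis using open_map_prod_id[OF open_map_frame_class[OF c], of Z] unfolding open_map_def by blast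
  qed
  then have "openin (prod_topology (frame_bundle \<A> g) Z) (\<Union>c\<in>\<A>. ?k c ` ?N c)" by blast
  moreover have "(\<Union>c\<in>\<A>. ?k c ` ?N c) = {p \<in> topspace (prod_topology (frame_bundle \<A> g) Z). f p \<in> U}"
  proof (intro subset_antisym subsetI)
    fix p assume "p \<in> (\<Union>c\<in>\<A>. ?k c ` ?N c)"
    then show "p \<in> {p \<in> topspace (prod_topology (frame_bundle \<A> g) Z). f p \<in> U}"
      by (auto simp: topspace_frame_bundle)
  next
    fix p assume "p \<in> {p \<in> topspace (prod_topology (frame_bundle \<A> g) Z). f p \<in> U}"
    then obtain c w z where *: "c \<in> \<A>" "w \<in> frames c" "z \<in> topspace Z" "p = (frame_class c w, z)" "f p \<in> U"
      by (auto simp: topspace_frame_bundle)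
    then have "p \<in> ?k c ` ?N c" by (intro image_eqI[of _ _ "(w, z)"]) auto
    then show "p \<in> (\<Union>c\<in>\<A>. ?k c ` ?N c)" using *(1) by blast
  qed
  ultimately show "openin (prod_topology (frame_bundle \<A> g) Z) {p \<in> topspace (prod_topology (frame_bundle \<A> g) Z). f p \<in> U}"
    by simp
qed

abbreviation orth_top :: "(real^'n^'n) topology" where
  "orth_top \<equiv> top_of_set {Q. orthogonal_matrix Q}"

lemma frame_rel_rotate:
  assumes Q: "orthogonal_matrix Q" and r: "((c, x, F), (d, y, G)) \<in> frame_rel \<A> g"
  shows "((c, x, F ** transpose Q), (d, y, G ** transpose Q)) \<in> frame_rel \<A> g"
proof -
  obtain V W h where h: "chart_change c d V W h" "x \<in> V" "h x = y" "jacobian h (at x) ** F = G"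
    and c: "c \<in> \<A>" "d \<in> \<A>" "(x, F) \<in> frames c"
    using r by (auto simp: frame_rel_iff)
  show ?thesis
    using frame_rel_change[OF c(1,2) h(1,2) frame_rotate[OF c(3) Q]] h(3,4) by (simp add: matrix_mul_assoc)
qed

lemma frame_act_class:
  assumes Q: "orthogonal_matrix Q" and c: "c \<in> \<A>" "(x, F) \<in> frames c"
  shows "frame_act Q (frame_class c (x, F)) = frame_class c (x, F ** transpose Q)"
proof (intro subset_antisym subsetI)
  fix p assume "p \<in> frame_act Q (frame_class c (x, F))"
  then obtain d y G where "((c, x, F), (d, y, G)) \<in> frame_rel \<A> g" "p = (d, y, G ** transpose Q)"
    by (auto simp: frame_act_def frame_class_def)
  then show "p \<in> frame_class c (x, F ** transpose Q)"
    using frame_rel_rotate[OF Q] by (simp add: frame_class_def)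
next
  fix p assume p: "p \<in> frame_class c (x, F ** transpose Q)"
  obtain d y G where p': "p = (d, y, G)" by (cases p)
  have Q': "orthogonal_matrix (transpose Q)" using Q by simp
  have "((c, x, F ** transpose Q ** transpose (transpose Q)), (d, y, G ** transpose (transpose Q))) \<in> frame_rel \<A> g"
    using frame_rel_rotate[OF Q'] p p' by (simp add: frame_class_def)
  then have "((c, x, F), (d, y, G ** Q)) \<in> frame_rel \<A> g"
    using orthogonal_transpose[OF Q] by (simp flip: matrix_mul_assoc)
  moreover have "p = (d, y, (G ** Q) ** transpose Q)"
    using orthogonal_transpose[OF Q] p' by (simp flip: matrix_mul_assoc)
  ultimately show "p \<in> frame_act Q (frame_class c (x, F))"
    unfolding frame_act_def frame_class_def by force
qed

definition total :: "((('n, 'g, 'x) orbifold_chart \<times> (real^'n) \<times> (real^'n^'n)) set \<times> 'e) topology" where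
  "total = prod_topology (frame_bundle \<A> g) E"

definition total_act where
  "total_act Q p = (case p of (P, e) \<Rightarrow> (frame_act Q P, \<sigma> Q e))"

definition proj where
  "proj p = orbit orthogonal_group (\<lambda>Q (P, e). (frame_act Q P, \<sigma> Q e)) p"

abbreviation base where "base \<equiv> classifying_space \<A> g E \<sigma>"

lemma classifying_space_eq: "base = quotient_topology total proj"
  by (simp add: classifying_space_def total_def proj_def[abs_def])

lemma univ_props:
  shows "Hausdorff_space E" "contractible_space E" "topspace E \<noteq> {}"
    and "continuous_map (prod_topology orth_top E) E (\<lambda>(Q, e). \<sigma> Q e)"
    and "\<lbrakk>orthogonal_matrix Q; e \<in> topspace E; \<sigma> Q e = e\<rbrakk> \<Longrightarrow> Q = mat 1"
    and "\<lbrakk>orthogonal_matrix Q; e \<in> topspace E\<rbrakk> \<Longrightarrow> \<sigma> Q e \<in> topspace E"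
    and "e \<in> topspace E \<Longrightarrow> \<sigma> (mat 1) e = e"
    and "\<lbrakk>orthogonal_matrix Q; orthogonal_matrix R; e \<in> topspace E\<rbrakk> \<Longrightarrow> \<sigma> Q (\<sigma> R e) = \<sigma> (Q ** R) e"
proof -
  have ga: "group_action orthogonal_group (topspace E) \<sigma>"
    using univ unfolding universal_orthogonal_space_def by (elim conjE)
  interpret group_action orthogonal_group "topspace E" \<sigma> by (rule ga)
  have "CW_complex E" using univ unfolding universal_orthogonal_space_def by (elim conjE)
  then show "Hausdorff_space E" unfolding CW_complex_def by (elim conjE)
  show "contractible_space E" using univ unfolding universal_orthogonal_space_def by (elim conjE)
  show "topspace E \<noteq> {}" using univ unfolding universal_orthogonal_space_def by (elim conjE)
  show "continuous_map (prod_topology orth_top E) E (\<lambda>(Q, e). \<sigma> Q e)"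
    using univ unfolding universal_orthogonal_space_def by (elim conjE)
  have "\<forall>Q\<in>carrier orthogonal_group. \<forall>e\<in>topspace E. \<sigma> Q e = e \<longrightarrow> Q = mat 1"
    using univ unfolding universal_orthogonal_space_def by (elim conjE)
  then show "\<lbrakk>orthogonal_matrix Q; e \<in> topspace E; \<sigma> Q e = e\<rbrakk> \<Longrightarrow> Q = mat 1"
    by (auto simp: orthogonal_group_def)
  show "\<lbrakk>orthogonal_matrix Q; e \<in> topspace E\<rbrakk> \<Longrightarrow> \<sigma> Q e \<in> topspace E"
    using element_image[of Q e] by (simp add: orthogonal_group_def)
  show "e \<in> topspace E \<Longrightarrow> \<sigma> (mat 1) e = e"
    using id_eq_one by (simp add: orthogonal_group_def) (metis restrict_apply')
  show "\<lbrakk>orthogonal_matrix Q; orthogonal_matrix R; e \<in> topspace E\<rbrakk> \<Longrightarrow> \<sigma> Q (\<sigma> R e) = \<sigma> (Q ** R) e"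
    using composition_rule[of e Q R] by (simp add: orthogonal_group_def)
qed

lemma total_cases:
  assumes "p \<in> topspace total"
  obtains c x F e where "p = (frame_class c (x, F), e)" "c \<in> \<A>" "(x, F) \<in> frames c" "e \<in> topspace E"
  using assms by (auto simp: total_def topspace_frame_bundle)

lemma in_total_space: "\<lbrakk>c \<in> \<A>; z \<in> frames c; e \<in> topspace E\<rbrakk> \<Longrightarrow> (frame_class c z, e) \<in> topspace total"
  by (auto simp: total_def topspace_frame_bundle)

lemma total_act_class:
  assumes "orthogonal_matrix Q" "c \<in> \<A>" "(x, F) \<in> frames c"
  shows "total_act Q (frame_class c (x, F), e) = (frame_class c (x, F ** transpose Q), \<sigma> Q e)"
  using frame_act_class[OF assms] by (simp add: total_act_def)

lemma total_act_closed:
  assumes "orthogonal_matrix Q" "p \<in> topspace total"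
  shows "total_act Q p \<in> topspace total"
  using assms(2)
  by (rule total_cases)
    (use assms(1) in \<open>simp add: total_act_class in_total_space frame_rotate univ_props\<close>)

lemma total_act_one:
  assumes "p \<in> topspace total"
  shows "total_act (mat 1) p = p"
  using assms
  by (rule total_cases) (simp add: total_act_class orthogonal_matrix_id univ_props)

lemma total_act_mult:
  assumes "orthogonal_matrix Q" "orthogonal_matrix R" "p \<in> topspace total"
  shows "total_act Q (total_act R p) = total_act (Q ** R) p"
  using assms(3)
  by (rule total_cases)
    (use assms(1,2) in \<open>simp add: total_act_class frame_rotate univ_props orthogonal_matrix_mul matrix_transpose_mul matrix_mul_assoc\<close>)

lemma total_act_free:
  assumes "orthogonal_matrix Q" "p \<in> topspace total" "total_act Q p = p"
  shows "Q = mat 1"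
proof -
  have "\<sigma> Q (snd p) = snd p" using assms(3) by (cases p) (simp add: total_act_def)
  moreover have "snd p \<in> topspace E" using assms(2) by (auto simp: total_def)
  ultimately show ?thesis using univ_props(5) assms(1) by blast
qed

lemma proj_eq: "proj p = {total_act Q p | Q. orthogonal_matrix Q}"
  by (auto simp: proj_def orbit_def orthogonal_group_def total_act_def split: prod.splits)

lemma proj_eq_iff:
  assumes "p \<in> topspace total" "p' \<in> topspace total"
  shows "proj p = proj p' \<longleftrightarrow> (\<exists>Q. orthogonal_matrix Q \<and> total_act Q p = p')"
proof
  assume eq: "proj p = proj p'"
  have "\<exists>Q. p' = total_act Q p' \<and> orthogonal_matrix Q"
    using total_act_one[OF assms(2)] orthogonal_matrix_id by (intro exI[of _ "mat 1"]) simp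
  then have "p' \<in> proj p" unfolding eq unfolding proj_eq by simp
  then show "\<exists>Q. orthogonal_matrix Q \<and> total_act Q p = p'" unfolding proj_eq by blast
next
  have sub: "proj (total_act Q p) \<subseteq> proj p" if "orthogonal_matrix Q" "p \<in> topspace total" for p Q
  proof
    fix r assume "r \<in> proj (total_act Q p)"
    then obtain R where "orthogonal_matrix R" "r = total_act R (total_act Q p)" by (auto simp: proj_eq)
    then have "r = total_act (R ** Q) p" "orthogonal_matrix (R ** Q)"
      using total_act_mult[of R Q p] orthogonal_matrix_mul[of R Q] that by simp_all
    then show "r \<in> proj p" unfolding proj_eq by blast
  qed
  assume "\<exists>Q. orthogonal_matrix Q \<and> total_act Q p = p'"
  then obtain Q where Q: "orthogonal_matrix Q" "total_act Q p = p'" by blast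
  have Q': "orthogonal_matrix (transpose Q)" using Q by simp
  have "total_act (transpose Q) p' = p"
    unfolding Q(2)[symmetric] total_act_mult[OF Q' Q(1) assms(1)] orthogonal_transpose[OF Q(1)]
    by (rule total_act_one[OF assms(1)])
  then show "proj p = proj p'" using sub[OF Q(1) assms(1)] sub[OF Q' assms(2)] Q(2) by simp
qed

lemma continuous_map_total_act:
  "continuous_map (prod_topology orth_top total) total (\<lambda>(Q, p). total_act Q p)"
proof -
  have "continuous_map (prod_topology (frame_bundle \<A> g) orth_top) (frame_bundle \<A> g) (\<lambda>(P, Q). frame_act Q P)"
  proof (rule continuous_map_chartwise)
    fix c assume c: "c \<in> \<A>"
    have cont: "continuous_on (frames c \<times> {Q. orthogonal_matrix Q}) (\<lambda>p. (fst (fst p), snd (fst p) ** transpose (snd p)))"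
      by (intro continuous_intros)
    have im: "(fst (fst p), snd (fst p) ** transpose (snd p)) \<in> frames c" if "p \<in> frames c \<times> {Q. orthogonal_matrix Q}" for p
      using that frame_rotate[of "fst (fst p)" "snd (fst p)" c "snd p"] by auto
    have rot: "continuous_map (prod_topology (top_of_set (frames c)) orth_top) (top_of_set (frames c))
        (\<lambda>p. (fst (fst p), snd (fst p) ** transpose (snd p)))"
      unfolding prod_topology_subtopology_eu using cont im by (simp add: continuous_map_in_subtopology Pi_iff)
    show "continuous_map (prod_topology (top_of_set (frames c)) orth_top) (frame_bundle \<A> g)
        (\<lambda>(w, Q). case (frame_class c w, Q) of (P, Q) \<Rightarrow> frame_act Q P)"
      by (rule continuous_map_eq[OF continuous_map_compose[OF rot continuous_map_frame_class[OF c]]])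
        (auto simp: frame_act_class c)
  qed
  moreover have "continuous_map (prod_topology orth_top total) (prod_topology (frame_bundle \<A> g) orth_top) (\<lambda>p. (fst (snd p), fst p))"
    unfolding total_def
    by (intro continuous_map_pairedI continuous_map_fst_of continuous_map_snd_of continuous_map_fst continuous_map_snd
        continuous_map_compose[OF continuous_map_snd continuous_map_fst, unfolded o_def])
  ultimately have 1: "continuous_map (prod_topology orth_top total) (frame_bundle \<A> g) (\<lambda>p. frame_act (fst p) (fst (snd p)))"
    by (rule continuous_map_compose[rotated, THEN continuous_map_eq]) simp
  have "continuous_map (prod_topology orth_top total) (prod_topology orth_top E) (\<lambda>p. (fst p, snd (snd p)))"
    unfolding total_def
    by (intro continuous_map_pairedI continuous_map_fst
        continuous_map_compose[OF continuous_map_snd continuous_map_snd, unfolded o_def])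
  then have 2: "continuous_map (prod_topology orth_top total) E (\<lambda>p. \<sigma> (fst p) (snd (snd p)))"
    by (rule continuous_map_eq[OF continuous_map_compose[OF _ univ_props(4)]]) simp
  have "continuous_map (prod_topology orth_top total) total (\<lambda>p. (frame_act (fst p) (fst (snd p)), \<sigma> (fst p) (snd (snd p))))"
    unfolding total_def by (rule continuous_map_pairedI[OF 1[unfolded total_def] 2[unfolded total_def]])
  then show ?thesis by (rule continuous_map_eq) (auto simp: total_act_def split: prod.splits)
qed

end

section \<open>The translation function, and presentations of the classifying space over
  charts\<close>

lemma compact_orthogonal: "compact {Q :: real^'n^'n. orthogonal_matrix Q}"
proof -
  have "bounded {Q :: real^'n^'n. orthogonal_matrix Q}"
    unfolding bounded_iff
  proof (intro exI ballI)
    fix Q :: "real^'n^'n" assume "Q \<in> {Q. orthogonal_matrix Q}"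
    then have "norm (Q $ i) = 1" for i
      using orthogonal_matrix_orthonormal_rows[of Q] by (simp add: row_def)
    moreover have "norm Q \<le> (\<Sum>i\<in>UNIV. norm (Q $ i))"
      unfolding norm_vec_def by (rule L2_set_le_sum) simp
    ultimately show "norm Q \<le> real CARD('n)" by simp
  qed
  moreover have "closedin (top_of_set UNIV) {Q \<in> UNIV. transpose Q ** Q = (mat 1 :: real^'n^'n)}"
    by (rule continuous_closedin_preimage_constant) (intro continuous_intros)
  ultimately show ?thesis by (simp add: orthogonal_matrix compact_eq_bounded_closed)
qed

text \<open>Each map sends \<open>w\<close> to a point separated from it, so by continuity it moves
  a neighbourhood off itself; finitely many such neighbourhoods are intersected.\<close>

lemma displacing_neighbourhood:
  assumes Z: "Hausdorff_space Z" "w \<in> topspace Z" "finite I"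
    and f: "\<And>i. i \<in> I \<Longrightarrow> continuous_map Z Z (f i)" "\<And>i. i \<in> I \<Longrightarrow> f i w \<noteq> w"
  shows "\<exists>N. openin Z N \<and> w \<in> N \<and> (\<forall>i\<in>I. \<forall>v\<in>N. f i v \<notin> N)"
proof -
  have "\<forall>i\<in>I. \<exists>U. openin Z U \<and> w \<in> U \<and> (\<forall>v\<in>U. f i v \<notin> U)"
  proof
    fix i assume i: "i \<in> I"
    have "f i w \<in> topspace Z" using f(1)[OF i] Z(2) by (auto simp: continuous_map_def)
    then obtain U V where U: "openin Z U" "openin Z V" "w \<in> U" "f i w \<in> V" "disjnt U V"
      using Z(1,2) f(2)[OF i] unfolding Hausdorff_space_def by metis
    let ?U = "U \<inter> {v \<in> topspace Z. f i v \<in> V}"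
    have "openin Z ?U" using U(1) openin_continuous_map_preimage[OF f(1)[OF i] U(2)] by blast
    then show "\<exists>U. openin Z U \<and> w \<in> U \<and> (\<forall>v\<in>U. f i v \<notin> U)"
      using U Z(2) by (intro exI[of _ ?U]) (auto simp: disjnt_iff)
  qed
  then obtain U where U: "\<And>i. i \<in> I \<Longrightarrow> openin Z (U i)" "\<And>i. i \<in> I \<Longrightarrow> w \<in> U i" "\<And>i v. i \<in> I \<Longrightarrow> v \<in> U i \<Longrightarrow> f i v \<notin> U i"
    by metis
  have "openin Z ((\<Inter>i\<in>I. U i) \<inter> topspace Z)" by (rule openin_INT[OF Z(3) U(1)])
  then show ?thesis using U(2,3) Z(2) by (intro exI[of _ "(\<Inter>i\<in>I. U i) \<inter> topspace Z"]) blast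
qed

context orbifold_bundle
begin

lemma snd_total_act: "snd (total_act Q p) = \<sigma> Q (snd p)"
  by (simp add: total_act_def split: prod.split)

definition translation where
  "translation p p' = (THE Q. orthogonal_matrix Q \<and> total_act Q p = p')"

lemma translation_eq:
  assumes Q: "orthogonal_matrix Q" and p: "p \<in> topspace total"
  shows "translation p (total_act Q p) = Q"
  unfolding translation_def
proof (rule the_equality)
  fix R assume R: "orthogonal_matrix R \<and> total_act R p = total_act Q p"
  have Q': "orthogonal_matrix (transpose Q)" using Q by simp
  have "total_act (transpose Q ** R) p = total_act (transpose Q) (total_act R p)"
    using total_act_mult[OF Q' _ p, of R] R by simp
  also have "\<dots> = p"
    using R total_act_mult[OF Q' Q p] total_act_one[OF p] by (simp add: orthogonal_transpose[OF Q])
  finally have "transpose Q ** R = mat 1"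
    using total_act_free[of "transpose Q ** R" p] orthogonal_matrix_mul[OF Q'] R p by blast
  then have "Q ** (transpose Q ** R) = Q" by simp
  then show "R = Q" by (simp add: matrix_mul_assoc orthogonal_transpose[OF Q])
qed (use Q in simp)

lemma translation_props:
  assumes "p \<in> topspace total" "p' \<in> topspace total" "proj p = proj p'"
  shows "orthogonal_matrix (translation p p')" "total_act (translation p p') p = p'"
  using assms proj_eq_iff[of p p'] translation_eq[of _ p] by auto

text \<open>The translation is detected on the \<open>E\<close> components, where the action is free
  and the space Hausdorff: the pairs together with a matrix relating these components form a closed
  set. Projecting along the compact group preserves closedness.\<close>

lemma continuous_map_translation:
  "continuous_map (subtopology (prod_topology total total) {(p, p'). proj p = proj p'}) orth_top (\<lambda>(p, p'). translation p p')"
  (is "continuous_map ?S _ _")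
  unfolding continuous_map_closedin
proof (intro conjI allI impI)
  show "(\<lambda>(p, p'). translation p p') \<in> topspace ?S \<rightarrow> topspace orth_top"
    using translation_props(1) by auto
  fix C :: "(real^'n^'n) set" assume C: "closedin orth_top C"
  let ?Z = "prod_topology ?S orth_top"
  let ?T = "{z \<in> topspace ?Z. snd z \<in> C} \<inter> {z \<in> topspace ?Z. \<sigma> (snd z) (snd (fst (fst z))) = snd (snd (fst z))}"
  have pr: "continuous_map ?Z total (\<lambda>z. fst (fst z))" "continuous_map ?Z total (\<lambda>z. snd (fst z))"
    using continuous_map_compose[OF continuous_map_fst continuous_map_from_subtopology[OF continuous_map_fst]]
      continuous_map_compose[OF continuous_map_fst continuous_map_from_subtopology[OF continuous_map_snd]]
    by (auto simp: o_def)
  have sn: "continuous_map total E snd" unfolding total_def by (rule continuous_map_snd)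
  have c1: "continuous_map ?Z E (\<lambda>z. snd (fst (fst z)))" "continuous_map ?Z E (\<lambda>z. snd (snd (fst z)))"
    using continuous_map_compose[OF pr(1) sn] continuous_map_compose[OF pr(2) sn] by (simp_all add: o_def)
  have c2: "continuous_map ?Z E (\<lambda>z. \<sigma> (snd z) (snd (fst (fst z))))"
    by (rule continuous_map_eq[OF continuous_map_compose[OF continuous_map_pairedI[OF continuous_map_snd c1(1)] univ_props(4)]]) simp
  have "closedin ?Z {z \<in> topspace ?Z. \<sigma> (snd z) (snd (fst (fst z))) = snd (snd (fst z))}"
    by (rule closedin_continuous_maps_eq[OF univ_props(1) c2 c1(2)])
  moreover have "closedin ?Z {z \<in> topspace ?Z. snd z \<in> C}"
    by (rule closedin_continuous_map_preimage[OF continuous_map_snd C])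
  ultimately have "closedin ?Z ?T" by (rule closedin_Int[rotated])
  moreover have "closed_map ?Z ?S fst"
    by (rule Abstract_Topological_Spaces.closed_map_fst)
      (simp add: compact_space_subtopology compact_orthogonal)
  ultimately have "closedin ?S (fst ` ?T)" unfolding closed_map_def by blast
  moreover have "fst ` ?T = {x \<in> topspace ?S. (case x of (p, p') \<Rightarrow> translation p p') \<in> C}"
  proof (intro subset_antisym subsetI)
    fix x assume "x \<in> fst ` ?T"
    then obtain p p' Q where x: "x = (p, p')" and p: "p \<in> topspace total" "p' \<in> topspace total" "proj p = proj p'"
      and Q: "orthogonal_matrix Q" "Q \<in> C" "\<sigma> Q (snd p) = snd p'" by auto
    let ?R = "translation p p'"
    have R: "orthogonal_matrix ?R" "\<sigma> ?R (snd p) = snd p'"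
      using translation_props[OF p] snd_total_act[of ?R p] by simp_all
    have e: "snd p \<in> topspace E" using p(1) by (auto simp: total_def)
    have Q': "orthogonal_matrix (transpose Q)" using Q(1) by simp
    have "\<sigma> (transpose Q ** ?R) (snd p) = snd p"
      using univ_props(8)[OF Q' R(1) e] univ_props(8)[OF Q' Q(1) e] R(2) Q(3)
      by (simp add: orthogonal_transpose[OF Q(1)] univ_props(7)[OF e])
    then have "transpose Q ** ?R = mat 1"
      using univ_props(5)[OF orthogonal_matrix_mul[OF Q' R(1)] e] by blast
    then have "Q ** (transpose Q ** ?R) = Q" by simp
    then have "?R = Q" by (simp add: matrix_mul_assoc orthogonal_transpose[OF Q(1)])
    then show "x \<in> {x \<in> topspace ?S. (case x of (p, p') \<Rightarrow> translation p p') \<in> C}"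
      using x p Q(2) by simp
  next
    fix x assume "x \<in> {x \<in> topspace ?S. (case x of (p, p') \<Rightarrow> translation p p') \<in> C}"
    then obtain p p' where x: "x = (p, p')" and p: "p \<in> topspace total" "p' \<in> topspace total" "proj p = proj p'"
      and C: "translation p p' \<in> C" by auto
    have "\<sigma> (translation p p') (snd p) = snd p'"
      using translation_props(2)[OF p] snd_total_act[of "translation p p'" p] by simp
    then have "(x, translation p p') \<in> ?T" using x p C translation_props(1)[OF p] by simp
    then show "x \<in> fst ` ?T" by force
  qed
  ultimately show "closedin ?S {x \<in> topspace ?S. (case x of (p, p') \<Rightarrow> translation p p') \<in> C}" by simp
qed

definition sec :: "('n, 'g, 'x) orbifold_chart \<Rightarrow> real^'n \<Rightarrow> real^'n^'n" where
  "sec c = (SOME s. continuous_on (chart_dom c) s \<and> (\<forall>x\<in>chart_dom c. (x, s x) \<in> frames c))"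

lemma sec_props:
  assumes "c \<in> \<A>"
  shows "continuous_on (chart_dom c) (sec c)" "x \<in> chart_dom c \<Longrightarrow> (x, sec c x) \<in> frames c"
proof -
  have "\<exists>s. continuous_on (chart_dom c) s \<and> (\<forall>x\<in>chart_dom c. (x, s x) \<in> frames c)"
  proof (rule gram_schmidt[of "chart_dom c" "g c"])
    show "continuous_on (chart_dom c) (g c)" by (rule metric_props(1)[OF assms])
    show "transpose (g c x) = g c x" if "x \<in> chart_dom c" for x by (rule metric_props(2)[OF assms that])
    show "v \<bullet> (g c x *v v) > 0" if "x \<in> chart_dom c" "v \<noteq> 0" for x v by (rule metric_props(3)[OF assms that])
    show "\<exists>s. continuous_on (chart_dom c) s \<and> (\<forall>x\<in>chart_dom c. (x, s x) \<in> frames c)" if "continuous_on (chart_dom c) s" "\<And>x. x \<in> chart_dom c \<Longrightarrow> transpose (s x) ** g c x ** s x = mat 1"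
      for s :: "real^'n \<Rightarrow> real^'n^'n"
      using that by (intro exI[of _ s]) (simp add: frames_def)
  qed
  from someI_ex[OF this]
  show "continuous_on (chart_dom c) (sec c)" "x \<in> chart_dom c \<Longrightarrow> (x, sec c x) \<in> frames c"
    unfolding sec_def by blast+
qed

definition dom where "dom c = prod_topology (top_of_set (chart_dom c)) E"

text \<open>With the frame fixed to \<open>sec c\<close>, composing with \<open>proj\<close>
  presents the classifying space over the chart as the quotient of
  \<open>chart_dom c \<times> E\<close> by the chart group.\<close>

definition lift where "lift c = (\<lambda>(x, e). (frame_class c (x, sec c x), e))"

lemma topspace_dom: "topspace (dom c) = chart_dom c \<times> topspace E"
  by (simp add: dom_def)

lemma continuous_map_lift:
  assumes c: "c \<in> \<A>"
  shows "continuous_map (dom c) total (lift c)"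
proof -
  have "continuous_map (top_of_set (chart_dom c)) (top_of_set (frames c)) (\<lambda>x. (x, sec c x))"
    using sec_props[OF c] by (auto intro!: continuous_intros)
  from continuous_map_compose[OF continuous_map_compose[OF continuous_map_fst this] continuous_map_frame_class[OF c]]
  have "continuous_map (dom c) (frame_bundle \<A> g) (\<lambda>w. frame_class c (fst w, sec c (fst w)))"
    unfolding dom_def by (simp add: o_def)
  then have "continuous_map (dom c) total (\<lambda>w. (frame_class c (fst w, sec c (fst w)), snd w))"
    unfolding total_def dom_def by (intro continuous_map_pairedI continuous_map_snd)
  then show ?thesis by (simp add: lift_def case_prod_unfold)
qed

lemma lift_in_total: "\<lbrakk>c \<in> \<A>; x \<in> chart_dom c; e \<in> topspace E\<rbrakk> \<Longrightarrow> lift c (x, e) \<in> topspace total"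
  using in_total_space sec_props(2) by (simp add: lift_def)

text \<open>The matrix \<open>M\<close> compares the frame with \<open>sec c x\<close>; acting by it
  slides every point over the chart along its orbit into the image of \<open>lift c\<close>.\<close>

lemma total_act_to_lift:
  assumes c: "c \<in> \<A>" "(x, F) \<in> frames c"
  defines "M \<equiv> transpose (sec c x) ** g c x ** F"
  shows "orthogonal_matrix M" "total_act M (frame_class c (x, F), e) = lift c (x, \<sigma> M e)"
proof -
  have x: "x \<in> chart_dom c" using c by (simp add: frames_def)
  note s = sec_props(2)[OF c(1) x]
  show M: "orthogonal_matrix M" unfolding M_def by (rule frame_ratio_orthogonal[OF s c(2)])
  have "sec c x ** M = F" unfolding M_def
    using frame_inverse(2)[OF s] by (simp add: matrix_mul_assoc)
  then have "F ** transpose M = sec c x ** (M ** transpose M)" by (simp add: matrix_mul_assoc)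
  then have "F ** transpose M = sec c x" by (simp add: orthogonal_transpose[OF M])
  then show "total_act M (frame_class c (x, F), e) = lift c (x, \<sigma> M e)"
    using total_act_class[OF M c] by (simp add: lift_def)
qed

lemma continuous_map_action:
  assumes "continuous_map Z orth_top A" "continuous_map Z E f"
  shows "continuous_map Z E (\<lambda>z. \<sigma> (A z) (f z))"
  by (rule continuous_map_eq[OF continuous_map_compose[OF continuous_map_pairedI[OF assms] univ_props(4)]]) simp

lemma proj_total_act:
  assumes "orthogonal_matrix Q" "p \<in> topspace total"
  shows "proj (total_act Q p) = proj p"
  using proj_eq_iff[of p "total_act Q p"] total_act_closed[OF assms] assms by blast

text \<open>Sliding along orbits gives the continuous map \<open>k\<close> to \<open>dom c\<close>.
  The points over the image of \<open>W\<close> are then the image, under an open map, of the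
  preimage of \<open>W\<close> under \<open>k\<close>.\<close>

lemma open_map_proj_lift:
  assumes c: "c \<in> \<A>"
  shows "open_map (dom c) base (\<lambda>w. proj (lift c w))"
  unfolding open_map_def
proof (intro allI impI)
  fix W assume W: "openin (dom c) W"
  have WD: "W \<subseteq> chart_dom c \<times> topspace E" using openin_subset[OF W] by (simp add: topspace_dom)
  let ?Z = "prod_topology (top_of_set (frames c)) E"
  define M where "M w = transpose (sec c (fst w)) ** g c (fst w) ** snd w" for w :: "(real^'n) \<times> (real^'n^'n)"
  define k where "k z = (fst (fst z), \<sigma> (M (fst z)) (snd z))" for z :: "((real^'n) \<times> (real^'n^'n)) \<times> 'e"
  have fr: "fst w \<in> chart_dom c" if "w \<in> frames c" for w using that by (auto simp: frames_def)
  have cf: "continuous_on (frames c) fst" by (intro continuous_intros)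
  have "continuous_on (frames c) M" unfolding M_def
    by (intro continuous_intros continuous_on_compose2[OF sec_props(1)[OF c] cf] continuous_on_compose2[OF metric_props(1)[OF c] cf])
      (use fr in auto)
  moreover have "orthogonal_matrix (M w)" if "w \<in> frames c" for w
    unfolding M_def using total_act_to_lift(1)[OF c, of "fst w" "snd w"] that by simp
  ultimately have Mc: "continuous_map (top_of_set (frames c)) orth_top M" by auto
  have "continuous_map (top_of_set (frames c)) (top_of_set (chart_dom c)) fst" using cf fr by auto
  from continuous_map_compose[OF continuous_map_fst this]
  have k1: "continuous_map ?Z (top_of_set (chart_dom c)) (\<lambda>z. fst (fst z))" by (simp add: o_def)
  have k2: "continuous_map ?Z E (\<lambda>z. \<sigma> (M (fst z)) (snd z))"
    by (rule continuous_map_action[OF _ continuous_map_snd])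
      (use continuous_map_compose[OF continuous_map_fst Mc] in \<open>simp add: o_def\<close>)
  have "continuous_map ?Z (dom c) k"
    unfolding dom_def k_def by (rule continuous_map_pairedI[OF k1 k2])
  then have "openin ?Z {z \<in> topspace ?Z. k z \<in> W}" using W by (rule openin_continuous_map_preimage)
  then have op: "openin total ((\<lambda>(w, e). (frame_class c w, e)) ` {z \<in> topspace ?Z. k z \<in> W})"
    using open_map_prod_id[OF open_map_frame_class[OF c], of E] unfolding open_map_def total_def by blast
  have "(\<lambda>(w, e). (frame_class c w, e)) ` {z \<in> topspace ?Z. k z \<in> W} =
      {p \<in> topspace total. proj p \<in> (\<lambda>w. proj (lift c w)) ` W}" (is "?L = ?R")
  proof (intro subset_antisym subsetI)
    fix p assume "p \<in> ?L"
    then obtain x F e where p: "p = (frame_class c (x, F), e)" "(x, F) \<in> frames c" "e \<in> topspace E" "k ((x, F), e) \<in> W"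
      by auto
    have pt: "p \<in> topspace total" using in_total_space c p by simp
    have "proj p = proj (total_act (M (x, F)) p)"
      using proj_total_act[OF _ pt] total_act_to_lift(1)[OF c p(2)] by (simp add: M_def)
    also have "\<dots> = proj (lift c (k ((x, F), e)))"
      using total_act_to_lift(2)[OF c p(2)] p(1) by (simp add: M_def k_def)
    finally show "p \<in> ?R" using p(4) pt by blast
  next
    fix p assume "p \<in> ?R"
    then obtain x e where p: "p \<in> topspace total" "(x, e) \<in> W" "proj p = proj (lift c (x, e))" by auto
    have xe: "x \<in> chart_dom c" "e \<in> topspace E" using p(2) WD by auto
    note s = sec_props(2)[OF c xe(1)]
    obtain Q where Q: "orthogonal_matrix Q" "total_act Q (lift c (x, e)) = p"
      using proj_eq_iff[OF lift_in_total[OF c xe] p(1)] p(3) by auto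
    have Q': "orthogonal_matrix (transpose Q)" using Q(1) by simp
    let ?z = "((x, sec c x ** transpose Q), \<sigma> Q e)"
    have fz: "(x, sec c x ** transpose Q) \<in> frames c" by (rule frame_rotate[OF s Q(1)])
    have "M (x, sec c x ** transpose Q) = transpose Q"
      unfolding M_def using frame_inverse(1)[OF s] by (simp add: matrix_mul_assoc)
    then have "k ?z = (x, e)"
      unfolding k_def using univ_props(8)[OF Q' Q(1) xe(2)] univ_props(7)[OF xe(2)] by (simp add: orthogonal_transpose[OF Q(1)])
    moreover have "p = (frame_class c (fst ?z), snd ?z)"
      using Q(2) total_act_class[OF Q(1) c s] by (simp add: lift_def)
    moreover have "?z \<in> topspace ?Z" using fz univ_props(6)[OF Q(1) xe(2)] by simp
    ultimately show "p \<in> ?L" using p(2) by (intro image_eqI[of _ _ ?z]) simp_all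
  qed
  moreover have "(\<lambda>w. proj (lift c w)) ` W \<subseteq> proj ` topspace total"
    using WD lift_in_total[OF c] by fastforce
  ultimately show "openin base ((\<lambda>w. proj (lift c w)) ` W)"
    unfolding classifying_space_eq openin_quotient_topology using op by simp
qed

end

section \<open>The free action of the chart group on chart times \<open>E\<close>, and local
  sections\<close>

context orbifold_bundle
begin

text \<open>The matrix of the derivative of \<open>\<gamma>\<close> in the frames \<open>sec c\<close>.\<close>

definition holonomy where
  "holonomy c \<gamma> z = transpose (sec c (chart_act c \<gamma> z)) ** g c (chart_act c \<gamma> z) ** jacobian (chart_act c \<gamma>) (at z) ** sec c z"

text \<open>The fibres of \<open>proj \<circ> lift c\<close> are the orbits of these maps, see \<open>proj_lift_eq\<close>.\<close>

definition deck where
  "deck c \<gamma> = (\<lambda>(z, e). (chart_act c \<gamma> z, \<sigma> (holonomy c \<gamma> z) e))"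

lemma pushed_frame:
  assumes c: "c \<in> \<A>" and \<gamma>: "\<gamma> \<in> carrier (chart_group c)" and z: "z \<in> chart_dom c"
  shows "(chart_act c \<gamma> z, jacobian (chart_act c \<gamma>) (at z) ** sec c z) \<in> frames c"
  using frame_push[OF c c chart_change_act[OF chart[OF c] \<gamma>] z sec_props(2)[OF c z]] .

lemma holonomy_props:
  assumes c: "c \<in> \<A>" and \<gamma>: "\<gamma> \<in> carrier (chart_group c)" and z: "z \<in> chart_dom c"
  shows "orthogonal_matrix (holonomy c \<gamma> z)"
    and "sec c (chart_act c \<gamma> z) ** holonomy c \<gamma> z = jacobian (chart_act c \<gamma>) (at z) ** sec c z"
proof -
  have z': "chart_act c \<gamma> z \<in> chart_dom c" by (rule chart_props(5)[OF chart[OF c] \<gamma> z])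
  note s = sec_props(2)[OF c z']
  show "orthogonal_matrix (holonomy c \<gamma> z)"
    unfolding holonomy_def using frame_ratio_orthogonal[OF s pushed_frame[OF assms]] by (simp add: matrix_mul_assoc)
  have "sec c (chart_act c \<gamma> z) ** holonomy c \<gamma> z =
      (sec c (chart_act c \<gamma> z) ** (transpose (sec c (chart_act c \<gamma> z)) ** g c (chart_act c \<gamma> z))) **
      (jacobian (chart_act c \<gamma>) (at z) ** sec c z)"
    by (simp only: holonomy_def matrix_mul_assoc)
  then show "sec c (chart_act c \<gamma> z) ** holonomy c \<gamma> z = jacobian (chart_act c \<gamma>) (at z) ** sec c z"
    by (simp only: frame_inverse(2)[OF s] matrix_mul_lid)
qed

lemma sec_cancel:
  assumes "c \<in> \<A>" "z \<in> chart_dom c" "sec c z ** A = sec c z ** B"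
  shows "A = B"
proof -
  note s = frame_inverse(1)[OF sec_props(2)[OF assms(1,2)]]
  have "(transpose (sec c z) ** g c z) ** (sec c z ** A) = (transpose (sec c z) ** g c z) ** (sec c z ** B)"
    by (simp only: assms(3))
  then have "((transpose (sec c z) ** g c z) ** sec c z) ** A = ((transpose (sec c z) ** g c z) ** sec c z) ** B"
    by (simp only: matrix_mul_assoc)
  then show ?thesis by (simp only: s matrix_mul_lid)
qed

lemma holonomy_unique:
  assumes c: "c \<in> \<A>" and \<gamma>: "\<gamma> \<in> carrier (chart_group c)" and z: "z \<in> chart_dom c"
    and A: "sec c (chart_act c \<gamma> z) ** A = jacobian (chart_act c \<gamma>) (at z) ** sec c z"
  shows "holonomy c \<gamma> z = A"
  by (rule sec_cancel[OF c chart_props(5)[OF chart[OF c] \<gamma> z]]) (simp only: holonomy_props[OF c \<gamma> z] A)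

lemma holonomy_one:
  assumes c: "c \<in> \<A>" and z: "z \<in> chart_dom c"
  shows "holonomy c \<one>\<^bsub>chart_group c\<^esub> z = mat 1"
proof -
  note ch = chart[OF c]
  have e: "\<one>\<^bsub>chart_group c\<^esub> \<in> carrier (chart_group c)" using chart_group[OF ch] by (simp add: group.is_monoid monoid.one_closed)
  have "jacobian (chart_act c \<one>\<^bsub>chart_group c\<^esub>) (at z) = mat 1"
    by (rule jacobian_identity[OF chart_props(1)[OF ch] z chart_props(6)[OF ch]])
  then show ?thesis
    by (intro holonomy_unique[OF c e z]) (simp add: chart_props(6)[OF ch z])
qed

text \<open>The chain rule, read in the frames \<open>sec c\<close>: holonomy is a cocycle.\<close>

lemma holonomy_mult:
  assumes c: "c \<in> \<A>" and \<gamma>: "\<gamma> \<in> carrier (chart_group c)" and \<delta>: "\<delta> \<in> carrier (chart_group c)" and z: "z \<in> chart_dom c"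
  shows "holonomy c (\<gamma> \<otimes>\<^bsub>chart_group c\<^esub> \<delta>) z = holonomy c \<gamma> (chart_act c \<delta> z) ** holonomy c \<delta> z"
proof (rule holonomy_unique[OF c _ z])
  note ch = chart[OF c]
  interpret group "chart_group c" by (rule chart_group[OF ch])
  show \<gamma>\<delta>: "\<gamma> \<otimes>\<^bsub>chart_group c\<^esub> \<delta> \<in> carrier (chart_group c)" using \<gamma> \<delta> by simp
  have comp: "chart_act c (\<gamma> \<otimes>\<^bsub>chart_group c\<^esub> \<delta>) y = chart_act c \<gamma> (chart_act c \<delta> y)" if "y \<in> chart_dom c" for y
    by (rule group_action.composition_rule[OF chart_action[OF ch] that \<gamma> \<delta>])
  have z': "chart_act c \<delta> z \<in> chart_dom c" by (rule chart_props(5)[OF ch \<delta> z])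
  have "jacobian (chart_act c (\<gamma> \<otimes>\<^bsub>chart_group c\<^esub> \<delta>)) (at z) = jacobian (\<lambda>y. chart_act c \<gamma> (chart_act c \<delta> y)) (at z)"
    by (rule jacobian_cong[OF chart_props(1)[OF ch] z comp chart_props(4)[OF ch \<gamma>\<delta>]])
  also have "\<dots> = jacobian (chart_act c \<gamma>) (at (chart_act c \<delta> z)) ** jacobian (chart_act c \<delta>) (at z)"
    by (rule jacobian_compose[OF chart_props(4)[OF ch \<delta>] z chart_props(4)[OF ch \<gamma>] z'])
  finally have J: "jacobian (chart_act c (\<gamma> \<otimes>\<^bsub>chart_group c\<^esub> \<delta>)) (at z) ** sec c z =
      jacobian (chart_act c \<gamma>) (at (chart_act c \<delta> z)) ** (jacobian (chart_act c \<delta>) (at z) ** sec c z)"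
    by (simp only: matrix_mul_assoc)
  show "sec c (chart_act c (\<gamma> \<otimes>\<^bsub>chart_group c\<^esub> \<delta>) z) ** (holonomy c \<gamma> (chart_act c \<delta> z) ** holonomy c \<delta> z) =
      jacobian (chart_act c (\<gamma> \<otimes>\<^bsub>chart_group c\<^esub> \<delta>)) (at z) ** sec c z"
    unfolding J holonomy_props(2)[OF c \<delta> z, symmetric] comp[OF z]
    by (simp only: matrix_mul_assoc holonomy_props(2)[OF c \<gamma> z'])
qed

lemma continuous_on_holonomy:
  assumes c: "c \<in> \<A>" and \<gamma>: "\<gamma> \<in> carrier (chart_group c)"
  shows "continuous_on (chart_dom c) (holonomy c \<gamma>)"
proof -
  note ch = chart[OF c]
  have a: "continuous_on (chart_dom c) (chart_act c \<gamma>)" by (rule smooth_on_continuous[OF chart_props(4)[OF ch \<gamma>]])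
  note im = chart_props(7)[OF ch \<gamma>]
  show ?thesis unfolding holonomy_def[abs_def]
    by (intro continuous_on_matrix_mult continuous_on_transpose
        continuous_on_compose2[OF sec_props(1)[OF c] a im] continuous_on_compose2[OF metric_props(1)[OF c] a im]
        smooth_on_continuous_jacobian[OF chart_props(4)[OF ch \<gamma>]] sec_props(1)[OF c])
qed

lemma continuous_map_deck:
  assumes c: "c \<in> \<A>" and \<gamma>: "\<gamma> \<in> carrier (chart_group c)"
  shows "continuous_map (dom c) (dom c) (deck c \<gamma>)"
proof -
  note ch = chart[OF c]
  have "continuous_map (top_of_set (chart_dom c)) (top_of_set (chart_dom c)) (chart_act c \<gamma>)"
    using smooth_on_continuous[OF chart_props(4)[OF ch \<gamma>]] chart_props(7)[OF ch \<gamma>] by auto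
  from continuous_map_compose[OF continuous_map_fst this]
  have 1: "continuous_map (dom c) (top_of_set (chart_dom c)) (\<lambda>w. chart_act c \<gamma> (fst w))" by (simp add: dom_def o_def)
  have "continuous_map (top_of_set (chart_dom c)) orth_top (holonomy c \<gamma>)"
    using continuous_on_holonomy[OF c \<gamma>] holonomy_props(1)[OF c \<gamma>] by auto
  from continuous_map_compose[OF continuous_map_fst this]
  have "continuous_map (dom c) orth_top (\<lambda>w. holonomy c \<gamma> (fst w))" by (simp add: dom_def o_def)
  then have 2: "continuous_map (dom c) E (\<lambda>w. \<sigma> (holonomy c \<gamma> (fst w)) (snd w))"
    by (rule continuous_map_action) (simp add: dom_def continuous_map_snd)
  show ?thesis using continuous_map_pairedI[OF 1 2] by (simp add: dom_def deck_def case_prod_unfold)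
qed

text \<open>An element of the chart group is a change of charts, so a frame and its push-forward are
  the same point of the frame bundle. Rotating the frame by the holonomy therefore amounts to moving
  its base point.\<close>

lemma total_act_holonomy:
  assumes c: "c \<in> \<A>" and \<gamma>: "\<gamma> \<in> carrier (chart_group c)" and z: "z \<in> chart_dom c"
  shows "total_act (holonomy c \<gamma> z) (lift c (z, e)) = lift c (deck c \<gamma> (z, e))"
proof -
  let ?A = "holonomy c \<gamma> z" and ?J = "jacobian (chart_act c \<gamma>) (at z)"
  note A = holonomy_props(1)[OF c \<gamma> z]
  have f: "(z, sec c z ** transpose ?A) \<in> frames c" by (rule frame_rotate[OF sec_props(2)[OF c z] A])
  have z': "chart_act c \<gamma> z \<in> chart_dom c" by (rule chart_props(5)[OF chart[OF c] \<gamma> z])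
  have "?J ** (sec c z ** transpose ?A) = sec c (chart_act c \<gamma> z) ** (?A ** transpose ?A)"
    by (simp only: matrix_mul_assoc holonomy_props(2)[OF c \<gamma> z])
  then have "?J ** (sec c z ** transpose ?A) = sec c (chart_act c \<gamma> z)"
    by (simp only: orthogonal_transpose[OF A] matrix_mul_rid)
  then have "frame_class c (z, sec c z ** transpose ?A) = frame_class c (chart_act c \<gamma> z, sec c (chart_act c \<gamma> z))"
    using frame_class_eq_iff[OF c f c sec_props(2)[OF c z']]
      frame_rel_change[OF c c chart_change_act[OF chart[OF c] \<gamma>] z f] by simp
  then show ?thesis
    by (simp add: lift_def deck_def total_act_class[OF A c sec_props(2)[OF c z]])
qed

text \<open>At a fixed point the holonomy is the derivative conjugated by the invertible matrix
  \<open>sec c z\<close>; if it is trivial, so is the derivative.\<close>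

lemma holonomy_trivial:
  assumes c: "c \<in> \<A>" and \<gamma>: "\<gamma> \<in> carrier (chart_group c)" and z: "z \<in> chart_dom c"
    and fixed: "chart_act c \<gamma> z = z" "holonomy c \<gamma> z = mat 1"
  shows "\<gamma> = \<one>\<^bsub>chart_group c\<^esub>"
proof (rule isotropy_faithful[OF chart[OF c] \<gamma> z fixed(1)])
  let ?J = "jacobian (chart_act c \<gamma>) (at z)" and ?s = "sec c z"
  note s = frame_inverse(2)[OF sec_props(2)[OF c z]]
  have "?J ** ?s = ?s" using holonomy_props(2)[OF c \<gamma> z] fixed by simp
  then have "(?J ** ?s) ** (transpose ?s ** g c z) = ?s ** (transpose ?s ** g c z)" by (simp only:)
  then have "?J ** (?s ** (transpose ?s ** g c z)) = ?s ** (transpose ?s ** g c z)" by (simp only: matrix_mul_assoc)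
  then show "?J = mat 1" by (simp only: s matrix_mul_rid)
qed

text \<open>Freeness of the action on \<open>E\<close> forces the holonomy at a fixed point to be
  trivial.\<close>

lemma deck_fixed:
  assumes c: "c \<in> \<A>" and \<gamma>: "\<gamma> \<in> carrier (chart_group c)" and w: "w \<in> topspace (dom c)" and fixed: "deck c \<gamma> w = w"
  shows "\<gamma> = \<one>\<^bsub>chart_group c\<^esub>"
proof -
  obtain z e where we: "w = (z, e)" "z \<in> chart_dom c" "e \<in> topspace E" using w by (auto simp: topspace_dom)
  have "chart_act c \<gamma> z = z" "\<sigma> (holonomy c \<gamma> z) e = e" using fixed we(1) by (simp_all add: deck_def)
  then show ?thesis
    using holonomy_trivial[OF c \<gamma> we(2)] univ_props(5)[OF holonomy_props(1)[OF c \<gamma> we(2)] we(3)] by blast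
qed

lemma proj_lift_eq:
  assumes c: "c \<in> \<A>" and w: "w \<in> topspace (dom c)" "w' \<in> topspace (dom c)" and eq: "proj (lift c w) = proj (lift c w')"
  shows "\<exists>\<gamma>\<in>carrier (chart_group c). w' = deck c \<gamma> w"
proof -
  obtain z e z' e' where we: "w = (z, e)" "z \<in> chart_dom c" "e \<in> topspace E" "w' = (z', e')" "z' \<in> chart_dom c" "e' \<in> topspace E"
    using w by (auto simp: topspace_dom)
  note s = sec_props(2)[OF c we(2)] and s' = sec_props(2)[OF c we(5)]
  obtain Q where Q: "orthogonal_matrix Q" "total_act Q (lift c w) = lift c w'"
    using proj_eq_iff[of "lift c w" "lift c w'"] lift_in_total[OF c] we eq by auto
  have f: "(z, sec c z ** transpose Q) \<in> frames c" by (rule frame_rotate[OF s Q(1)])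
  have "frame_class c (z, sec c z ** transpose Q) = frame_class c (z', sec c z')" and e': "\<sigma> Q e = e'"
    using Q(2) total_act_class[OF Q(1) c s, of e] we by (simp_all add: lift_def)
  then have "((c, z, sec c z ** transpose Q), (c, z', sec c z')) \<in> frame_rel \<A> g"
    using frame_class_eq_iff[OF c f c s'] by simp
  then obtain V W h where h: "chart_change c c V W h" "z \<in> V" "h z = z'"
    "jacobian h (at z) ** (sec c z ** transpose Q) = sec c z'"
    by (auto simp: frame_rel_iff)
  \<comment> \<open>The gluing yields only some change of charts. To first order at \<open>z\<close>
    it agrees with a group element, and frames see nothing beyond first order.\<close>
  obtain \<gamma> where \<gamma>: "\<gamma> \<in> carrier (chart_group c)" "h z = chart_act c \<gamma> z" "jacobian h (at z) = jacobian (chart_act c \<gamma>) (at z)"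
    using chart_change_self[OF chart[OF c] h(1,2)] by blast
  have "sec c z' ** Q = jacobian h (at z) ** sec c z ** (transpose Q ** Q)"
    unfolding h(4)[symmetric] by (simp only: matrix_mul_assoc)
  then have "sec c (chart_act c \<gamma> z) ** Q = jacobian (chart_act c \<gamma>) (at z) ** sec c z"
    using \<gamma> h(3) by (simp add: orthogonal_transpose[OF Q(1)])
  then have "holonomy c \<gamma> z = Q" by (rule holonomy_unique[OF c \<gamma>(1) we(2)])
  then have "w' = deck c \<gamma> w" using we \<gamma>(2) h(3) e' by (simp add: deck_def)
  then show ?thesis using \<gamma>(1) by blast
qed

lemma continuous_map_proj: "continuous_map total base proj"
  unfolding classifying_space_eq by (rule quotient_imp_continuous_map[OF quotient_map_quotient_topology])

lemma Hausdorff_space_dom: "Hausdorff_space (dom c)"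
  unfolding dom_def Hausdorff_space_prod_topology using univ_props(1) by (simp add: Hausdorff_space_subtopology)

text \<open>The fibres are orbits of a finite group acting freely on a Hausdorff space.\<close>

lemma proj_lift_locally_injective:
  assumes c: "c \<in> \<A>" and w: "w \<in> topspace (dom c)"
  shows "\<exists>N. openin (dom c) N \<and> w \<in> N \<and> inj_on (\<lambda>w. proj (lift c w)) N"
proof -
  let ?I = "carrier (chart_group c) - {\<one>\<^bsub>chart_group c\<^esub>}"
  have fin: "finite ?I" using chart_props(3)[OF chart[OF c]] by simp
  have ne: "deck c \<gamma> w \<noteq> w" if "\<gamma> \<in> ?I" for \<gamma> using deck_fixed[OF c _ w] that by blast
  have ct: "continuous_map (dom c) (dom c) (deck c \<gamma>)" if "\<gamma> \<in> ?I" for \<gamma> using continuous_map_deck[OF c] that by blast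
  obtain N where N: "openin (dom c) N" "w \<in> N" "\<forall>\<gamma>\<in>?I. \<forall>v\<in>N. deck c \<gamma> v \<notin> N"
    using displacing_neighbourhood[where f = "deck c", OF Hausdorff_space_dom w fin ct ne] by blast
  have "inj_on (\<lambda>w. proj (lift c w)) N"
  proof (rule inj_onI)
    fix v v' assume v: "v \<in> N" "v' \<in> N" "proj (lift c v) = proj (lift c v')"
    have vt: "v \<in> topspace (dom c)" "v' \<in> topspace (dom c)" using v openin_subset[OF N(1)] by auto
    obtain \<gamma> where \<gamma>: "\<gamma> \<in> carrier (chart_group c)" "v' = deck c \<gamma> v" using proj_lift_eq[OF c vt v(3)] by blast
    then have "\<gamma> = \<one>\<^bsub>chart_group c\<^esub>" using N(3) v by blast
    moreover obtain z e where "v = (z, e)" "z \<in> chart_dom c" "e \<in> topspace E" using vt(1) by (auto simp: topspace_dom)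
    ultimately show "v = v'"
      using \<gamma>(2) chart_props(6)[OF chart[OF c]] holonomy_one[OF c] univ_props(7) by (simp add: deck_def)
  qed
  then show ?thesis using N by blast
qed

text \<open>The map \<open>proj \<circ> lift c\<close> is open and locally injective; its local
  inverse followed by \<open>lift c\<close> is a section.\<close>

lemma local_section:
  assumes "y \<in> topspace base"
  shows "\<exists>U s. openin base U \<and> y \<in> U \<and> continuous_map (subtopology base U) total s \<and> (\<forall>z\<in>U. proj (s z) = z)"
proof -
  obtain p where "p \<in> topspace total" and y: "y = proj p" using assms by (auto simp: classifying_space_eq)
  then obtain c x F e where p: "p = (frame_class c (x, F), e)" "c \<in> \<A>" "(x, F) \<in> frames c" "e \<in> topspace E"
    using total_cases by blast
  note c = p(2)
  define M where "M = transpose (sec c x) ** g c x ** F"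
  note M = total_act_to_lift[OF c p(3), folded M_def]
  define w where "w = (x, \<sigma> M e)"
  have w: "w \<in> topspace (dom c)"
    using p(3) univ_props(6)[OF M(1) p(4)] by (simp add: topspace_dom w_def frames_def)
  have yw: "y = proj (lift c w)"
    using proj_total_act[OF M(1) \<open>p \<in> topspace total\<close>] M(2) p(1) y by (simp add: w_def)
  let ?\<pi> = "\<lambda>w. proj (lift c w)"
  obtain N where N: "openin (dom c) N" "w \<in> N" "inj_on ?\<pi> N"
    using proj_lift_locally_injective[OF c w] by blast
  have op: "openin base (?\<pi> ` O')" if "openin (dom c) O'" for O'
    using open_map_proj_lift[OF c] that unfolding open_map_def by blast
  let ?U = "?\<pi> ` N" and ?k = "inv_into N ?\<pi>"
  have NU: "?U \<subseteq> topspace base" using openin_subset[OF op[OF N(1)]] .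
  have "continuous_map (subtopology base ?U) (dom c) ?k"
    unfolding continuous_map_def
  proof (intro conjI allI impI)
    show "?k \<in> topspace (subtopology base ?U) \<rightarrow> topspace (dom c)"
      using openin_subset[OF N(1)] inv_into_into[of _ ?\<pi> N] by fastforce
    fix O' assume O': "openin (dom c) O'"
    have "{u \<in> topspace (subtopology base ?U). ?k u \<in> O'} = ?\<pi> ` (N \<inter> O')"
    proof (intro subset_antisym subsetI)
      fix u assume "u \<in> {u \<in> topspace (subtopology base ?U). ?k u \<in> O'}"
      then obtain v where v: "v \<in> N" "u = ?\<pi> v" "?k u \<in> O'" by auto
      then have "v \<in> N \<inter> O'" using inv_into_f_f[OF N(3) v(1)] by simp
      then show "u \<in> ?\<pi> ` (N \<inter> O')" using v(2) by blast
    next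
      fix u assume "u \<in> ?\<pi> ` (N \<inter> O')"
      then obtain v where v: "v \<in> N" "v \<in> O'" "u = ?\<pi> v" by blast
      have "u \<in> ?U" using v by blast
      then show "u \<in> {u \<in> topspace (subtopology base ?U). ?k u \<in> O'}"
        using inv_into_f_f[OF N(3) v(1)] v NU by auto
    qed
    then show "openin (subtopology base ?U) {u \<in> topspace (subtopology base ?U). ?k u \<in> O'}"
      using op[OF openin_Int[OF N(1) O']] by (simp only: openin_open_subtopology[OF op[OF N(1)]]) blast
  qed
  from continuous_map_compose[OF this continuous_map_lift[OF c]]
  have "continuous_map (subtopology base ?U) total (lift c \<circ> ?k)" .
  moreover have "\<forall>u\<in>?U. proj ((lift c \<circ> ?k) u) = u" using f_inv_into_f[of _ ?\<pi> N] by simp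
  ultimately show ?thesis using op[OF N(1)] N(2) yw by (intro exI[of _ ?U] exI[of _ "lift c \<circ> ?k"]) blast
qed

sublocale principal_bundle total base proj orth_top total_act translation
proof
  show "continuous_map total base proj" by (rule continuous_map_proj)
  show "continuous_map (prod_topology orth_top total) total (\<lambda>(Q, p). total_act Q p)" by (rule continuous_map_total_act)
  show "proj (total_act Q p) = proj p" if "Q \<in> topspace orth_top" "p \<in> topspace total" for Q p
    using proj_total_act that by simp
  show "continuous_map (subtopology (prod_topology total total) {(p, p'). proj p = proj p'}) orth_top (\<lambda>(p, p'). translation p p')"
    by (rule continuous_map_translation)
  show "total_act (translation p p') p = p'" if "p \<in> topspace total" "p' \<in> topspace total" "proj p = proj p'" for p p'
    by (rule translation_props(2)[OF that])
  show "\<exists>U s. openin base U \<and> y \<in> U \<and> continuous_map (subtopology base U) total s \<and> (\<forall>z\<in>U. proj (s z) = z)"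
    if "y \<in> topspace base" for y by (rule local_section[OF that])
qed

lemma compactin_fibre:
  assumes "p \<in> topspace total"
  shows "compactin total {p' \<in> topspace total. proj p' = proj p}"
proof -
  have "continuous_map orth_top (prod_topology orth_top total) (\<lambda>Q. (Q, p))"
    using assms by (intro continuous_map_pairedI) auto
  from continuous_map_compose[OF this continuous_map_total_act]
  have "continuous_map orth_top total (\<lambda>Q. total_act Q p)" by (simp add: o_def)
  moreover have "compactin orth_top {Q. orthogonal_matrix Q}" by (simp add: compact_orthogonal)
  ultimately have "compactin total ((\<lambda>Q. total_act Q p) ` {Q. orthogonal_matrix Q})" by (rule image_compactin[rotated])
  moreover have "(\<lambda>Q. total_act Q p) ` {Q. orthogonal_matrix Q} = {p' \<in> topspace total. proj p' = proj p}"
  proof (intro subset_antisym subsetI)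
    fix p' assume "p' \<in> (\<lambda>Q. total_act Q p) ` {Q. orthogonal_matrix Q}"
    then show "p' \<in> {p' \<in> topspace total. proj p' = proj p}"
      using total_act_closed[OF _ assms] proj_total_act[OF _ assms] by auto
  next
    fix p' assume p': "p' \<in> {p' \<in> topspace total. proj p' = proj p}"
    then have "proj p = proj p'" "p' \<in> topspace total" by simp_all
    then show "p' \<in> (\<lambda>Q. total_act Q p) ` {Q. orthogonal_matrix Q}"
      using proj_eq_iff[OF assms, of p'] by blast
  qed
  ultimately show ?thesis by simp
qed

lemma isotropy_trivial:
  assumes contr: "contractible_orbifold \<A> g E \<sigma>"
    and c: "c \<in> \<A>" and x: "x \<in> chart_dom c" and \<gamma>: "\<gamma> \<in> carrier (chart_group c)" and fixed: "chart_act c \<gamma> x = x"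
  shows "\<gamma> = \<one>\<^bsub>chart_group c\<^esub>"
proof (rule ccontr)
  assume ne: "\<gamma> \<noteq> \<one>\<^bsub>chart_group c\<^esub>"
  note ch = chart[OF c]
  interpret group "chart_group c" by (rule chart_group[OF ch])
  define m where "m = ord \<gamma>"
  \<comment> \<open>As the powers of \<open>\<gamma>\<close> fix \<open>x\<close>, the cocycle of
    holonomies becomes a homomorphism on them. It is injective by \<open>holonomy_trivial\<close>,
    so \<open>B 1\<close> has order exactly \<open>m\<close>.\<close>
  define B where "B i = holonomy c (\<gamma> [^]\<^bsub>chart_group c\<^esub> i) x" for i :: nat
  have "ord \<gamma> \<noteq> 1" using ne \<gamma> ord_eq_1 by blast
  moreover have "1 \<le> ord \<gamma>" by (rule ord_ge_1[OF chart_props(3)[OF ch] \<gamma>])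
  ultimately have m: "2 \<le> m" by (simp add: m_def)
  have pow: "\<gamma> [^]\<^bsub>chart_group c\<^esub> i \<in> carrier (chart_group c)" for i :: nat using \<gamma> by simp
  have powx: "chart_act c (\<gamma> [^]\<^bsub>chart_group c\<^esub> i) x = x" for i :: nat
    unfolding chart_act_funpow[OF ch \<gamma> x] by (induction i) (simp_all add: fixed)
  have orthB: "orthogonal_matrix (B i)" for i unfolding B_def by (rule holonomy_props(1)[OF c pow x])
  have B0: "B 0 = mat 1" unfolding B_def using holonomy_one[OF c x] by simp
  have B1: "B 1 = holonomy c \<gamma> x" unfolding B_def using \<gamma> by simp
  have BSuc: "B (Suc i) = B 1 ** B i" for i
    unfolding B1 unfolding B_def nat_pow_Suc2[OF \<gamma>] holonomy_mult[OF c \<gamma> pow x] powx ..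
  have Bm: "B m = mat 1" unfolding B_def m_def pow_ord_eq_1[OF \<gamma>] by (rule holonomy_one[OF c x])
  have Bi: "B i \<noteq> mat 1" if "0 < i" "i < m" for i
  proof
    assume "B i = mat 1"
    then have "\<gamma> [^]\<^bsub>chart_group c\<^esub> i = \<one>\<^bsub>chart_group c\<^esub>"
      unfolding B_def by (rule holonomy_trivial[OF c pow x powx])
    then show False using pow_eq_id[OF \<gamma>] that dvd_imp_le[of m i] by (simp add: m_def)
  qed
  let ?t = "total_act (B 1)" and ?s = "\<sigma> (B 1)"
  have ti: "(?t ^^ i) p = total_act (B i) p" if p: "p \<in> topspace total" for i p
  proof (induction i)
    case 0
    show ?case using total_act_one[OF p] B0 by simp
  next
    case (Suc i)
    show ?case by (simp only: funpow.simps o_apply Suc total_act_mult[OF orthB orthB p] BSuc[of i])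
  qed
  have si: "(?s ^^ i) e = \<sigma> (B i) e" if e: "e \<in> topspace E" for i e
  proof (induction i)
    case 0
    show ?case using univ_props(7)[OF e] B0 by simp
  next
    case (Suc i)
    show ?case by (simp only: funpow.simps o_apply Suc univ_props(8)[OF orthB orthB e] BSuc[of i])
  qed
  have contE: "continuous_map E E (\<sigma> Q)" if "orthogonal_matrix Q" for Q
    using continuous_map_action[of E "\<lambda>_. Q" "\<lambda>e. e"] that by simp
  obtain e0 where e0: "e0 \<in> topspace E" using univ_props(3) by blast
  \<comment> \<open>The copy of \<open>E\<close> over \<open>x\<close>. Because
    \<open>\<gamma>\<close> fixes \<open>x\<close>, \<open>total_act_holonomy\<close> makes this map
    equivariant.\<close>
  let ?j = "\<lambda>e. lift c (x, e)"
  have "continuous_map E (dom c) (\<lambda>e. (x, e))" unfolding dom_def using x by (intro continuous_map_pairedI) auto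
  from continuous_map_compose[OF this continuous_map_lift[OF c]]
  have j: "continuous_map E total ?j" by (simp add: o_def)
  have j0: "?j e0 \<in> topspace total" by (rule lift_in_total[OF c x e0])
  have y0: "proj (?j e0) \<in> topspace base" using j0 by (simp add: classifying_space_eq)
  show False
  proof (rule no_free_cyclic_action[of "proj (?j e0)" ?t m E e0 ?s ?j])
    show "proj (?j e0) \<in> topspace base" by (rule y0)
    show "(f, \<lambda>_. proj (?j e0)) \<in> spheroid_homotopy i base (proj (?j e0))"
      if "1 \<le> i" "f \<in> spheroids i base (proj (?j e0))" for i f
      using contr y0 that trivial_homotopy_group_iff[OF y0, of i]
      unfolding contractible_orbifold_def orbifold_homotopy_group_def by blast
    show "compactin total {p \<in> topspace total. proj p = proj (?j e0)}" by (rule compactin_fibre[OF j0])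
    have "continuous_map total (prod_topology orth_top total) (\<lambda>p. (B 1, p))"
      using orthB by (intro continuous_map_pairedI) auto
    from continuous_map_compose[OF this continuous_map_total_act]
    show "continuous_map total total ?t" by (simp add: o_def)
    show "proj (?t p) = proj p" if "p \<in> topspace total" for p by (rule proj_total_act[OF orthB that])
    show "(?t ^^ m) p = p" if "p \<in> topspace total" for p
      unfolding ti[OF that] Bm by (rule total_act_one[OF that])
    show "2 \<le> m" by (rule m)
    show "\<exists>W. openin total W \<and> p \<in> W \<and> (\<forall>x\<in>W. \<forall>i. 0 < i \<and> i < m \<longrightarrow> (?t ^^ i) x \<notin> W)" if p: "p \<in> topspace total" for p
    proof -
      have e: "snd p \<in> topspace E" using p by (auto simp: total_def)
      have ne: "\<sigma> (B i) (snd p) \<noteq> snd p" if "i \<in> {0<..<m}" for i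
        using univ_props(5)[OF orthB e] Bi that by auto
      have ct: "continuous_map E E (\<sigma> (B i))" if "i \<in> {0<..<m}" for i by (rule contE[OF orthB])
      obtain N where N: "openin E N" "snd p \<in> N" "\<forall>i\<in>{0<..<m}. \<forall>e\<in>N. \<sigma> (B i) e \<notin> N"
        using displacing_neighbourhood[where f = "\<lambda>i. \<sigma> (B i)", OF univ_props(1) e finite_greaterThanLessThan ct ne] by blast
      \<comment> \<open>Points are already displaced in their \<open>E\<close> component, so the
        neighbourhood may contain all of the frame bundle.\<close>
      let ?W = "topspace (frame_bundle \<A> g) \<times> N"
      have "openin total ?W" unfolding total_def using N(1) by (simp add: openin_prod_Times_iff)
      moreover have "p \<in> ?W" using p N(2) by (auto simp: total_def)
      moreover have "(?t ^^ i) q \<notin> ?W" if "q \<in> ?W" "0 < i" "i < m" for q i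
      proof -
        have q: "q \<in> topspace total" using openin_subset[OF \<open>openin total ?W\<close>] that(1) by blast
        have "\<sigma> (B i) (snd q) \<notin> N" using N(3) that by auto
        then show ?thesis unfolding ti[OF q] by (simp add: mem_Times_iff snd_total_act)
      qed
      ultimately show ?thesis by (intro exI[of _ ?W]) simp
    qed
    show "contractible_space E" by (rule univ_props(2))
    show "e0 \<in> topspace E" by (rule e0)
    show "continuous_map E E ?s" by (rule contE[OF orthB])
    show "(?s ^^ m) e = e" if "e \<in> topspace E" for e
      unfolding si[OF that] Bm by (rule univ_props(7)[OF that])
    show "continuous_map E total ?j" by (rule j)
    show "?j (?s e) = ?t (?j e)" if "e \<in> topspace E" for e
      unfolding B1 total_act_holonomy[OF c \<gamma> x] by (simp add: deck_def fixed)
    show "proj (?j e0) = proj (?j e0)" ..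
  qed
qed

end

theorem theorem1p1:
  fixes X :: "'x topology"
    and \<A> :: "('n::finite, 'g, 'x) orbifold_chart set"
    and g :: "('n, 'g, 'x) orbifold_chart \<Rightarrow> real^'n \<Rightarrow> real^'n^'n"
    and E :: "'e topology"
    and \<sigma> :: "real^'n^'n \<Rightarrow> 'e \<Rightarrow> 'e"
  assumes "smooth_orbifold X \<A>"
    and "orbifold_metric \<A> g"
    and "universal_orthogonal_space E \<sigma>"
    and "contractible_orbifold \<A> g E \<sigma>"
  shows "orbifold_is_manifold \<A>"
  unfolding orbifold_is_manifold_def
proof (intro ballI)
  interpret orbifold_bundle X \<A> g E \<sigma> by unfold_locales (rule assms)+
  fix c x assume c: "c \<in> \<A>" and x: "x \<in> chart_dom c"
  note ga = chart_action[OF chart[OF c]]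
  have sub: "subgroup (stabilizer (chart_group c) (chart_act c) x) (chart_group c)"
    by (rule group_action.stabilizer_subgroup[OF ga x])
  have "stabilizer (chart_group c) (chart_act c) x \<subseteq> {\<one>\<^bsub>chart_group c\<^esub>}"
    using isotropy_trivial[OF assms(4) c x] by (auto simp: stabilizer_def)
  then have "stabilizer (chart_group c) (chart_act c) x = {\<one>\<^bsub>chart_group c\<^esub>}"
    using subgroup.one_closed[OF sub] by blast
  moreover have "group (local_group c x)"
    unfolding local_group_def by (rule subgroup.subgroup_is_group[OF sub chart_group[OF chart[OF c]]])
  ultimately show "trivial_group (local_group c x)"
    by (simp add: trivial_group_def local_group_def)
qed

end
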